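(* Let $\mathbb{K}$ be an algebraically closed field of characteristic zero and let $G\subset \mathrm{GL}(3,\mathbb{K})$ be a finite abelian group of order $d$, acting diagonally on $\mathbb{K}[x_0,x_1,x_2]$. Let $\mathcal{B}_1$ be the set of monomials of degree $d$ in $\mathbb{K}[x_0,x_1,x_2]$ that are invariant under $G$, and let $\mathrm{A}(X_{2,d}^G)\cong\mathbb{K}[\mathcal{B}_1]$. The following are equivalent: (i) $\mathrm{A}(X_{2,d}^G)$ is Koszul. (ii) $\mathcal{B}_1$ contains at least one monomial $m$ with $|\operatorname{supp}(m)|=2$. (iii) $\mathrm{A}(X_{2,d}^G)$ is quadratic.
   Context: A diagonal matrix $\operatorname{diag}(g_0,g_1,g_2)$ acts on $\mathbb{K}[x_0,x_1,x_2]$ by $x_i\mapsto g_ix_i$. For a monomial $m=x_0^{a_0}x_1^{a_1}x_2^{a_2}$, $\operatorname{supp}(m)=\{x_i\mid a_i>0\}$. Writing $\mathcal{B}_1=\{m_1,\dots,m_\mu\}$, $X_{2,d}^G\subset\mathbb{P}^{\mu-1}$ is the projective toric variety parameterized by $\mathcal{B}_1$; its homogeneous ideal $\mathrm{I}(X_{2,d}^G)$ is the kernel of $S=\mathbb{K}[w_1,\dots,w_\mu]\to\mathbb{K}[x_0,x_1,x_2]$, $w_i\mapsto m_i$, and its homogeneous coordinate ring is $\mathrm{A}(X_{2,d}^G)=S/\mathrm{I}(X_{2,d}^G)\cong\mathbb{K}[\mathcal{B}_1]$, standard graded with each $m_i$ in degree 1. The algebra is quadratic if $\mathrm{I}(X_{2,d}^G)$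 is generated by quadrics. A standard graded $\mathbb{K}$-algebra $A$ is Koszul if $\mathbb{K}=A/A_{>0}$ has a linear minimal graded free resolution over $A$.
   Formalization: The group G is assumed to have order d ≥ 2; for the trivial group (d = 1) the algebra is a polynomial ring, so (i) and (iii) hold while no monomial of degree 1 has support of size 2, and the equivalence fails. *)

theory Defs
  imports
    "HOL-Analysis.Analysis"
    "HOL-Library.Poly_Mapping"
    "HOL-Algebra.Algebra"
begin

section \<open>Polynomials\<close>

text \<open>
  A monomial in variables indexed by \<open>'v\<close> is its finitely supported exponent vector
  \<open>'v \<Rightarrow>\<^sub>0 nat\<close>; for such an \<open>m\<close>, \<open>Poly_Mapping.keys m\<close> is the support of the monomial
  and \<open>Poly_Mapping.single m 1\<close> is the monomial as a polynomial. A polynomial is a finitely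
  supported function from monomials to coefficients, with the convolution product.
\<close>

type_synonym 'v monomial = "'v \<Rightarrow>\<^sub>0 nat"
type_synonym ('v, 'k) mpoly = "'v monomial \<Rightarrow>\<^sub>0 'k"

definition mdeg :: "'v monomial \<Rightarrow> nat" where
  "mdeg m = (\<Sum>v\<in>Poly_Mapping.keys m. Poly_Mapping.lookup m v)"

text \<open>The \<open>'k\<close>-algebra homomorphism that sends the variable \<open>v\<close> to \<open>q v\<close>.\<close>

definition mpoly_subst ::
    "('v \<Rightarrow> ('w, 'k::comm_ring_1) mpoly) \<Rightarrow> ('v, 'k) mpoly \<Rightarrow> ('w, 'k) mpoly" where
  "mpoly_subst q p =
     (\<Sum>t\<in>Poly_Mapping.keys p.
        Poly_Mapping.single 0 (Poly_Mapping.lookup p t) *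
        (\<Prod>v\<in>Poly_Mapping.keys t. q v ^ Poly_Mapping.lookup t v))"

text \<open>The polynomial ring over \<open>'k\<close> in the variables indexed by the elements of \<open>V\<close>.\<close>

definition mpoly_ring :: "'v set \<Rightarrow> ('v, 'k::comm_ring_1) mpoly ring" where
  "mpoly_ring V =
     \<lparr>carrier = {p. \<forall>t\<in>Poly_Mapping.keys p. Poly_Mapping.keys t \<subseteq> V},
      mult = (*), one = 1, ring.zero = 0, add = (+)\<rparr>"

text \<open>Gradings are indexed by \<open>int\<close>; here the components of negative degree are zero.\<close>

definition mpoly_homogeneous :: "'v set \<Rightarrow> int \<Rightarrow> ('v, 'k::comm_ring_1) mpoly set" where
  "mpoly_homogeneous V n =
     {p \<in> carrier (mpoly_ring V). \<forall>t\<in>Poly_Mapping.keys p. int (mdeg t) = n}"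


section \<open>Diagonal matrix groups and invariant monomials\<close>

definition GL :: "('k::field ^ 'n ^ 'n) monoid" where
  "GL = \<lparr>carrier = {g. invertible g}, mult = (**), one = mat 1\<rparr>"

definition diagonal_matrix :: "'k::zero ^ 'n ^ 'n \<Rightarrow> bool" where
  "diagonal_matrix g \<longleftrightarrow> (\<forall>i j. i \<noteq> j \<longrightarrow> g $ i $ j = 0)"

text \<open>The action \<open>x\<^sub>i \<mapsto> g\<^sub>i x\<^sub>i\<close> of a diagonal matrix \<open>g = diag(g\<^sub>i)\<close>.\<close>

definition diag_act :: "'k::field ^ 'n ^ 'n \<Rightarrow> ('n, 'k) mpoly \<Rightarrow> ('n, 'k) mpoly" where
  "diag_act g =
     mpoly_subst (\<lambda>i. Poly_Mapping.single 0 (g $ i $ i) *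
                        Poly_Mapping.single (Poly_Mapping.single i 1) 1)"

definition invariant_monomials :: "('k::field ^ 'n ^ 'n) set \<Rightarrow> nat \<Rightarrow> 'n monomial set" where
  "invariant_monomials G d =
     {m. mdeg m = d \<and>
         (\<forall>g\<in>G. diag_act g (Poly_Mapping.single m 1) = Poly_Mapping.single m 1)}"


section \<open>Projective toric varieties parameterized by monomials\<close>

text \<open>
  The variables \<open>w\<close> of the coordinate ring of the ambient projective space are indexed by the
  monomials in \<open>B\<close> themselves, so that \<open>w\<^sub>m \<mapsto> m\<close>. The field \<open>'k\<close> occurs only in the result
  types below.
\<close>

definition toric_ideal :: "'v monomial set \<Rightarrow> ('v monomial, 'k::field) mpoly set" where
  "toric_ideal B =
     a_kernel (mpoly_ring B) (mpoly_ring (UNIV :: 'v set))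
       (mpoly_subst (\<lambda>m. Poly_Mapping.single m 1))"

definition toric_coordinate_ring ::
    "'v monomial set \<Rightarrow> ('v monomial, 'k::field) mpoly set ring" where
  "toric_coordinate_ring B = mpoly_ring B Quot toric_ideal B"

definition toric_grading ::
    "'v monomial set \<Rightarrow> int \<Rightarrow> ('v monomial, 'k::field) mpoly set set" where
  "toric_grading B n = (\<lambda>p. toric_ideal B +>\<^bsub>mpoly_ring B\<^esub> p) ` mpoly_homogeneous B n"

definition generated_by_quadrics :: "'w set \<Rightarrow> ('w, 'k::field) mpoly set \<Rightarrow> bool" where
  "generated_by_quadrics V I \<longleftrightarrow>
     (\<exists>Q \<subseteq> mpoly_homogeneous V 2. I = Idl\<^bsub>mpoly_ring V\<^esub> Q)"


section \<open>Graded free resolutions and the Koszul property\<close>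

text \<open>
  In what follows \<open>R\<close> is a commutative ring with grading \<open>A\<close>. The ideal \<open>R\<^sub>>\<^sub>0\<close> is spanned by
  the homogeneous elements of positive degree.
\<close>

definition irrelevant_ideal :: "('a, 'x) ring_scheme \<Rightarrow> (int \<Rightarrow> 'a set) \<Rightarrow> 'a set" where
  "irrelevant_ideal R A = Idl\<^bsub>R\<^esub> (\<Union>n\<in>{0<..}. A n)"

text \<open>\<open>R / R\<^sub>>\<^sub>0\<close> as a graded \<open>R\<close>-module, concentrated in degree 0.\<close>

definition residue_module ::
    "('a, 'x) ring_scheme \<Rightarrow> (int \<Rightarrow> 'a set) \<Rightarrow> ('a, 'a set) module" where
  "residue_module R A =
     ring.extend (R Quot irrelevant_ideal R A)
       \<lparr>smult = (\<lambda>a x. (irrelevant_ideal R A +>\<^bsub>R\<^esub> a) \<otimes>\<^bsub>R Quot irrelevant_ideal R A\<^esub> x)\<rparr>"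

definition residue_grading ::
    "('a, 'x) ring_scheme \<Rightarrow> (int \<Rightarrow> 'a set) \<Rightarrow> int \<Rightarrow> 'a set set" where
  "residue_grading R A n =
     (if n = 0 then carrier (residue_module R A) else {\<zero>\<^bsub>residue_module R A\<^esub>})"

definition free_carrier :: "('a, 'x) ring_scheme \<Rightarrow> nat \<Rightarrow> (nat \<Rightarrow> 'a) set" where
  "free_carrier R n = {..<n} \<rightarrow>\<^sub>E carrier R"

definition free_zero :: "('a, 'x) ring_scheme \<Rightarrow> nat \<Rightarrow> nat \<Rightarrow> 'a" where
  "free_zero R n = (\<lambda>i\<in>{..<n}. \<zero>\<^bsub>R\<^esub>)"

text \<open>The linear map \<open>R\<^sup>n \<rightarrow> R\<^sup>m\<close> with matrix \<open>D\<close>.\<close>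

definition free_map ::
    "('a, 'x) ring_scheme \<Rightarrow> nat \<Rightarrow> nat \<Rightarrow> (nat \<Rightarrow> nat \<Rightarrow> 'a) \<Rightarrow> (nat \<Rightarrow> 'a) \<Rightarrow> nat \<Rightarrow> 'a" where
  "free_map R m n D v = (\<lambda>r\<in>{..<m}. \<Oplus>\<^bsub>R\<^esub>c\<in>{..<n}. D r c \<otimes>\<^bsub>R\<^esub> v c)"

text \<open>The linear map \<open>R\<^sup>n \<rightarrow> M\<close> that sends the basis vector \<open>e\<^sub>j\<close> to \<open>u j\<close>.\<close>

definition augmentation_map ::
    "('a, 'm, 'x) module_scheme \<Rightarrow> nat \<Rightarrow> (nat \<Rightarrow> 'm) \<Rightarrow> (nat \<Rightarrow> 'a) \<Rightarrow> 'm" where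
  "augmentation_map M n u v = (\<Oplus>\<^bsub>M\<^esub>j\<in>{..<n}. v j \<odot>\<^bsub>M\<^esub> u j)"

text \<open>
  \<open>\<dots> \<rightarrow> F\<^sub>2 \<rightarrow> F\<^sub>1 \<rightarrow> F\<^sub>0 \<rightarrow> M \<rightarrow> 0\<close> is a graded free resolution of the module \<open>M\<close> with grading
  \<open>N\<close>, where \<open>F\<^sub>i = \<Oplus>\<^sub>j R(- s i j)\<close> has the finite rank \<open>b i\<close>, that is, its \<open>j\<close>-th basis
  vector has degree \<open>s i j\<close>. \<open>D i\<close> is the matrix of \<open>F\<^sub>i\<^sub>+\<^sub>1 \<rightarrow> F\<^sub>i\<close>, and \<open>u\<close> gives
  \<open>F\<^sub>0 \<rightarrow> M\<close>; the first two conditions say that these maps are homogeneous of degree 0.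
\<close>

definition graded_free_resolution ::
    "('a, 'x) ring_scheme \<Rightarrow> (int \<Rightarrow> 'a set) \<Rightarrow>
     ('a, 'm, 'y) module_scheme \<Rightarrow> (int \<Rightarrow> 'm set) \<Rightarrow>
     (nat \<Rightarrow> nat) \<Rightarrow> (nat \<Rightarrow> nat \<Rightarrow> int) \<Rightarrow>
     (nat \<Rightarrow> 'm) \<Rightarrow> (nat \<Rightarrow> nat \<Rightarrow> nat \<Rightarrow> 'a) \<Rightarrow> bool" where
  "graded_free_resolution R A M N b s u D \<longleftrightarrow>
     (\<forall>j < b 0. u j \<in> N (s 0 j)) \<and>
     (\<forall>i. \<forall>r < b i. \<forall>c < b (Suc i). D i r c \<in> A (s (Suc i) c - s i r)) \<and>
     augmentation_map M (b 0) u ` free_carrier R (b 0) = carrier M \<and>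
     {v \<in> free_carrier R (b 0). augmentation_map M (b 0) u v = \<zero>\<^bsub>M\<^esub>} =
       free_map R (b 0) (b 1) (D 0) ` free_carrier R (b 1) \<and>
     (\<forall>i. {v \<in> free_carrier R (b (Suc i)).
             free_map R (b i) (b (Suc i)) (D i) v = free_zero R (b i)} =
          free_map R (b (Suc i)) (b (Suc (Suc i))) (D (Suc i)) ` free_carrier R (b (Suc (Suc i))))"

text \<open>Minimality: the image of \<open>F\<^sub>i\<^sub>+\<^sub>1\<close> lies in \<open>R\<^sub>>\<^sub>0 F\<^sub>i\<close>.\<close>

definition minimal_graded_free_resolution ::
    "('a, 'x) ring_scheme \<Rightarrow> (int \<Rightarrow> 'a set) \<Rightarrow>
     ('a, 'm, 'y) module_scheme \<Rightarrow> (int \<Rightarrow> 'm set) \<Rightarrow>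
     (nat \<Rightarrow> nat) \<Rightarrow> (nat \<Rightarrow> nat \<Rightarrow> int) \<Rightarrow>
     (nat \<Rightarrow> 'm) \<Rightarrow> (nat \<Rightarrow> nat \<Rightarrow> nat \<Rightarrow> 'a) \<Rightarrow> bool" where
  "minimal_graded_free_resolution R A M N b s u D \<longleftrightarrow>
     graded_free_resolution R A M N b s u D \<and>
     (\<forall>i. \<forall>r < b i. \<forall>c < b (Suc i). D i r c \<in> irrelevant_ideal R A)"

text \<open>A resolution is linear if \<open>F\<^sub>i\<close> is generated in degree \<open>i\<close>.\<close>

definition koszul :: "('a, 'x) ring_scheme \<Rightarrow> (int \<Rightarrow> 'a set) \<Rightarrow> bool" where
  "koszul R A \<longleftrightarrow>
     (\<exists>b s u D.
        minimal_graded_free_resolution R A (residue_module R A) (residue_grading R A) b s u D \<and>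
        (\<forall>i. \<forall>j < b i. s i j = int i))"

end

theory Submission
  imports Defs
begin

text \<open>
  The invariant monomials of degree \<open>d\<close> are the points of a lattice in a triangle whose vertices
  are the \<open>x\<^sub>i\<^sup>d\<close>, and (ii) says that some lattice point lies in the interior of an edge.

  (ii) \<open>\<Longrightarrow>\<close> (i). Let \<open>F\<close> be a set of lists of monomials such that every colon ideal
  \<open>(z\<^sub>1,\<dots>,z\<^sub>j\<^sub>-\<^sub>1) : z\<^sub>j\<close> of a list in \<open>F\<close> is generated by a list in \<open>F\<close> (a Koszul filtration).
  If all successive colon ideals of a list of vectors are generated by lists in \<open>F\<close>, then the
  syzygy module is generated by a list of linear vectors with the same property, so iteration
  yields a linear resolution. To find \<open>F\<close>, divide the edge into equal lattice segments, erect on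
  each of them a triangle similar to the whole one, and let the core consist of the lattice points
  of these small triangles and the vertices. The product of two core monomials is divisible by a
  vertex or by a fixed monomial \<open>e\<close> on the edge, and every element of degree at least 2 is divisible
  by a core monomial. Hence all colon ideals contain the core as soon as the list starts with the
  vertices and \<open>e\<close>, and they are generated in degree 1.

  (i) \<open>\<Longrightarrow>\<close> (iii). The syzygies of the generators are generated by linear ones, so that a relation of
  degree at least 3 reduces to relations of smaller degree and quadrics.

  (iii) \<open>\<Longrightarrow>\<close> (ii). A lattice point other than the vertices exists since the lattice has index at
  most \<open>d\<close>. If the edges contain no further lattice points, then the product of the three vertices
  equals a product of three inner points, while a quadric in the toric ideal cannot
  involve the product of two different vertices.
\<close>

section \<open>Modules with linear quotients\<close>

text \<open>The obstacle is that a colon ideal of monomials may need generators of degree 2 or more.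
  The core is built to prevent this. It is large enough that each element of degree at least 2 has a
  divisor in it, and small enough that products of two members stay in the ideal of the vertices and
  \<open>e\<close>. Let the segments have length \<open>g\<close> and \<open>d = k g\<close>. A core
  point over segment number \<open>i\<close> has \<open>b >= i g\<close> and
  \<open>a >= d - (i + 1) g\<close>. If the product of points over segments \<open>i\<close> and
  \<open>j\<close> is divisible by neither end of the edge, then \<open>i + j = k - 1\<close>, and
  \<open>2 g <= d\<close> leaves just enough room for the single monomial
  \<open>e = (g, d - g, 0)\<close>. Comparing exponents decides divisibility in the algebra only if
  the monomials of degree \<open>d\<close> generate all lattice points of degree a multiple of
  \<open>d\<close>; this follows from the same covering property. Linearity passes from one syzygy
  module to the next because a generator \<open>z\<close> of a colon ideal lifts to a syzygy whose
  colon ideal is again that of \<open>z\<close>. For the index of the lattice, orthogonality of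
  characters counts the invariant exponents modulo \<open>d\<close>; the count takes place in the
  field and is read off thanks to characteristic zero.\<close>

text \<open>Of the grading of \<open>R\<close> only the projections \<open>\<pi>\<^sub>1\<close> and \<open>\<pi>\<^sub>2\<close> to the components of degree 1 and 2
  are needed.\<close>

locale linear_pieces =
  fixes R A\<^sub>1 :: "'a::comm_ring_1 set" and \<pi>\<^sub>1 \<pi>\<^sub>2 :: "'a \<Rightarrow> 'a"
  assumes R_1 [simp]: "1 \<in> R"
    and R_diff: "a \<in> R \<Longrightarrow> b \<in> R \<Longrightarrow> a - b \<in> R"
    and R_mult: "a \<in> R \<Longrightarrow> b \<in> R \<Longrightarrow> a * b \<in> R"
    and A_R: "a \<in> A\<^sub>1 \<Longrightarrow> a \<in> R"
    and A_0: "0 \<in> A\<^sub>1"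
    and A_uminus: "a \<in> A\<^sub>1 \<Longrightarrow> - a \<in> A\<^sub>1"
    and \<pi>\<^sub>1_A: "a \<in> R \<Longrightarrow> \<pi>\<^sub>1 a \<in> A\<^sub>1"
    and \<pi>\<^sub>2_add: "\<pi>\<^sub>2 (a + b) = \<pi>\<^sub>2 a + \<pi>\<^sub>2 b"
    and \<pi>\<^sub>2_mult: "a \<in> R \<Longrightarrow> x \<in> A\<^sub>1 \<Longrightarrow> \<pi>\<^sub>2 (a * x) = \<pi>\<^sub>1 a * x"
    and \<pi>\<^sub>2_quadric: "a \<in> A\<^sub>1 \<Longrightarrow> x \<in> A\<^sub>1 \<Longrightarrow> \<pi>\<^sub>2 (a * x) = a * x"
begin

lemma R_0 [simp]: "0 \<in> R"
  using R_diff[OF R_1 R_1] by simp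

lemma R_uminus: "a \<in> R \<Longrightarrow> - a \<in> R"
  using R_diff[of 0 a] by simp

lemma R_add: "a \<in> R \<Longrightarrow> b \<in> R \<Longrightarrow> a + b \<in> R"
  using R_diff[of a "- b"] R_uminus by simp

lemma \<pi>\<^sub>2_0 [simp]: "\<pi>\<^sub>2 0 = 0"
  using \<pi>\<^sub>2_add[of 0 0] by simp

lemma \<pi>\<^sub>2_sum: "\<pi>\<^sub>2 (sum f I) = (\<Sum>i\<in>I. \<pi>\<^sub>2 (f i))"
  by (induction I rule: infinite_finite_induct) (auto simp: \<pi>\<^sub>2_add)

text \<open>Vectors are total functions vanishing beyond their length, so that the free modules
  \<open>R\<^sup>n\<close> form an increasing chain.\<close>

definition lin_comb :: "(nat \<Rightarrow> 'a) \<Rightarrow> (nat \<Rightarrow> 'a) list \<Rightarrow> nat \<Rightarrow> 'a" where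
  "lin_comb a L = (\<lambda>i. \<Sum>l<length L. a l * (L ! l) i)"

definition free_module :: "nat \<Rightarrow> (nat \<Rightarrow> 'a) set" where
  "free_module n = {a. (\<forall>l. a l \<in> R) \<and> (\<forall>l\<ge>n. a l = 0)}"

definition module_span :: "(nat \<Rightarrow> 'a) list \<Rightarrow> (nat \<Rightarrow> 'a) set" where
  "module_span L = (\<lambda>a. lin_comb a L) ` free_module (length L)"

definition syzygies :: "(nat \<Rightarrow> 'a) list \<Rightarrow> (nat \<Rightarrow> 'a) set" where
  "syzygies L = {a \<in> free_module (length L). lin_comb a L = (\<lambda>i. 0)}"

definition ideal_span :: "'a list \<Rightarrow> 'a set" where
  "ideal_span Z = {\<Sum>l<length Z. a l * Z ! l |a. \<forall>l. a l \<in> R}"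

text \<open>Although \<open>L\<close> consists of vectors, its colon ideals are ideals of
  \<open>R\<close>. Hence one family \<open>F\<close> of ideals can control all syzygy modules of a
  resolution at once.\<close>

definition linear_quotients :: "'a list set \<Rightarrow> (nat \<Rightarrow> 'a) list \<Rightarrow> bool" where
  "linear_quotients F L \<longleftrightarrow>
     (\<forall>j<length L. (\<forall>i. (L ! j) i \<in> A\<^sub>1) \<and>
        (\<exists>Z\<in>F. \<forall>r\<in>R. (\<lambda>i. r * (L ! j) i) \<in> module_span (take j L) \<longleftrightarrow> r \<in> ideal_span Z))"

definition ideal_quotients :: "'a list set \<Rightarrow> 'a list \<Rightarrow> bool" where
  "ideal_quotients F Y \<longleftrightarrow>
     (\<forall>j<length Y. Y ! j \<in> A\<^sub>1 \<and>
        (\<exists>Z\<in>F. \<forall>r\<in>R. r * Y ! j \<in> ideal_span (take j Y) \<longleftrightarrow> r \<in> ideal_span Z))"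

lemma module_spanI: "(\<And>l. l < length L \<Longrightarrow> a l \<in> R) \<Longrightarrow> lin_comb a L \<in> module_span L"
  unfolding module_span_def
  by (rule image_eqI[where x = "\<lambda>l. if l < length L then a l else 0"])
     (auto simp: lin_comb_def free_module_def intro!: sum.cong)

lemma module_spanE:
  assumes "v \<in> module_span L"
  obtains a where "a \<in> free_module (length L)" "v = lin_comb a L"
  using assms unfolding module_span_def by auto

lemma module_span_snoc:
  "v \<in> module_span (L @ [c]) \<longleftrightarrow> (\<exists>r\<in>R. (\<lambda>i. v i - r * c i) \<in> module_span L)"
proof
  assume "v \<in> module_span (L @ [c])"
  then obtain a where a: "a \<in> free_module (length (L @ [c]))" "v = lin_comb a (L @ [c])"
    by (rule module_spanE)
  have "(\<lambda>i. v i - a (length L) * c i) = lin_comb a L"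
    using a(2) by (auto simp: lin_comb_def nth_append)
  moreover have "lin_comb a L \<in> module_span L"
    using a(1) by (intro module_spanI) (auto simp: free_module_def)
  ultimately show "\<exists>r\<in>R. (\<lambda>i. v i - r * c i) \<in> module_span L"
    using a(1) by (intro bexI[of _ "a (length L)"]) (auto simp: free_module_def)
next
  assume "\<exists>r\<in>R. (\<lambda>i. v i - r * c i) \<in> module_span L"
  then obtain r a where r: "r \<in> R" and a: "a \<in> free_module (length L)"
    "(\<lambda>i. v i - r * c i) = lin_comb a L"
    by (auto elim!: module_spanE)
  have "v i = lin_comb (a(length L := r)) (L @ [c]) i" for i
    using fun_cong[OF a(2), of i] by (auto simp: lin_comb_def nth_append algebra_simps)
  then have "v = lin_comb (a(length L := r)) (L @ [c])" ..
  then show "v \<in> module_span (L @ [c])"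
    using r a(1) by (auto simp: free_module_def intro!: module_spanI)
qed

lemma ideal_span_Nil [simp]: "ideal_span [] = {0}"
  by (auto simp: ideal_span_def intro!: exI[of _ "\<lambda>_. 0"])

lemma ideal_span_snoc:
  "x \<in> ideal_span (Z @ [z]) \<longleftrightarrow> (\<exists>r\<in>R. x - r * z \<in> ideal_span Z)"
proof
  assume "x \<in> ideal_span (Z @ [z])"
  then obtain a where "\<forall>l. a l \<in> R" "x = (\<Sum>l<Suc (length Z). a l * (Z @ [z]) ! l)"
    by (auto simp: ideal_span_def)
  then show "\<exists>r\<in>R. x - r * z \<in> ideal_span Z"
    by (intro bexI[of _ "a (length Z)"]) (auto simp: ideal_span_def nth_append)
next
  assume "\<exists>r\<in>R. x - r * z \<in> ideal_span Z"
  then obtain r a where r: "r \<in> R" and a: "\<forall>l. a l \<in> R" "x - r * z = (\<Sum>l<length Z. a l * Z ! l)"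
    by (auto simp: ideal_span_def)
  have "x = (\<Sum>l<length (Z @ [z]). (a(length Z := r)) l * (Z @ [z]) ! l)"
    using a(2) by (auto simp: nth_append algebra_simps)
  then show "x \<in> ideal_span (Z @ [z])"
    using r a(1) unfolding ideal_span_def
    by (intro CollectI exI[of _ "a(length Z := r)"]) (auto simp del: fun_upd_apply simp: fun_upd_def)
qed

lemma linear_quotients_snoc:
  "linear_quotients F (L @ [c]) \<longleftrightarrow> linear_quotients F L \<and> (\<forall>i. c i \<in> A\<^sub>1) \<and>
     (\<exists>Z\<in>F. \<forall>r\<in>R. (\<lambda>i. r * c i) \<in> module_span L \<longleftrightarrow> r \<in> ideal_span Z)"
  by (simp add: linear_quotients_def All_less_Suc nth_append cong: imp_cong conj_cong) (auto simp: less_Suc_eq)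

lemma ideal_quotients_snoc:
  "ideal_quotients F (Y @ [z]) \<longleftrightarrow> ideal_quotients F Y \<and> z \<in> A\<^sub>1 \<and>
     (\<exists>Z\<in>F. \<forall>r\<in>R. r * z \<in> ideal_span Y \<longleftrightarrow> r \<in> ideal_span Z)"
  by (simp add: ideal_quotients_def All_less_Suc nth_append cong: imp_cong conj_cong) (auto simp: less_Suc_eq)

lemma syzygies_snoc:
  "a \<in> syzygies (L @ [c]) \<Longrightarrow> a (length L) = 0 \<Longrightarrow> a \<in> syzygies L"
  "a \<in> syzygies L \<Longrightarrow> a \<in> syzygies (L @ [c])"
proof -
  show "a \<in> syzygies (L @ [c]) \<Longrightarrow> a (length L) = 0 \<Longrightarrow> a \<in> syzygies L"
    by (auto simp: syzygies_def free_module_def lin_comb_def nth_append fun_eq_iff)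
       (metis le_neq_implies_less Suc_leI)
  show "a \<in> syzygies L \<Longrightarrow> a \<in> syzygies (L @ [c])"
    by (auto simp: syzygies_def free_module_def lin_comb_def nth_append fun_eq_iff)
qed

lemma syzygies_diff_mult:
  assumes "a \<in> syzygies L" "b \<in> syzygies L" "r \<in> R"
  shows "(\<lambda>l. a l - r * b l) \<in> syzygies L"
proof -
  have "(\<Sum>l<length L. (a l - r * b l) * (L ! l) i)
      = (\<Sum>l<length L. a l * (L ! l) i) - r * (\<Sum>l<length L. b l * (L ! l) i)" for i
    by (simp add: algebra_simps sum_subtractf sum_distrib_left)
  then show ?thesis
    using assms by (auto simp: syzygies_def free_module_def lin_comb_def fun_eq_iff intro!: R_diff R_mult)
qed

text \<open>The products \<open>z * c i\<close> and the entries of \<open>L\<close> are homogeneous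
  of degrees 2 and 1. Projecting an arbitrary representation of \<open>z * c\<close> to degree 2
  therefore replaces each coefficient by its linear part.\<close>

lemma syzygy_lift:
  assumes L: "\<forall>j<length L. \<forall>i. (L ! j) i \<in> A\<^sub>1" and c: "\<forall>i. c i \<in> A\<^sub>1" and z: "z \<in> A\<^sub>1"
    and mem: "(\<lambda>i. z * c i) \<in> module_span L"
  obtains s where "s \<in> syzygies (L @ [c])" "s (length L) = z" "\<forall>i. s i \<in> A\<^sub>1"
proof -
  obtain a where a: "a \<in> free_module (length L)" "(\<lambda>i. z * c i) = lin_comb a L"
    using mem by (rule module_spanE)
  have "z * c i = (\<Sum>l<length L. \<pi>\<^sub>1 (a l) * (L ! l) i)" for i
  proof -
    have "z * c i = \<pi>\<^sub>2 (z * c i)"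
      using z c by (simp add: \<pi>\<^sub>2_quadric)
    also have "\<dots> = \<pi>\<^sub>2 (\<Sum>l<length L. a l * (L ! l) i)"
      using fun_cong[OF a(2), of i] by (simp add: lin_comb_def)
    also have "\<dots> = (\<Sum>l<length L. \<pi>\<^sub>1 (a l) * (L ! l) i)"
      using a(1) L by (auto simp: \<pi>\<^sub>2_sum free_module_def intro!: sum.cong \<pi>\<^sub>2_mult)
    finally show ?thesis .
  qed
  note eq = this
  define s where "s = (\<lambda>l. if l < length L then - \<pi>\<^sub>1 (a l) else if l = length L then z else 0)"
  have "\<forall>i. s i \<in> A\<^sub>1"
    using a(1) z by (auto simp: s_def free_module_def A_0 intro: A_uminus \<pi>\<^sub>1_A)
  moreover have "s \<in> syzygies (L @ [c])"
    using calculation by (auto simp: syzygies_def free_module_def lin_comb_def nth_append s_def eq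
        fun_eq_iff sum_negf A_R)
  ultimately show ?thesis
    using that[of s] by (simp add: s_def)
qed

lemma linear_quotients_linear: "linear_quotients F L \<Longrightarrow> \<forall>j<length L. \<forall>i. (L ! j) i \<in> A\<^sub>1"
  by (auto simp: linear_quotients_def)

text \<open>Start from \<open>M\<close>, which generates the syzygies with last coordinate 0, and
  adjoin a linear lift \<open>s\<close> of each member \<open>z\<close> of \<open>Y\<close>. A
  multiple \<open>r * s\<close> lies in the span of the earlier vectors iff its last coordinate
  \<open>r * z\<close> lies in the ideal of the earlier members of \<open>Y\<close>, so the new
  colon ideals are exactly those of \<open>Y\<close>.\<close>

lemma syzygies_extend:
  assumes L: "\<forall>j<length L. \<forall>i. (L ! j) i \<in> A\<^sub>1" and c: "\<forall>i. c i \<in> A\<^sub>1"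
    and M: "linear_quotients F M" "module_span M = syzygies L"
    and Y: "ideal_quotients F Y" "\<forall>j<length Y. (\<lambda>i. Y ! j * c i) \<in> module_span L"
  shows "\<exists>N. linear_quotients F N \<and>
     module_span N = {v \<in> syzygies (L @ [c]). v (length L) \<in> ideal_span Y}"
  using Y
proof (induction Y rule: rev_induct)
  case Nil
  have "v (length L) = 0" if "v \<in> syzygies L" for v
    using that by (auto simp: syzygies_def free_module_def)
  then have "syzygies L = {v \<in> syzygies (L @ [c]). v (length L) = 0}"
    using syzygies_snoc[where L = L and c = c] by blast
  then show ?case
    using M by (intro exI[of _ M]) simp
next
  case (snoc z Y)
  have "\<forall>j<length Y. (\<lambda>i. Y ! j * c i) \<in> module_span L"
    using snoc.prems(2) by (auto simp: nth_append less_Suc_eq)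
  moreover from snoc.prems(1) obtain Z where Y: "ideal_quotients F Y" and z: "z \<in> A\<^sub>1"
    and Z: "Z \<in> F" "\<forall>r\<in>R. r * z \<in> ideal_span Y \<longleftrightarrow> r \<in> ideal_span Z"
    by (auto simp: ideal_quotients_snoc)
  ultimately obtain N where N: "linear_quotients F N"
    "module_span N = {v \<in> syzygies (L @ [c]). v (length L) \<in> ideal_span Y}"
    using snoc.IH by blast
  have "(\<lambda>i. z * c i) \<in> module_span L"
    using snoc.prems(2) by (auto dest: spec[of _ "length Y"])
  then obtain s where s: "s \<in> syzygies (L @ [c])" "s (length L) = z" "\<forall>i. s i \<in> A\<^sub>1"
    using syzygy_lift[OF L c z] by blast
  have "(\<lambda>i. r * s i) \<in> module_span N \<longleftrightarrow> r \<in> ideal_span Z" if "r \<in> R" for r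
  proof -
    have "(\<lambda>i. 0 - (- r) * s i) \<in> syzygies (L @ [c])"
      using that by (intro syzygies_diff_mult s R_uminus) (auto simp: syzygies_def free_module_def lin_comb_def)
    then show ?thesis
      using that Z s by (simp add: N)
  qed
  then have "linear_quotients F (N @ [s])"
    using N(1) s(3) Z(1) by (auto simp: linear_quotients_snoc)
  moreover have "module_span (N @ [s]) = {v \<in> syzygies (L @ [c]). v (length L) \<in> ideal_span (Y @ [z])}"
  proof -
    have "(\<lambda>i. v i - r * s i) \<in> syzygies (L @ [c]) \<longleftrightarrow> v \<in> syzygies (L @ [c])" if "r \<in> R" for r v
      using syzygies_diff_mult[OF _ s(1) that, of v]
        syzygies_diff_mult[OF _ s(1) R_uminus[OF that], of "\<lambda>i. v i - r * s i"] by auto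
    then show ?thesis
      by (auto simp: module_span_snoc ideal_span_snoc N s(2))
  qed
  ultimately show ?case
    by blast
qed

lemma ideal_span_nth: "j < length Y \<Longrightarrow> Y ! j \<in> ideal_span Y"
  unfolding ideal_span_def
  by (intro CollectI exI[of _ "\<lambda>l. if l = j then 1 else 0"])
     (auto simp: if_distrib[where f = "\<lambda>x. x * _"] cong: if_cong)

text \<open>The last coordinates of the syzygies of \<open>L @ [c]\<close> lie in the colon ideal of
  the span of \<open>L\<close> by \<open>c\<close>. That ideal is generated by some \<open>Z\<close>
  in \<open>F\<close>, whose own colon ideals are again generated by lists in \<open>F\<close>, so
  \<open>syzygies_extend\<close> applies with \<open>Y = Z\<close>.\<close>

lemma syzygies_linear_quotients:
  assumes F: "\<And>Z. Z \<in> F \<Longrightarrow> ideal_quotients F Z" and L: "linear_quotients F L"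
  shows "\<exists>M. linear_quotients F M \<and> module_span M = syzygies L"
  using L
proof (induction L rule: rev_induct)
  case Nil
  have "linear_quotients F []" "module_span [] = syzygies []"
    by (auto simp: linear_quotients_def module_span_def syzygies_def lin_comb_def free_module_def)
  then show ?case by blast
next
  case (snoc c L)
  then obtain M Z where L: "linear_quotients F L" and c: "\<forall>i. c i \<in> A\<^sub>1"
    and M: "linear_quotients F M" "module_span M = syzygies L"
    and Z: "Z \<in> F" "\<forall>r\<in>R. (\<lambda>i. r * c i) \<in> module_span L \<longleftrightarrow> r \<in> ideal_span Z"
    by (auto simp: linear_quotients_snoc)
  have "Z ! j \<in> R" if "j < length Z" for j
    using F[OF Z(1)] that A_R by (auto simp: ideal_quotients_def)
  then have "\<forall>j<length Z. (\<lambda>i. Z ! j * c i) \<in> module_span L"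
    using Z(2) by (auto intro: ideal_span_nth)
  then obtain N where N: "linear_quotients F N"
    "module_span N = {v \<in> syzygies (L @ [c]). v (length L) \<in> ideal_span Z}"
    using syzygies_extend[OF linear_quotients_linear[OF L] c M F[OF Z(1)]] by blast
  have "v (length L) \<in> ideal_span Z" if "v \<in> syzygies (L @ [c])" for v
  proof -
    have v: "v l \<in> R" for l
      using that by (auto simp: syzygies_def free_module_def)
    have "lin_comb (\<lambda>l. - v l) L \<in> module_span L"
      using v by (intro module_spanI R_uminus)
    also have "lin_comb (\<lambda>l. - v l) L = (\<lambda>i. v (length L) * c i)"
      using that by (auto simp: syzygies_def lin_comb_def fun_eq_iff nth_append sum_negf
          neg_eq_iff_add_eq_0 add.commute)
    finally show ?thesis
      using Z(2) v by auto
  qed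
  then show ?case
    using N by auto
qed

text \<open>An ideal is a submodule of the free module of rank one, with coordinate 0 as the only
  one in use. This starts the resolution.\<close>

lemma ideal_quotients_linear_quotients:
  assumes "ideal_quotients F Y"
  shows "linear_quotients F (map (\<lambda>y i. if i = 0 then y else 0) Y)"
proof -
  have "(\<lambda>i. if i = 0 then x else 0) \<in> module_span (map (\<lambda>y i. if i = 0 then y else 0) Y)
      \<longleftrightarrow> x \<in> ideal_span Y" for x :: 'a and Y
  proof (induction Y arbitrary: x rule: rev_induct)
    case Nil
    have "free_module 0 = {\<lambda>_. 0}"
      by (auto simp: free_module_def)
    then show ?case
      by (auto simp: module_span_def lin_comb_def fun_eq_iff)
  next
    case (snoc z Y)
    have *: "(\<lambda>i. (if i = 0 then x else 0) - r * (if i = 0 then z else 0))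
        = (\<lambda>i::nat. if i = 0 then x - r * z else 0)" for r
      by auto
    show ?case
      by (simp add: module_span_snoc ideal_span_snoc * snoc.IH)
  qed
  note span = this
  have "(\<lambda>i. r * (if i = 0 then y else 0)) = (\<lambda>i::nat. if i = 0 then r * y else 0)" for r y :: 'a
    by auto
  then show ?thesis
    using assms by (simp add: linear_quotients_def ideal_quotients_def take_map span A_0)
qed

lemma ideal_span_add:
  assumes "x \<in> ideal_span Z" "y \<in> ideal_span Z"
  shows "x + y \<in> ideal_span Z"
proof -
  obtain a b where "\<forall>l. a l \<in> R" "x = (\<Sum>l<length Z. a l * Z ! l)"
    "\<forall>l. b l \<in> R" "y = (\<Sum>l<length Z. b l * Z ! l)"
    using assms by (auto simp: ideal_span_def)
  then show ?thesis
    unfolding ideal_span_def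
    by (intro CollectI exI[of _ "\<lambda>l. a l + b l"]) (auto simp: algebra_simps sum.distrib intro: R_add)
qed

lemma ideal_span_mult_nth:
  assumes "j < length Z" "a \<in> R"
  shows "a * Z ! j \<in> ideal_span Z"
  using assms unfolding ideal_span_def
  by (intro CollectI exI[of _ "\<lambda>l. if l = j then a else 0"])
     (auto simp: if_distrib[where f = "\<lambda>x. x * _"] cong: if_cong)

lemma module_span_nth:
  assumes "j < length L"
  shows "L ! j \<in> module_span L"
proof -
  have "lin_comb (\<lambda>l. if l = j then 1 else 0) L = L ! j"
    using assms by (auto simp: lin_comb_def fun_eq_iff if_distrib[where f = "\<lambda>x. x * _"] cong: if_cong)
  then show ?thesis
    using module_spanI[of L "\<lambda>l. if l = j then 1 else 0"] by auto
qed

text \<open>\<open>L i\<close> is to be read as the list of columns of the \<open>i\<close>-th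
  differential; \<open>L 0\<close> is the row of the generators \<open>Y\<close>.\<close>

theorem linear_resolution:
  assumes F: "\<And>Z. Z \<in> F \<Longrightarrow> ideal_quotients F Z" and Y: "Y \<in> F"
  obtains L :: "nat \<Rightarrow> (nat \<Rightarrow> 'a) list"
  where "L 0 = map (\<lambda>y i. if i = 0 then y else 0) Y"
    and "\<And>i j r. j < length (L i) \<Longrightarrow> (L i ! j) r \<in> A\<^sub>1"
    and "\<And>i. module_span (L (Suc i)) = syzygies (L i)"
proof -
  obtain L where L: "L 0 = map (\<lambda>y i. if i = 0 then y else 0) Y"
    "\<And>i. linear_quotients F (L i) \<and> module_span (L (Suc i)) = syzygies (L i)"
  proof -
    have "\<exists>L. L 0 = map (\<lambda>y i. if i = 0 then y else 0) Y \<and>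
        (\<forall>i. linear_quotients F (L i) \<and> module_span (L (Suc i)) = syzygies (L i))"
    proof -
      let ?next = "\<lambda>L. SOME M. linear_quotients F M \<and> module_span M = syzygies L"
      define L where "L = rec_nat (map (\<lambda>y i. if i = 0 then y else 0) Y) (\<lambda>_. ?next)"
      have step: "linear_quotients F (?next M) \<and> module_span (?next M) = syzygies M"
        if "linear_quotients F M" for M
        using someI_ex[OF syzygies_linear_quotients[OF F that]] by simp
      have LQ: "linear_quotients F (L i)" for i
        using ideal_quotients_linear_quotients[OF F[OF Y]] step by (induction i) (auto simp: L_def)
      then show ?thesis
        using step by (intro exI[of _ L]) (auto simp: L_def)
    qed
    then show ?thesis
      using that by blast
  qed
  then show ?thesis
    using that linear_quotients_linear by blast
qed

end

section \<open>Graded free resolutions and ring isomorphisms\<close>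

text \<open>The coordinate ring consists of cosets. The isomorphism \<open>h\<close> moves
  computations with sums and matrices to a subring \<open>T\<close> of a type class ring, where the
  usual algebra of sums is available.\<close>

locale ring_model = cring R for R :: "('a, 'x) ring_scheme" (structure) +
  fixes h :: "'a \<Rightarrow> 'b::comm_ring_1" and T :: "'b set"
  assumes h_bij: "bij_betw h (carrier R) T"
    and h_add: "x \<in> carrier R \<Longrightarrow> y \<in> carrier R \<Longrightarrow> h (x \<oplus> y) = h x + h y"
    and h_mult: "x \<in> carrier R \<Longrightarrow> y \<in> carrier R \<Longrightarrow> h (x \<otimes> y) = h x * h y"
    and h_one: "h \<one> = 1"
begin

abbreviation h' :: "'b \<Rightarrow> 'a" where "h' \<equiv> inv_into (carrier R) h"

lemma h_zero: "h \<zero> = 0"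
  using h_add[of \<zero> \<zero>] by simp

lemma h_in: "x \<in> carrier R \<Longrightarrow> h x \<in> T"
  using h_bij by (auto simp: bij_betw_def)

lemma h'_in: "y \<in> T \<Longrightarrow> h' y \<in> carrier R"
  using h_bij by (auto simp: bij_betw_def intro!: inv_into_into)

lemma h_h': "y \<in> T \<Longrightarrow> h (h' y) = y"
  using h_bij by (auto simp: bij_betw_def intro!: f_inv_into_f)

lemma h'_h: "x \<in> carrier R \<Longrightarrow> h' (h x) = x"
  using h_bij by (auto simp: bij_betw_def intro!: inv_into_f_f)

lemma h_inj: "x \<in> carrier R \<Longrightarrow> y \<in> carrier R \<Longrightarrow> h x = h y \<longleftrightarrow> x = y"
  using h_bij by (auto simp: bij_betw_def inj_on_def)

lemma h_finsum: "finite I \<Longrightarrow> f \<in> I \<rightarrow> carrier R \<Longrightarrow> h (\<Oplus>i\<in>I. f i) = (\<Sum>i\<in>I. h (f i))"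
  by (induction I rule: finite_induct) (auto simp: h_zero h_add Pi_iff)

lemma T_zero: "0 \<in> T"
  using h_in[of \<zero>] by (simp add: h_zero)

lemma free_map_in:
  assumes "\<And>r c. r < m \<Longrightarrow> c < n \<Longrightarrow> D r c \<in> carrier R" "v \<in> free_carrier R n"
  shows "free_map R m n D v \<in> free_carrier R m"
  using assms by (auto simp: free_map_def free_carrier_def Pi_iff PiE_iff intro!: finsum_closed)

lemma h_free_map:
  assumes "\<And>r c. r < m \<Longrightarrow> c < n \<Longrightarrow> D r c \<in> carrier R" "v \<in> free_carrier R n" "r < m"
  shows "h (free_map R m n D v r) = (\<Sum>c<n. h (D r c) * h (v c))"
proof -
  have v: "v c \<in> carrier R" if "c < n" for c
    using assms(2) that by (auto simp: free_carrier_def PiE_iff)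
  have "h (free_map R m n D v r) = (\<Sum>c<n. h (D r c \<otimes> v c))"
    using assms v by (simp add: free_map_def h_finsum Pi_iff)
  then show ?thesis
    using assms v by (simp add: h_mult)
qed

text \<open>Members of \<open>free_carrier\<close> are extensional, so only the indices below
  \<open>m\<close> matter, and there \<open>h\<close> is injective.\<close>

lemma free_carrier_eqI:
  assumes "v \<in> free_carrier R m" "w \<in> free_carrier R m" "\<And>r. r < m \<Longrightarrow> h (v r) = h (w r)"
  shows "v = w"
proof
  fix r
  show "v r = w r"
  proof (cases "r < m")
    case True
    then show ?thesis
      using assms by (auto simp: free_carrier_def PiE_iff h_inj)
  qed (use assms in \<open>auto simp: free_carrier_def PiE_iff extensional_def\<close>)
qed

lemma free_zero_in: "free_zero R m \<in> free_carrier R m"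
  by (auto simp: free_zero_def free_carrier_def)

lemma free_map_zero_iff:
  assumes "\<And>r c. r < m \<Longrightarrow> c < n \<Longrightarrow> D r c \<in> carrier R" "v \<in> free_carrier R n"
  shows "free_map R m n D v = free_zero R m \<longleftrightarrow> (\<forall>r<m. (\<Sum>c<n. h (D r c) * h (v c)) = 0)"
proof -
  have "free_map R m n D v = free_zero R m \<longleftrightarrow> (\<forall>r<m. h (free_map R m n D v r) = h (free_zero R m r))"
    using free_carrier_eqI[OF free_map_in[OF assms] free_zero_in] by auto
  then show ?thesis
    by (simp add: h_free_map[OF assms] free_zero_def h_zero)
qed

lemma free_map_image_iff:
  assumes "\<And>r c. r < m \<Longrightarrow> c < n \<Longrightarrow> D r c \<in> carrier R" "v \<in> free_carrier R m"
  shows "v \<in> free_map R m n D ` free_carrier R n \<longleftrightarrow>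
    (\<exists>w. (\<forall>c. w c \<in> T) \<and> (\<forall>r<m. h (v r) = (\<Sum>c<n. h (D r c) * w c)))"
proof
  assume "v \<in> free_map R m n D ` free_carrier R n"
  then obtain w where w: "w \<in> free_carrier R n" "v = free_map R m n D w"
    by auto
  have "\<forall>r<m. h (v r) = (\<Sum>c<n. h (D r c) * (if c < n then h (w c) else 0))"
    using w h_free_map[OF assms(1)] by simp
  moreover have "\<forall>c. (if c < n then h (w c) else 0) \<in> T"
    using w(1) by (auto simp: free_carrier_def PiE_iff intro: h_in T_zero)
  ultimately show "\<exists>w. (\<forall>c. w c \<in> T) \<and> (\<forall>r<m. h (v r) = (\<Sum>c<n. h (D r c) * w c))"
    by (intro exI[of _ "\<lambda>c. if c < n then h (w c) else 0"] conjI)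
next
  assume "\<exists>w. (\<forall>c. w c \<in> T) \<and> (\<forall>r<m. h (v r) = (\<Sum>c<n. h (D r c) * w c))"
  then obtain w where w: "\<forall>c. w c \<in> T" "\<forall>r<m. h (v r) = (\<Sum>c<n. h (D r c) * w c)"
    by blast
  define w' where "w' = (\<lambda>c\<in>{..<n}. h' (w c))"
  have w': "w' \<in> free_carrier R n"
    using w(1) by (auto simp: w'_def free_carrier_def intro: h'_in)
  have "v = free_map R m n D w'"
    using w by (intro free_carrier_eqI[OF assms(2) free_map_in[OF assms(1) w']])
      (simp_all add: h_free_map[OF assms(1) w'], simp add: w'_def h_h')
  with w' show "v \<in> free_map R m n D ` free_carrier R n"
    by blast
qed

end

lemma carrier_residue_module:
  "carrier (residue_module R A) = carrier (R Quot irrelevant_ideal R A)"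
  "\<zero>\<^bsub>residue_module R A\<^esub> = \<zero>\<^bsub>R Quot irrelevant_ideal R A\<^esub>"
  "x \<oplus>\<^bsub>residue_module R A\<^esub> y = x \<oplus>\<^bsub>R Quot irrelevant_ideal R A\<^esub> y"
  "a \<odot>\<^bsub>residue_module R A\<^esub> x =
     (irrelevant_ideal R A +>\<^bsub>R\<^esub> a) \<otimes>\<^bsub>R Quot irrelevant_ideal R A\<^esub> x"
  by (simp_all add: residue_module_def ring.defs)

text \<open>\<open>C\<close> and \<open>M\<close> are the images of the linear forms and of the
  irrelevant ideal. A linear resolution of the residue field sees no more of the grading than these
  two.\<close>

locale graded_ring_model = ring_model R h T
  for R :: "('a, 'x) ring_scheme" (structure) and h :: "'a \<Rightarrow> 'b::comm_ring_1" and T +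
  fixes A :: "int \<Rightarrow> 'a set" and C M :: "'b set"
  assumes A_carrier: "A n \<subseteq> carrier R"
    and h_A: "h ` A 1 = C"
    and h_irrelevant: "h ` irrelevant_ideal R A = M"
begin

lemma irrelevant_ideal: "ideal (irrelevant_ideal R A) R"
  unfolding irrelevant_ideal_def using A_carrier by (intro genideal_ideal) auto

lemma irrelevant_A: "A 1 \<subseteq> irrelevant_ideal R A"
proof -
  have "(\<Union>n\<in>{0<..}. A n) \<subseteq> irrelevant_ideal R A"
    unfolding irrelevant_ideal_def using A_carrier by (intro genideal_self) auto
  then show ?thesis
    by force
qed

lemma in_A_iff: "x \<in> carrier R \<Longrightarrow> x \<in> A 1 \<longleftrightarrow> h x \<in> C"
  using h_A A_carrier by (auto simp: h_inj image_iff subset_iff)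

lemma in_irrelevant_iff: "x \<in> carrier R \<Longrightarrow> x \<in> irrelevant_ideal R A \<longleftrightarrow> h x \<in> M"
  using h_irrelevant additive_subgroup.a_subset[OF ideal.axioms(1)[OF irrelevant_ideal]]
  by (auto simp: h_inj image_iff subset_iff)

lemma C_T: "x \<in> C \<Longrightarrow> x \<in> T"
  using h_A A_carrier h_in by blast

lemma residue_ring: "ring (R Quot irrelevant_ideal R A)"
  by (rule ideal.quotient_is_ring[OF irrelevant_ideal])

lemma residue_abelian: "abelian_monoid (residue_module R A)"
proof -
  interpret Q: ring "R Quot irrelevant_ideal R A"
    by (rule residue_ring)
  show ?thesis
    by (rule abelian_monoidI) (auto simp: carrier_residue_module Q.a_ac)
qed

lemma coset_zero_iff:
  assumes "x \<in> carrier R"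
  shows "irrelevant_ideal R A +> x = \<zero>\<^bsub>R Quot irrelevant_ideal R A\<^esub> \<longleftrightarrow> h x \<in> M"
proof -
  have "irrelevant_ideal R A +> x = irrelevant_ideal R A \<longleftrightarrow> x \<in> irrelevant_ideal R A"
    using assms irrelevant_ideal ideal.rcos_const_imp_mem a_rcos_zero by metis
  then show ?thesis
    using in_irrelevant_iff[OF assms] by (simp add: FactRing_def)
qed

text \<open>The generator of the first free module goes to the unit class, and the
  \<open>i\<close>-th free module is generated in degree \<open>i\<close>. The resolution is then
  homogeneous because the entries are linear, and minimal because linear forms lie in the irrelevant
  ideal.\<close>

theorem koszulI:
  fixes b :: "nat \<Rightarrow> nat" and D :: "nat \<Rightarrow> nat \<Rightarrow> nat \<Rightarrow> 'b"
  assumes b0: "b 0 = 1"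
    and D: "\<And>i r c. r < b i \<Longrightarrow> c < b (Suc i) \<Longrightarrow> D i r c \<in> C"
    and M: "\<And>x. x \<in> T \<Longrightarrow> x \<in> M \<longleftrightarrow> (\<exists>w. (\<forall>c. w c \<in> T) \<and> x = (\<Sum>c<b 1. D 0 0 c * w c))"
    and exact: "\<And>i v. \<forall>c<b (Suc i). v c \<in> T \<Longrightarrow>
      (\<forall>r<b i. (\<Sum>c<b (Suc i). D i r c * v c) = 0) \<longleftrightarrow>
      (\<exists>w. (\<forall>e. w e \<in> T) \<and> (\<forall>c<b (Suc i). v c = (\<Sum>e<b (Suc (Suc i)). D (Suc i) c e * w e)))"
  shows "koszul R A"
proof -
  define D' where "D' i r c = h' (D i r c)" for i r c
  define u where "u = (\<lambda>j::nat. \<one>\<^bsub>R Quot irrelevant_ideal R A\<^esub>)"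
  interpret Q: ring "R Quot irrelevant_ideal R A"
    by (rule residue_ring)
  interpret N: abelian_monoid "residue_module R A"
    by (rule residue_abelian)
  have D': "D' i r c \<in> carrier R" "h (D' i r c) = D i r c"
    if "r < b i" "c < b (Suc i)" for i r c
    using D[OF that] by (auto simp: D'_def h'_in h_h' C_T)
  have D'_A: "D' i r c \<in> A 1" if "r < b i" "c < b (Suc i)" for i r c
    using D[OF that] D'[OF that] by (simp add: in_A_iff)
  have coset: "irrelevant_ideal R A +> x \<in> carrier (R Quot irrelevant_ideal R A)" if "x \<in> carrier R" for x
    using that by (auto simp: FactRing_def A_RCOSETS_def')
  have aug: "augmentation_map (residue_module R A) (b 0) u v = irrelevant_ideal R A +> v 0"
    if "v \<in> free_carrier R (b 0)" for v
  proof -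
    have v: "v 0 \<in> carrier R"
      using that by (auto simp: free_carrier_def b0 PiE_iff)
    show ?thesis
      using coset[OF v] b0
      by (simp add: augmentation_map_def carrier_residue_module u_def lessThan_Suc)
  qed
  have img: "augmentation_map (residue_module R A) (b 0) u ` free_carrier R (b 0) = carrier (residue_module R A)"
  proof -
    have "X' \<in> augmentation_map (residue_module R A) (b 0) u ` free_carrier R (b 0)"
      if X': "X' \<in> carrier (R Quot irrelevant_ideal R A)" for X'
    proof -
      obtain x where x: "x \<in> carrier R" "X' = irrelevant_ideal R A +> x"
        using X' by (auto simp: FactRing_def A_RCOSETS_def')
      have "(\<lambda>i\<in>{..<b 0}. x) \<in> free_carrier R (b 0)"
        using x by (auto simp: free_carrier_def)
      then show ?thesis
        using aug x b0 by (intro image_eqI[where x = "\<lambda>i\<in>{..<b 0}. x"]) simp_all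
    qed
    then show ?thesis
      using aug coset by (auto simp: carrier_residue_module free_carrier_def b0 PiE_iff)
  qed
  have ker: "{v \<in> free_carrier R (b 0). augmentation_map (residue_module R A) (b 0) u v = \<zero>\<^bsub>residue_module R A\<^esub>} =
       free_map R (b 0) (b 1) (D' 0) ` free_carrier R (b 1)" (is "?K = ?I")
  proof (rule Set.set_eqI)
    fix v
    show "v \<in> ?K \<longleftrightarrow> v \<in> ?I"
    proof (cases "v \<in> free_carrier R (b 0)")
      case True
      have v: "v 0 \<in> carrier R"
        using True by (auto simp: free_carrier_def b0 PiE_iff)
      have "v \<in> ?K \<longleftrightarrow> h (v 0) \<in> M"
        using True v by (simp add: aug carrier_residue_module coset_zero_iff)
      also have "\<dots> \<longleftrightarrow> (\<exists>w. (\<forall>c. w c \<in> T) \<and> h (v 0) = (\<Sum>c<b 1. D 0 0 c * w c))"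
        using M h_in v by blast
      also have "\<dots> \<longleftrightarrow> v \<in> ?I"
        using D' b0 by (subst free_map_image_iff[OF _ True]) auto
      finally show ?thesis .
    next
      case False
      then show ?thesis
        using free_map_in[of "b 0" "b 1" "D' 0"] D' by auto
    qed
  qed
  have ex: "{v \<in> free_carrier R (b (Suc i)).
             free_map R (b i) (b (Suc i)) (D' i) v = free_zero R (b i)} =
          free_map R (b (Suc i)) (b (Suc (Suc i))) (D' (Suc i)) ` free_carrier R (b (Suc (Suc i)))"
    (is "?K = ?I") for i
  proof (rule Set.set_eqI)
    fix v
    show "v \<in> ?K \<longleftrightarrow> v \<in> ?I"
    proof (cases "v \<in> free_carrier R (b (Suc i))")
      case True
      have v: "\<forall>c<b (Suc i). h (v c) \<in> T"
        using True by (auto simp: free_carrier_def PiE_iff intro: h_in)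
      have "v \<in> ?K \<longleftrightarrow> (\<forall>r<b i. (\<Sum>c<b (Suc i). D i r c * h (v c)) = 0)"
        using True D' by (simp add: free_map_zero_iff)
      also have "\<dots> \<longleftrightarrow> (\<exists>w. (\<forall>e. w e \<in> T) \<and> (\<forall>c<b (Suc i). h (v c) = (\<Sum>e<b (Suc (Suc i)). D (Suc i) c e * w e)))"
        using v by (rule exact)
      also have "\<dots> \<longleftrightarrow> v \<in> ?I"
        using D' by (subst free_map_image_iff[OF _ True]) auto
      finally show ?thesis .
    next
      case False
      then show ?thesis
        using free_map_in[of "b (Suc i)" "b (Suc (Suc i))" "D' (Suc i)"] D' by auto
    qed
  qed
  have "minimal_graded_free_resolution R A (residue_module R A) (residue_grading R A) b (\<lambda>i j. int i) u D'"
    unfolding minimal_graded_free_resolution_def graded_free_resolution_def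
    using img ker ex D'_A irrelevant_A by (auto simp: residue_grading_def carrier_residue_module u_def)
  then show ?thesis
    unfolding koszul_def by blast
qed

text \<open>The rank of the first free module is not computed and \<open>u\<close> is arbitrary.
  What is extracted instead: an element \<open>x\<close> of the irrelevant ideal annihilates the
  residue module, so the vector \<open>(x, 0, ..., 0)\<close> is mapped to zero and by exactness
  comes from the second free module. The rank is positive because the residue module is not
  zero.\<close>

theorem koszulE:
  assumes "koszul R A" and M: "1 \<notin> M"
  obtains b :: "nat \<Rightarrow> nat" and D :: "nat \<Rightarrow> nat \<Rightarrow> nat \<Rightarrow> 'b"
  where "b 0 > 0"
    and "\<forall>i. \<forall>r<b i. \<forall>c<b (Suc i). D i r c \<in> C"
    and "\<forall>x\<in>M \<inter> T. \<exists>w. (\<forall>c. w c \<in> T) \<and>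
      (\<forall>r<b 0. (if r = 0 then x else 0) = (\<Sum>c<b 1. D 0 r c * w c))"
    and "\<forall>i v. (\<forall>c<b (Suc i). v c \<in> T) \<longrightarrow>
      (\<forall>r<b i. (\<Sum>c<b (Suc i). D i r c * v c) = 0) \<longleftrightarrow>
      (\<exists>w. (\<forall>e. w e \<in> T) \<and> (\<forall>c<b (Suc i). v c = (\<Sum>e<b (Suc (Suc i)). D (Suc i) c e * w e)))"
proof -
  obtain b s u D where min: "minimal_graded_free_resolution R A (residue_module R A) (residue_grading R A) b s u D"
    and s: "\<forall>i. \<forall>j < b i. s i j = int i"
    using assms(1) unfolding koszul_def by blast
  interpret Q: ring "R Quot irrelevant_ideal R A"
    by (rule residue_ring)
  interpret N: abelian_monoid "residue_module R A"
    by (rule residue_abelian)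
  have u: "u j \<in> carrier (R Quot irrelevant_ideal R A)" if "j < b 0" for j
    using min s that
    by (force simp: minimal_graded_free_resolution_def graded_free_resolution_def residue_grading_def carrier_residue_module)
  have D_A: "D i r c \<in> A 1" if "r < b i" "c < b (Suc i)" for i r c
  proof -
    have "D i r c \<in> A (s (Suc i) c - s i r)"
      using min that by (auto simp: minimal_graded_free_resolution_def graded_free_resolution_def)
    then show ?thesis
      using s that by simp
  qed
  have D: "D i r c \<in> carrier R" "h (D i r c) \<in> C" if "r < b i" "c < b (Suc i)" for i r c
    using D_A[OF that] A_carrier h_A by auto
  have img: "augmentation_map (residue_module R A) (b 0) u ` free_carrier R (b 0) = carrier (residue_module R A)"
    and ker: "{v \<in> free_carrier R (b 0). augmentation_map (residue_module R A) (b 0) u v = \<zero>\<^bsub>residue_module R A\<^esub>} =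
       free_map R (b 0) (b 1) (D 0) ` free_carrier R (b 1)"
    and ex: "\<And>i. {v \<in> free_carrier R (b (Suc i)).
             free_map R (b i) (b (Suc i)) (D i) v = free_zero R (b i)} =
          free_map R (b (Suc i)) (b (Suc (Suc i))) (D (Suc i)) ` free_carrier R (b (Suc (Suc i)))"
    using min by (auto simp: minimal_graded_free_resolution_def graded_free_resolution_def)
  show thesis
  proof (rule that[of b "\<lambda>i r c. h (D i r c)"]; (intro allI impI ballI)?)
    show "b 0 > 0"
    proof (rule ccontr)
      assume "\<not> b 0 > 0"
      then have "augmentation_map (residue_module R A) (b 0) u ` free_carrier R (b 0)
          \<subseteq> {\<zero>\<^bsub>residue_module R A\<^esub>}"
        by (auto simp: augmentation_map_def)
      then have "\<one>\<^bsub>R Quot irrelevant_ideal R A\<^esub> = \<zero>\<^bsub>R Quot irrelevant_ideal R A\<^esub>"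
        using Q.one_closed img by (auto simp: carrier_residue_module)
      then show False
        using coset_zero_iff[of \<one>] M by (simp add: FactRing_def h_one)
    qed
    show "h (D i r c) \<in> C" if "r < b i" "c < b (Suc i)" for i r c
      using D that by blast
    show "\<exists>w. (\<forall>c. w c \<in> T) \<and> (\<forall>r<b 0. (if r = 0 then x else 0) = (\<Sum>c<b 1. h (D 0 r c) * w c))"
      if "x \<in> M \<inter> T" for x
    proof -
      have x: "x \<in> M" "x \<in> T"
        using that by auto
      define v where "v = (\<lambda>r\<in>{..<b 0}. if r = 0 then h' x else \<zero>)"
      have v: "v \<in> free_carrier R (b 0)"
        using x by (auto simp: v_def free_carrier_def h'_in)
      have "irrelevant_ideal R A +> v j = \<zero>\<^bsub>R Quot irrelevant_ideal R A\<^esub>" if "j < b 0" for j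
        using that x coset_zero_iff[of "h' x"] coset_zero_iff[of \<zero>] in_irrelevant_iff[of \<zero>]
          additive_subgroup.zero_closed[OF ideal.axioms(1)[OF irrelevant_ideal]]
        by (auto simp: v_def h'_in h_h' in_irrelevant_iff)
      then have "augmentation_map (residue_module R A) (b 0) u v
          = (\<Oplus>\<^bsub>residue_module R A\<^esub>j\<in>{..<b 0}. \<zero>\<^bsub>residue_module R A\<^esub>)"
        unfolding augmentation_map_def
        using u by (intro N.finsum_cong') (auto simp: carrier_residue_module)
      then have "v \<in> free_map R (b 0) (b 1) (D 0) ` free_carrier R (b 1)"
        using v ker by auto
      then show ?thesis
        using x D by (subst (asm) free_map_image_iff[OF _ v]) (auto simp: v_def h_h' h_zero if_distrib[of h] cong: if_cong)
    qed
    show "(\<forall>r<b i. (\<Sum>c<b (Suc i). h (D i r c) * v c) = 0) \<longleftrightarrow>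
      (\<exists>w. (\<forall>e. w e \<in> T) \<and> (\<forall>c<b (Suc i). v c = (\<Sum>e<b (Suc (Suc i)). h (D (Suc i) c e) * w e)))"
      if v: "\<forall>c<b (Suc i). v c \<in> T" for i v
    proof -
      define v' where "v' = (\<lambda>c\<in>{..<b (Suc i)}. h' (v c))"
      have v': "v' \<in> free_carrier R (b (Suc i))" "\<And>c. c < b (Suc i) \<Longrightarrow> h (v' c) = v c"
        using v by (auto simp: v'_def free_carrier_def h'_in h_h')
      have "(\<forall>r<b i. (\<Sum>c<b (Suc i). h (D i r c) * v c) = 0) \<longleftrightarrow>
          v' \<in> {v \<in> free_carrier R (b (Suc i)). free_map R (b i) (b (Suc i)) (D i) v = free_zero R (b i)}"
        using v' D by (simp add: free_map_zero_iff)
      also have "\<dots> \<longleftrightarrow> v' \<in> free_map R (b (Suc i)) (b (Suc (Suc i))) (D (Suc i)) ` free_carrier R (b (Suc (Suc i)))"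
        by (simp only: ex)
      also have "\<dots> \<longleftrightarrow> (\<exists>w. (\<forall>e. w e \<in> T) \<and> (\<forall>c<b (Suc i). v c = (\<Sum>e<b (Suc (Suc i)). h (D (Suc i) c e) * w e)))"
        using D v' by (subst free_map_image_iff) auto
      finally show ?thesis .
    qed
  qed
qed

end

section \<open>Monomials and monomial maps\<close>

lemma poly_mapping_sum_single:
  "(\<Sum>t\<in>Poly_Mapping.keys f. Poly_Mapping.single t (Poly_Mapping.lookup f t)) = f"
proof (rule poly_mapping_eqI)
  fix s
  show "Poly_Mapping.lookup (\<Sum>t\<in>Poly_Mapping.keys f. Poly_Mapping.single t (Poly_Mapping.lookup f t)) s
      = Poly_Mapping.lookup f s"
    by (simp add: lookup_sum lookup_single when_def in_keys_iff)
qed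

text \<open>The case \<open>single\<close> is restricted to the keys of the given \<open>f\<close>,
  so that what is known about the monomials of \<open>f\<close> stays available in the
  induction.\<close>

lemma poly_mapping_induct_add [case_names zero single add]:
  fixes f :: "'a \<Rightarrow>\<^sub>0 'b::comm_monoid_add"
  assumes "P 0" "\<And>t c. t \<in> Poly_Mapping.keys f \<Longrightarrow> P (Poly_Mapping.single t c)"
    and "\<And>g h. P g \<Longrightarrow> P h \<Longrightarrow> P (g + h)"
  shows "P f"
proof -
  have "P (\<Sum>t\<in>T. Poly_Mapping.single t (Poly_Mapping.lookup f t))" if "T \<subseteq> Poly_Mapping.keys f" for T
    using finite_subset[OF that finite_keys] that by induction (auto intro: assms)
  then show ?thesis
    using poly_mapping_sum_single[of f] by (metis subset_refl)
qed

lemma monomial_diff_add: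
  assumes "\<And>v. Poly_Mapping.lookup s v \<le> Poly_Mapping.lookup t v"
  shows "s + (t - s) = (t :: 'v monomial)"
  using assms by (intro poly_mapping_eqI) (simp add: lookup_add lookup_minus)

lemma mdeg_add: "mdeg (s + t) = mdeg s + mdeg t"
  unfolding mdeg_def by (rule setsum_keys_plus_distrib) auto

lemma mdeg_0 [simp]: "mdeg 0 = 0"
  by (simp add: mdeg_def)

lemma mdeg_single [simp]: "mdeg (Poly_Mapping.single v n) = n"
  by (simp add: mdeg_def)

lemma mdeg_eq_0_iff [simp]: "mdeg m = 0 \<longleftrightarrow> m = 0"
proof
  assume "mdeg m = 0"
  then have "\<forall>v\<in>Poly_Mapping.keys m. Poly_Mapping.lookup m v = 0"
    by (simp add: mdeg_def)
  then show "m = 0"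
    by (metis in_keys_iff keys_eq_empty equals0I)
qed simp

lemma monomial_add_eq_0_iff: "s + t = 0 \<longleftrightarrow> s = 0 \<and> t = (0 :: 'v monomial)"
  by (metis mdeg_add mdeg_eq_0_iff add_is_0)

lemma keys_add_monomial: "Poly_Mapping.keys (s + t) = Poly_Mapping.keys s \<union> Poly_Mapping.keys (t :: 'v monomial)"
  by (auto simp: in_keys_iff lookup_add)

lemma word_cases:
  assumes "W \<noteq> (0 :: 'w monomial)" "Poly_Mapping.keys W \<subseteq> B"
  obtains m U where "m \<in> B" "Poly_Mapping.keys U \<subseteq> B" "W = Poly_Mapping.single m 1 + U"
proof -
  obtain m where m: "m \<in> Poly_Mapping.keys W"
    using assms(1) keys_eq_empty by blast
  have "W = Poly_Mapping.single m 1 + (W - Poly_Mapping.single m 1)"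
    using m by (intro monomial_diff_add[symmetric]) (auto simp: lookup_single when_def in_keys_iff)
  moreover have "Poly_Mapping.keys (W - Poly_Mapping.single m 1) \<subseteq> Poly_Mapping.keys W"
    by (auto simp: in_keys_iff lookup_minus)
  ultimately show ?thesis
    using that[of m] m assms(2) by blast
qed

lemma word_induct [consumes 1, case_names zero add]:
  assumes "Poly_Mapping.keys (W :: 'w monomial) \<subseteq> B" "P 0"
    and "\<And>m W. m \<in> B \<Longrightarrow> Poly_Mapping.keys W \<subseteq> B \<Longrightarrow> P W \<Longrightarrow> P (Poly_Mapping.single m 1 + W)"
  shows "P W"
  using assms(1)
proof (induction "mdeg W" arbitrary: W)
  case 0
  then show ?case
    using assms(2) by simp
next
  case (Suc n)
  then have "W \<noteq> 0"
    by auto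
  then obtain m U where "m \<in> B" "Poly_Mapping.keys U \<subseteq> B" "W = Poly_Mapping.single m 1 + U"
    using Suc.prems by (rule word_cases)
  then show ?case
    using Suc.hyps assms(3) by (simp add: mdeg_add)
qed

lemma word_degree_1:
  assumes "mdeg W = 1" "Poly_Mapping.keys W \<subseteq> B"
  obtains m where "m \<in> B" "W = Poly_Mapping.single m 1"
proof -
  have "W \<noteq> 0"
    using assms by auto
  then obtain m U where "m \<in> B" "Poly_Mapping.keys U \<subseteq> B" "W = Poly_Mapping.single m 1 + U"
    using assms(2) by (rule word_cases)
  then show ?thesis
    using that[of m] assms(1) by (simp add: mdeg_add)
qed

lemma word_degree_2:
  assumes "mdeg W = 2" "Poly_Mapping.keys W \<subseteq> B"
  obtains m n where "m \<in> B" "n \<in> B" "W = Poly_Mapping.single m 1 + Poly_Mapping.single n 1"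
proof -
  have "W \<noteq> 0"
    using assms by auto
  then obtain m U where m: "m \<in> B" "Poly_Mapping.keys U \<subseteq> B" "W = Poly_Mapping.single m 1 + U"
    using assms(2) by (rule word_cases)
  then have "mdeg U = 1"
    using assms(1) by (simp add: mdeg_add)
  then show ?thesis
    using word_degree_1[OF _ m(2)] that m by metis
qed

text \<open>A monomial \<open>W\<close> in the variables indexed by monomials is a word in these
  letters up to order, and its weight is the product of the letters. Mapping multiplication by
  \<open>n\<close> over the exponents of \<open>m\<close> is the \<open>n\<close>-th power of
  \<open>m\<close>.\<close>

definition weight :: "'v monomial monomial \<Rightarrow> 'v monomial" where
  "weight W = (\<Sum>m\<in>Poly_Mapping.keys W. Poly_Mapping.map ((*) (Poly_Mapping.lookup W m)) m)"

lemma lookup_map_times: "Poly_Mapping.lookup (Poly_Mapping.map ((*) (n::nat)) m) v = n * Poly_Mapping.lookup m v"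
  by (simp add: map.rep_eq when_def)

lemma lookup_weight:
  "Poly_Mapping.lookup (weight W) v = (\<Sum>m\<in>Poly_Mapping.keys W. Poly_Mapping.lookup W m * Poly_Mapping.lookup m v)"
  by (simp add: weight_def lookup_sum lookup_map_times)

lemma weight_0 [simp]: "weight 0 = 0"
  by (simp add: weight_def)

lemma weight_add: "weight (U + W) = weight U + weight W"
proof (rule poly_mapping_eqI)
  fix v
  have "(\<Sum>m\<in>Poly_Mapping.keys (U + W). Poly_Mapping.lookup (U + W) m * Poly_Mapping.lookup m v)
      = (\<Sum>m\<in>Poly_Mapping.keys U. Poly_Mapping.lookup U m * Poly_Mapping.lookup m v)
        + (\<Sum>m\<in>Poly_Mapping.keys W. Poly_Mapping.lookup W m * Poly_Mapping.lookup m v)"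
    by (rule setsum_keys_plus_distrib[where f = "\<lambda>m n. n * Poly_Mapping.lookup m v"])
       (auto simp: algebra_simps)
  then show "Poly_Mapping.lookup (weight (U + W)) v = Poly_Mapping.lookup (weight U + weight W) v"
    by (simp only: lookup_weight lookup_add[of "weight U"])
qed

lemma weight_single [simp]: "weight (Poly_Mapping.single m (Suc 0)) = m"
  by (rule poly_mapping_eqI) (simp add: lookup_weight)

lemma mdeg_weight:
  assumes "\<And>m. m \<in> B \<Longrightarrow> mdeg m = d" "Poly_Mapping.keys W \<subseteq> B"
  shows "mdeg (weight W) = mdeg W * d"
  using assms(2) by (induction W rule: word_induct) (auto simp: weight_add mdeg_add assms(1))

section \<open>The algebra homomorphism that evaluates words\<close>

abbreviation monomial_map :: "('v monomial, 'k::comm_ring_1) mpoly \<Rightarrow> ('v, 'k) mpoly" where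
  "monomial_map \<equiv> mpoly_subst (\<lambda>m. Poly_Mapping.single m 1)"

lemma single_one_power:
  "(Poly_Mapping.single m 1 :: ('v, 'k::comm_ring_1) mpoly) ^ n = Poly_Mapping.single (Poly_Mapping.map ((*) n) m) 1"
proof (induction n)
  case 0
  have "Poly_Mapping.map ((*) 0) m = 0"
    by (rule poly_mapping_eqI) (simp add: lookup_map_times)
  then show ?case by (simp only: power_0 single_one)
next
  case (Suc n)
  have "m + Poly_Mapping.map ((*) n) m = Poly_Mapping.map ((*) (Suc n)) m"
    by (rule poly_mapping_eqI) (simp add: lookup_map_times lookup_add)
  then show ?case
    by (simp only: power_Suc Suc.IH mult_single mult_1)
qed

lemma prod_single:
  "(\<Prod>i\<in>I. Poly_Mapping.single (f i) (c i) :: ('v, 'k::comm_ring_1) mpoly)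
    = Poly_Mapping.single (\<Sum>i\<in>I. f i) (\<Prod>i\<in>I. c i)"
  by (induction I rule: infinite_finite_induct) (auto simp: mult_single)

lemma monomial_map_alt:
  "monomial_map p = (\<Sum>t\<in>Poly_Mapping.keys p. Poly_Mapping.single (weight t) (Poly_Mapping.lookup p t))"
  by (simp add: mpoly_subst_def single_one_power prod_single weight_def mult_single)

lemma monomial_map_single [simp]:
  "monomial_map (Poly_Mapping.single t c) = Poly_Mapping.single (weight t) c"
  by (simp add: monomial_map_alt)

lemma monomial_map_0 [simp]: "monomial_map 0 = 0"
  by (simp add: monomial_map_alt)

lemma monomial_map_1 [simp]: "monomial_map 1 = 1"
  using monomial_map_single[of 0 1] by simp

lemma monomial_map_add: "monomial_map (p + q) = monomial_map p + monomial_map q"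
  unfolding monomial_map_alt by (rule setsum_keys_plus_distrib) (auto simp: single_add)

lemma monomial_map_mult: "monomial_map (p * q) = monomial_map p * monomial_map q"
proof (induction p rule: poly_mapping_induct_add)
  case (single t c)
  show ?case
    by (induction q rule: poly_mapping_induct_add)
       (auto simp: monomial_map_add mult_single weight_add algebra_simps)
qed (auto simp: monomial_map_add algebra_simps)

lemma monomial_map_uminus: "monomial_map (- p) = - monomial_map p"
  using monomial_map_add[of p "- p"] by (simp add: add_eq_0_iff)

lemma monomial_map_diff: "monomial_map (p - q) = monomial_map p - monomial_map q"
  using monomial_map_add[of p "- q"] by (simp add: monomial_map_uminus)

lemma monomial_map_sum: "monomial_map (sum f I) = (\<Sum>i\<in>I. monomial_map (f i))"
  by (induction I rule: infinite_finite_induct) (auto simp: monomial_map_add)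

text \<open>Coefficients add up along the fibres of \<open>weight\<close>. In particular a word that
  is alone in its fibre has coefficient zero in every element of the kernel.\<close>

lemma lookup_monomial_map:
  "Poly_Mapping.lookup (monomial_map p) s
    = (\<Sum>t\<in>{t \<in> Poly_Mapping.keys p. weight t = s}. Poly_Mapping.lookup p t)"
  by (simp add: monomial_map_alt lookup_sum lookup_single when_def sum.If_cases Int_def)

lemma keys_monomial_map: "Poly_Mapping.keys (monomial_map p) \<subseteq> weight ` Poly_Mapping.keys p"
  unfolding monomial_map_alt using keys_sum[of _ "Poly_Mapping.keys p"]
  by (force split: if_splits)

lemma lookup_mult_singleton:
  fixes f g :: "('v, 'k::comm_ring_1) mpoly"
  assumes "\<And>a b. a + b = s \<Longrightarrow> b \<in> Poly_Mapping.keys g \<Longrightarrow> a \<in> Poly_Mapping.keys f \<Longrightarrow> False"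
  shows "Poly_Mapping.lookup (f * g) s = 0"
  using keys_mult[of f g] assms by (force simp flip: not_in_keys_iff_lookup_eq_zero)

lemma lookup_mult_0:
  fixes f g :: "('v, 'k::comm_ring_1) mpoly"
  shows "Poly_Mapping.lookup (f * g) 0 = Poly_Mapping.lookup f 0 * Poly_Mapping.lookup g 0"
proof (induction f rule: poly_mapping_induct_add)
  case (single t c)
  show ?case
    by (induction g rule: poly_mapping_induct_add)
       (auto simp: mult_single lookup_single when_def monomial_add_eq_0_iff lookup_add algebra_simps)
qed (auto simp: lookup_add algebra_simps)

text \<open>With a condition \<open>mdeg t = n\<close> this is the projection to the homogeneous
  component of degree \<open>n\<close>.\<close>

definition mpoly_restrict :: "('v monomial \<Rightarrow> bool) \<Rightarrow> ('v, 'k::comm_ring_1) mpoly \<Rightarrow> ('v, 'k) mpoly" where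
  "mpoly_restrict P f = Poly_Mapping.mapp (\<lambda>t c. if P t then c else 0) f"

lemma lookup_mpoly_restrict: "Poly_Mapping.lookup (mpoly_restrict P f) t = (if P t then Poly_Mapping.lookup f t else 0)"
  by (simp add: mpoly_restrict_def lookup_mapp when_def in_keys_iff)

lemma keys_mpoly_restrict: "Poly_Mapping.keys (mpoly_restrict P f) = {t \<in> Poly_Mapping.keys f. P t}"
  by (auto simp: in_keys_iff lookup_mpoly_restrict split: if_splits)

lemma mpoly_restrict_add: "mpoly_restrict P (f + g) = mpoly_restrict P f + mpoly_restrict P g"
  by (rule poly_mapping_eqI) (simp add: lookup_mpoly_restrict lookup_add)

lemma mpoly_restrict_0 [simp]: "mpoly_restrict P 0 = 0"
  by (rule poly_mapping_eqI) (simp add: lookup_mpoly_restrict)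

lemma mpoly_restrict_sum: "mpoly_restrict P (sum f I) = (\<Sum>i\<in>I. mpoly_restrict P (f i))"
  by (induction I rule: infinite_finite_induct) (auto simp: mpoly_restrict_add)

lemma mpoly_restrict_id: "(\<And>t. t \<in> Poly_Mapping.keys f \<Longrightarrow> P t) \<Longrightarrow> mpoly_restrict P f = f"
  by (rule poly_mapping_eqI) (auto simp: lookup_mpoly_restrict in_keys_iff)

lemma mpoly_restrict_single:
  "mpoly_restrict P (Poly_Mapping.single t c) = (if P t then Poly_Mapping.single t c else 0)"
  by (rule poly_mapping_eqI) (auto simp: lookup_mpoly_restrict lookup_single when_def)

lemma mpoly_restrict_mult:
  assumes "\<And>t. t \<in> Poly_Mapping.keys g \<Longrightarrow> mdeg t = k"
  shows "mpoly_restrict (\<lambda>t. mdeg t = n + k) (f * g) = mpoly_restrict (\<lambda>t. mdeg t = n) f * g"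
proof (induction f rule: poly_mapping_induct_add)
  case (single t c)
  show ?case
    by (induction g rule: poly_mapping_induct_add)
       (auto simp: mpoly_restrict_single mpoly_restrict_add mult_single mdeg_add assms algebra_simps)
qed (auto simp: mpoly_restrict_add algebra_simps)

lemma monomial_map_restrict:
  assumes "\<And>t. t \<in> Poly_Mapping.keys f \<Longrightarrow> mdeg (weight t) = n * d \<longleftrightarrow> mdeg t = n"
  shows "monomial_map (mpoly_restrict (\<lambda>t. mdeg t = n) f) = mpoly_restrict (\<lambda>t. mdeg t = n * d) (monomial_map f)"
  by (induction f rule: poly_mapping_induct_add)
     (auto simp: mpoly_restrict_single mpoly_restrict_add monomial_map_add assms)

definition monomial_algebra :: "'v monomial set \<Rightarrow> ('v, 'k::comm_ring_1) mpoly set" where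
  "monomial_algebra S = {f. Poly_Mapping.keys f \<subseteq> S}"

lemma monomial_algebra_0 [simp]: "0 \<in> monomial_algebra S"
  by (simp add: monomial_algebra_def)

lemma monomial_algebra_single: "s \<in> S \<Longrightarrow> Poly_Mapping.single s c \<in> monomial_algebra S"
  by (simp add: monomial_algebra_def)

lemma monomial_algebra_add: "f \<in> monomial_algebra S \<Longrightarrow> g \<in> monomial_algebra S \<Longrightarrow> f + g \<in> monomial_algebra S"
  using keys_add[of f g] by (auto simp: monomial_algebra_def)

lemma monomial_algebra_uminus: "f \<in> monomial_algebra S \<Longrightarrow> - f \<in> monomial_algebra S"
  by (auto simp: monomial_algebra_def in_keys_iff)

lemma monomial_algebra_diff: "f \<in> monomial_algebra S \<Longrightarrow> g \<in> monomial_algebra S \<Longrightarrow> f - g \<in> monomial_algebra S"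
  using monomial_algebra_add[of f S "- g"] monomial_algebra_uminus[of g S] by simp

lemma monomial_algebra_sum: "(\<And>i. i \<in> I \<Longrightarrow> f i \<in> monomial_algebra S) \<Longrightarrow> sum f I \<in> monomial_algebra S"
  by (induction I rule: infinite_finite_induct) (auto intro: monomial_algebra_add)

lemma monomial_algebra_mult:
  assumes "f \<in> monomial_algebra S" "g \<in> monomial_algebra T" "\<And>s t. s \<in> S \<Longrightarrow> t \<in> T \<Longrightarrow> s + t \<in> U"
  shows "f * g \<in> monomial_algebra U"
  using keys_mult[of f g] assms by (force simp: monomial_algebra_def)

section \<open>Polynomial rings and their ideals as rings with a carrier\<close>

lemma carrier_mpoly_ring: "carrier (mpoly_ring V) = monomial_algebra {t. Poly_Mapping.keys t \<subseteq> V}"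
  by (auto simp: mpoly_ring_def monomial_algebra_def)

lemma mpoly_ring_simps [simp]:
  "\<one>\<^bsub>mpoly_ring V\<^esub> = 1" "\<zero>\<^bsub>mpoly_ring V\<^esub> = 0"
  "f \<oplus>\<^bsub>mpoly_ring V\<^esub> g = f + g" "f \<otimes>\<^bsub>mpoly_ring V\<^esub> g = f * g"
  by (simp_all add: mpoly_ring_def)

lemma mpoly_ring_cring: "cring (mpoly_ring V :: ('w, 'k::comm_ring_1) mpoly ring)" (is "cring ?P")
proof (rule cringI)
  show "abelian_group ?P"
  proof (rule abelian_groupI)
    fix x assume "x \<in> carrier ?P"
    then show "\<exists>y\<in>carrier ?P. y \<oplus>\<^bsub>?P\<^esub> x = \<zero>\<^bsub>?P\<^esub>"
      by (intro bexI[of _ "- x"]) (auto simp: carrier_mpoly_ring monomial_algebra_uminus)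
  qed (auto simp: carrier_mpoly_ring algebra_simps intro: monomial_algebra_add)
  show "comm_monoid ?P"
  proof (rule comm_monoidI)
    show "\<one>\<^bsub>?P\<^esub> \<in> carrier ?P"
      by (simp add: carrier_mpoly_ring monomial_algebra_def)
    show "x \<otimes>\<^bsub>?P\<^esub> y \<in> carrier ?P"
      if "x \<in> carrier ?P" "y \<in> carrier ?P" for x y :: "('w, 'k) mpoly"
      using that
      by (auto simp: carrier_mpoly_ring keys_add_monomial
          intro!: monomial_algebra_mult[where S = "{t. Poly_Mapping.keys t \<subseteq> V}" and T = "{t. Poly_Mapping.keys t \<subseteq> V}"])
  qed (auto simp: algebra_simps)
qed (auto simp: algebra_simps)

lemma cring_idealI:
  assumes "cring R" "I \<subseteq> carrier R" "\<zero>\<^bsub>R\<^esub> \<in> I"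
    and add: "\<And>a b. a \<in> I \<Longrightarrow> b \<in> I \<Longrightarrow> a \<oplus>\<^bsub>R\<^esub> b \<in> I"
    and mult: "\<And>a x. a \<in> I \<Longrightarrow> x \<in> carrier R \<Longrightarrow> x \<otimes>\<^bsub>R\<^esub> a \<in> I"
  shows "ideal I R"
proof -
  interpret cring R by fact
  have neg: "\<ominus>\<^bsub>R\<^esub> a \<in> I" if "a \<in> I" for a
    using mult[OF that, of "\<ominus>\<^bsub>R\<^esub> \<one>\<^bsub>R\<^esub>"] that assms(2) l_minus[of "\<one>\<^bsub>R\<^esub>" a] by auto
  show ?thesis
  proof (rule idealI)
    show "subgroup I (add_monoid R)"
      using assms neg by (intro group.subgroupI[OF a_group]) (auto simp: a_inv_def)
    show "x \<otimes>\<^bsub>R\<^esub> a \<in> I" "a \<otimes>\<^bsub>R\<^esub> x \<in> I" if "a \<in> I" "x \<in> carrier R" for a x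
      using mult[OF that] that assms(2) m_comm[of x a] by auto
  qed (rule ring_axioms)
qed

lemma lookup_mult_single:
  "Poly_Mapping.lookup (f * Poly_Mapping.single z 1 :: ('v, 'k::comm_ring_1) mpoly) (s + z) = Poly_Mapping.lookup f s"
  by (induction f rule: poly_mapping_induct_add)
     (auto simp: mult_single lookup_single when_def lookup_add algebra_simps)

lemma keys_mult_single:
  "Poly_Mapping.keys (f * Poly_Mapping.single z 1 :: ('v, 'k::comm_ring_1) mpoly) = (\<lambda>s. s + z) ` Poly_Mapping.keys f"
proof
  show "Poly_Mapping.keys (f * Poly_Mapping.single z 1) \<subseteq> (\<lambda>s. s + z) ` Poly_Mapping.keys f"
    using keys_mult[of f "Poly_Mapping.single z 1"] by auto
qed (auto simp: in_keys_iff lookup_mult_single)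

section \<open>The coordinate ring as a monomial algebra\<close>

locale monomial_family =
  fixes B :: "'v monomial set" and d :: nat and K :: "'k::field itself"
  assumes finite_B: "finite B" and d_pos: "d > 0" and mdeg_B: "m \<in> B \<Longrightarrow> mdeg m = d"
begin

text \<open>The semigroup generated by \<open>B\<close>, presented by words, so that elements of the
  algebra can be lifted to the polynomial ring.\<close>

definition S :: "'v monomial set" where
  "S = weight ` {W. Poly_Mapping.keys W \<subseteq> B}"

lemma S_0 [simp]: "0 \<in> S"
  unfolding S_def by (rule image_eqI[where x = 0]) auto

lemma S_add: "s \<in> S \<Longrightarrow> t \<in> S \<Longrightarrow> s + t \<in> S"
  unfolding S_def by (auto simp: weight_add[symmetric] keys_add_monomial intro!: imageI)

lemma B_S: "B \<subseteq> S"
proof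
  fix m assume "m \<in> B"
  then show "m \<in> S"
    unfolding S_def by (intro image_eqI[where x = "Poly_Mapping.single m 1"]) auto
qed

abbreviation KS :: "('v, 'k) mpoly set" where "KS \<equiv> monomial_algebra S"

lemma KS_mult: "f \<in> KS \<Longrightarrow> g \<in> KS \<Longrightarrow> f * g \<in> KS"
  by (rule monomial_algebra_mult[OF _ _ S_add])

lemma mdeg_word: "Poly_Mapping.keys W \<subseteq> B \<Longrightarrow> mdeg (weight W) = mdeg W * d"
  using mdeg_weight[OF mdeg_B] .

lemma S_degree:
  assumes "s \<in> S"
  obtains n where "mdeg s = n * d"
  using assms mdeg_word unfolding S_def by auto

lemma S_degree_d: "s \<in> S \<Longrightarrow> mdeg s = d \<longleftrightarrow> s \<in> B"
proof -
  assume "s \<in> S"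
  then obtain W where W: "Poly_Mapping.keys W \<subseteq> B" "s = weight W"
    by (auto simp: S_def)
  have "s \<in> B" if "mdeg s = d"
  proof -
    have "mdeg W = 1"
      using mdeg_word[OF W(1)] d_pos that W(2) by simp
    then show ?thesis
      using word_degree_1[OF _ W(1)] W(2) weight_single by (metis One_nat_def)
  qed
  then show ?thesis
    using mdeg_B by blast
qed

definition K_piece :: "int \<Rightarrow> ('v, 'k) mpoly set" where
  "K_piece n = {f \<in> KS. \<forall>t\<in>Poly_Mapping.keys f. int (mdeg t) = n * int d}"

lemma K_piece_1: "K_piece 1 = monomial_algebra B"
  using S_degree_d B_S by (auto simp: K_piece_def monomial_algebra_def)

abbreviation P_B :: "('v monomial, 'k) mpoly ring" where "P_B \<equiv> mpoly_ring B"

lemma P_B_keys: "f \<in> carrier P_B \<Longrightarrow> t \<in> Poly_Mapping.keys f \<Longrightarrow> Poly_Mapping.keys t \<subseteq> B"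
  by (auto simp: carrier_mpoly_ring monomial_algebra_def)

lemma monomial_map_in: "f \<in> carrier P_B \<Longrightarrow> monomial_map (f :: ('v monomial, 'k) mpoly) \<in> KS"
  using keys_monomial_map[of f] by (fastforce simp: carrier_mpoly_ring monomial_algebra_def S_def)

lemma monomial_map_restrict_degree:
  assumes "f \<in> carrier P_B"
  shows "monomial_map (mpoly_restrict (\<lambda>t. mdeg t = n) f) = mpoly_restrict (\<lambda>t. mdeg t = n * d) (monomial_map f)"
  using assms d_pos by (intro monomial_map_restrict) (auto simp: mdeg_word[OF P_B_keys])

lemma restrict_in_P_B: "f \<in> carrier P_B \<Longrightarrow> mpoly_restrict P f \<in> carrier P_B"
  by (auto simp: carrier_mpoly_ring monomial_algebra_def keys_mpoly_restrict)

lemma monomial_lift: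
  assumes "f \<in> KS"
  obtains p where "p \<in> carrier P_B" "monomial_map p = f"
proof -
  obtain w where w: "\<And>s. s \<in> S \<Longrightarrow> Poly_Mapping.keys (w s) \<subseteq> B \<and> weight (w s) = s"
    unfolding S_def by (metis (mono_tags, lifting) image_iff mem_Collect_eq)
  define p where "p = (\<Sum>s\<in>Poly_Mapping.keys f. Poly_Mapping.single (w s) (Poly_Mapping.lookup f s))"
  have S: "s \<in> S" if "s \<in> Poly_Mapping.keys f" for s
    using assms that by (auto simp: monomial_algebra_def)
  have "p \<in> carrier P_B"
    unfolding p_def carrier_mpoly_ring using w S by (intro monomial_algebra_sum monomial_algebra_single) auto
  moreover have "monomial_map p = (\<Sum>s\<in>Poly_Mapping.keys f. Poly_Mapping.single s (Poly_Mapping.lookup f s))"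
    unfolding p_def monomial_map_sum using w S by (intro sum.cong) auto
  ultimately show ?thesis
    using that poly_mapping_sum_single[of f] by metis
qed

text \<open>Evaluation of words multiplies degrees by \<open>d\<close>. The part of degree
  \<open>n\<close> of an arbitrary lift is therefore still a lift.\<close>

lemma homogeneous_lift:
  assumes "f \<in> K_piece (int n)"
  obtains p where "p \<in> mpoly_homogeneous B (int n)" "monomial_map p = f"
proof -
  obtain p where p: "p \<in> carrier P_B" "monomial_map p = f"
    using assms monomial_lift[of f] by (auto simp: K_piece_def)
  have "monomial_map (mpoly_restrict (\<lambda>t. mdeg t = n) p) = mpoly_restrict (\<lambda>t. mdeg t = n * d) f"
    using monomial_map_restrict_degree p by blast
  also have "\<dots> = f"
    using assms by (intro mpoly_restrict_id) (auto simp: K_piece_def simp flip: of_nat_mult)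
  finally show ?thesis
    using that[of "mpoly_restrict (\<lambda>t. mdeg t = n) p"] restrict_in_P_B[OF p(1)]
    by (auto simp: mpoly_homogeneous_def keys_mpoly_restrict)
qed

lemma monomial_map_homogeneous:
  assumes "p \<in> mpoly_homogeneous B n"
  shows "monomial_map p \<in> K_piece n"
  using assms keys_monomial_map[of p] monomial_map_in[of p] mdeg_word[OF P_B_keys[of p]]
  by (force simp: K_piece_def mpoly_homogeneous_def)

sublocale P: ring_hom_ring "P_B :: ('v monomial, 'k) mpoly ring" "mpoly_ring UNIV" monomial_map
  by (rule ring_hom_ringI2)
     (auto simp: ring_hom_def carrier_mpoly_ring monomial_algebra_def monomial_map_add monomial_map_mult
       intro: cring.axioms(1)[OF mpoly_ring_cring])

text \<open>The isomorphism of the first isomorphism theorem: the monomial map is constant on each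
  coset of its kernel.\<close>

definition coset_value :: "('v monomial, 'k) mpoly set \<Rightarrow> ('v, 'k) mpoly" where
  "coset_value X' = the_elem (monomial_map ` X')"

abbreviation R :: "('v monomial, 'k) mpoly set ring" where "R \<equiv> toric_coordinate_ring B"

lemma R_alt: "R = P_B Quot (a_kernel P_B (mpoly_ring UNIV) monomial_map)"
  by (simp add: toric_coordinate_ring_def toric_ideal_def)

lemma coset_value_coset:
  "p \<in> carrier P_B \<Longrightarrow> coset_value (toric_ideal B +>\<^bsub>P_B\<^esub> p) = monomial_map p"
  unfolding coset_value_def toric_ideal_def by (rule P.the_elem_simp)

lemma monomial_map_image: "monomial_map ` carrier P_B = KS"
proof
  show "KS \<subseteq> monomial_map ` carrier P_B"
  proof
    fix f assume "f \<in> KS"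
    then show "f \<in> monomial_map ` carrier P_B"
      using monomial_lift by blast
  qed
qed (use monomial_map_in in auto)

lemma R_cring: "cring R"
  unfolding R_alt by (rule ideal.quotient_is_cring[OF P.kernel_is_ideal mpoly_ring_cring])

lemma carrier_R: "carrier R = (\<lambda>p. toric_ideal B +>\<^bsub>P_B\<^esub> p) ` carrier P_B"
  by (auto simp: toric_coordinate_ring_def FactRing_def A_RCOSETS_def')

sublocale R: ring_model "R :: ('v monomial, 'k) mpoly set ring" coset_value KS
proof (intro ring_model.intro ring_model_axioms.intro R_cring)
  let ?R = "R :: ('v monomial, 'k) mpoly set ring"
  have hom: "coset_value \<in> ring_hom ?R (mpoly_ring UNIV)"
    using P.the_elem_hom unfolding R_alt coset_value_def .
  show "bij_betw coset_value (carrier ?R) (KS)"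
    using P.the_elem_inj P.the_elem_surj
    by (simp add: bij_betw_def inj_on_def R_alt coset_value_def[abs_def] monomial_map_image)
  show "coset_value (x \<oplus>\<^bsub>?R\<^esub> y) = coset_value x + coset_value y"
    "coset_value (x \<otimes>\<^bsub>?R\<^esub> y) = coset_value x * coset_value y"
    if "x \<in> carrier ?R" "y \<in> carrier ?R" for x y
    using that hom by (auto simp: ring_hom_def)
  show "coset_value \<one>\<^bsub>?R\<^esub> = 1"
    using hom by (simp add: ring_hom_def)
qed

lemma toric_grading_iff:
  "x \<in> toric_grading B n \<longleftrightarrow> x \<in> carrier R \<and> coset_value x \<in> K_piece n"
proof
  assume "x \<in> toric_grading B n"
  then show "x \<in> carrier R \<and> coset_value x \<in> K_piece n"
    by (auto simp: toric_grading_def mpoly_homogeneous_def carrier_R coset_value_coset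
        intro!: monomial_map_homogeneous)
next
  assume x: "x \<in> carrier R \<and> coset_value x \<in> K_piece n"
  show "x \<in> toric_grading B n"
  proof (cases "n \<ge> 0")
    case True
    then obtain p where p: "p \<in> mpoly_homogeneous B n" "monomial_map p = coset_value x"
      using x homogeneous_lift[of "coset_value x" "nat n"] by auto
    then have "coset_value (toric_ideal B +>\<^bsub>P_B\<^esub> p) = coset_value x"
      by (auto simp: coset_value_coset mpoly_homogeneous_def)
    then have "x = toric_ideal B +>\<^bsub>P_B\<^esub> p"
      using x p by (subst (asm) R.h_inj) (auto simp: carrier_R mpoly_homogeneous_def)
    then show ?thesis
      using p by (auto simp: toric_grading_def)
  next
    case False
    \<comment> \<open>In negative degree the only candidate is 0, and the zero coset is the image of
      the zero polynomial, which is homogeneous of every degree.\<close>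
    then have "n * int d < 0"
      using d_pos by (simp add: mult_neg_pos)
    then have "Poly_Mapping.keys (coset_value x) = {}"
      using x by (force simp: K_piece_def)
    then have "coset_value x = coset_value \<zero>\<^bsub>R\<^esub>"
      by (simp add: R.h_zero)
    then have "x = \<zero>\<^bsub>R\<^esub>"
      using x by (subst (asm) R.h_inj) auto
    moreover have "\<zero>\<^bsub>R\<^esub> = toric_ideal B +>\<^bsub>P_B\<^esub> 0"
    proof -
      have "coset_value (toric_ideal B +>\<^bsub>P_B\<^esub> 0) = coset_value \<zero>\<^bsub>R\<^esub>"
        by (subst coset_value_coset) (auto simp: R.h_zero carrier_mpoly_ring)
      then show ?thesis
        using R.zero_closed by (subst (asm) R.h_inj) (auto simp: carrier_R[symmetric] carrier_mpoly_ring, auto simp: carrier_R carrier_mpoly_ring)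
    qed
    moreover have "0 \<in> mpoly_homogeneous B n"
      by (simp add: mpoly_homogeneous_def carrier_mpoly_ring)
    ultimately show ?thesis
      unfolding toric_grading_def by blast
  qed
qed

definition K_plus :: "('v, 'k) mpoly set" where
  "K_plus = {f \<in> KS. Poly_Mapping.lookup f 0 = 0}"

text \<open>The right-hand side is an ideal containing all positive components. Conversely, an
  element without constant term is a sum of terms whose monomials differ from 1, and each of these
  has degree \<open>n * d\<close> with \<open>n > 0\<close>.\<close>

lemma irrelevant_ideal_toric:
  "irrelevant_ideal R (toric_grading B) = {x \<in> carrier R. coset_value x \<in> K_plus}"
  (is "irrelevant_ideal ?R _ = ?M")
proof (rule subset_antisym)
  have "ideal ?M ?R"
    using R.h_zero R.h_add R.h_mult R.h_in
    by (intro cring_idealI R_cring)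
       (auto simp: K_plus_def lookup_add lookup_mult_0 intro: monomial_algebra_add KS_mult)
  moreover have "(\<Union>n\<in>{0<..}. toric_grading B n) \<subseteq> ?M"
    using d_pos by (force simp: toric_grading_iff K_plus_def K_piece_def simp flip: not_in_keys_iff_lookup_eq_zero)
  ultimately show "irrelevant_ideal ?R (toric_grading B) \<subseteq> ?M"
    unfolding irrelevant_ideal_def by (rule R.genideal_minimal)
next
  have sub: "(\<Union>n\<in>{0<..}. toric_grading B n) \<subseteq> carrier ?R"
    by (auto simp: toric_grading_iff)
  have I: "ideal (irrelevant_ideal ?R (toric_grading B)) ?R"
    unfolding irrelevant_ideal_def using sub by (rule R.genideal_ideal)
  then interpret I: ideal "irrelevant_ideal ?R (toric_grading B)" ?R .
  have "R.h' f \<in> irrelevant_ideal ?R (toric_grading B) \<and> f \<in> KS"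
    if "f \<in> monomial_algebra (S - {0})" for f
  proof (induction f rule: poly_mapping_induct_add)
    case zero
    have "R.h' 0 = \<zero>\<^bsub>?R\<^esub>"
      using R.h'_h[of "\<zero>\<^bsub>?R\<^esub>"] by (simp add: R.h_zero)
    then show ?case
      using I.zero_closed by simp
  next
    case (single t c)
    then have t: "t \<in> S" "t \<noteq> 0"
      using that by (auto simp: monomial_algebra_def)
    then obtain n where n: "mdeg t = n * d"
      using S_degree by blast
    then have "n > 0"
      using t by (metis mdeg_eq_0_iff mult_0 gr0I)
    have s: "Poly_Mapping.single t c \<in> KS"
      using t by (simp add: monomial_algebra_single)
    have "R.h' (Poly_Mapping.single t c) \<in> toric_grading B (int n)"
      using s n by (auto simp: toric_grading_iff R.h'_in R.h_h' K_piece_def)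
    then show ?case
      using R.genideal_self[OF sub] s \<open>n > 0\<close> unfolding irrelevant_ideal_def by force
  next
    case (add f g)
    then have "R.h' (f + g) = R.h' f \<oplus>\<^bsub>?R\<^esub> R.h' g"
      using R.h'_h[of "R.h' f \<oplus>\<^bsub>?R\<^esub> R.h' g"] by (simp add: R.h_add R.h'_in R.h_h')
    then show ?case
      using add I.a_closed by (auto intro: monomial_algebra_add)
  qed
  moreover have "coset_value x \<in> monomial_algebra (S - {0})" if "x \<in> ?M" for x
    using that by (auto simp: K_plus_def monomial_algebra_def in_keys_iff)
  ultimately show "?M \<subseteq> irrelevant_ideal ?R (toric_grading B)"
    using R.h'_h by fastforce
qed

sublocale G: graded_ring_model "R :: ('v monomial, 'k) mpoly set ring" coset_value
  KS "toric_grading B" "monomial_algebra B" K_plus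
proof (intro graded_ring_model.intro graded_ring_model_axioms.intro R.ring_model_axioms)
  show "toric_grading B n \<subseteq> carrier R" for n
    by (auto simp: toric_grading_iff)
  have image: "coset_value ` {x \<in> carrier R. coset_value x \<in> C} = C" if "C \<subseteq> KS"
    for C :: "('v, 'k) mpoly set"
  proof
    show "C \<subseteq> coset_value ` {x \<in> carrier R. coset_value x \<in> C}"
    proof
      fix f assume "f \<in> C"
      then show "f \<in> coset_value ` {x \<in> carrier R. coset_value x \<in> C}"
        using that R.h'_in[of f] R.h_h'[of f] by (intro image_eqI[where x = "R.h' f"]) auto
    qed
  qed auto
  have "toric_grading B 1 = {x \<in> carrier R. coset_value x \<in> monomial_algebra B}"
    unfolding K_piece_1[symmetric] using toric_grading_iff by blast
  then show "coset_value ` toric_grading B 1 = (monomial_algebra B :: ('v, 'k) mpoly set)"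
    using image[of "monomial_algebra B"] B_S by (force simp: monomial_algebra_def)
  show "coset_value ` irrelevant_ideal R (toric_grading B) = (K_plus :: ('v, 'k) mpoly set)"
    unfolding irrelevant_ideal_toric by (rule image) (auto simp: K_plus_def)
qed

end

section \<open>Filtrations by monomial ideals\<close>

context monomial_family
begin

sublocale LP: linear_pieces KS "monomial_algebra B :: ('v, 'k) mpoly set"
  "mpoly_restrict (\<lambda>t. mdeg t = d)" "mpoly_restrict (\<lambda>t. mdeg t = d + d)"
proof
  fix a b :: "('v, 'k) mpoly"
  show "(1 :: ('v, 'k) mpoly) \<in> KS"
    by (simp add: monomial_algebra_def)
  show "a \<in> KS \<Longrightarrow> b \<in> KS \<Longrightarrow> a - b \<in> KS" "a \<in> KS \<Longrightarrow> b \<in> KS \<Longrightarrow> a * b \<in> KS"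
    by (auto intro: monomial_algebra_diff KS_mult)
  show "a \<in> monomial_algebra B \<Longrightarrow> a \<in> KS"
    using B_S by (auto simp: monomial_algebra_def)
  show "a \<in> monomial_algebra B \<Longrightarrow> - a \<in> monomial_algebra B"
    by (rule monomial_algebra_uminus)
  show "a \<in> KS \<Longrightarrow> mpoly_restrict (\<lambda>t. mdeg t = d) a \<in> monomial_algebra B"
    using S_degree_d by (auto simp: monomial_algebra_def keys_mpoly_restrict)
  show "mpoly_restrict (\<lambda>t. mdeg t = d + d) (a + b)
      = mpoly_restrict (\<lambda>t. mdeg t = d + d) a + mpoly_restrict (\<lambda>t. mdeg t = d + d) b"
    by (rule mpoly_restrict_add)
  show *: "mpoly_restrict (\<lambda>t. mdeg t = d + d) (a * b) = mpoly_restrict (\<lambda>t. mdeg t = d) a * b"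
    if "b \<in> monomial_algebra B" for a b :: "('v, 'k) mpoly"
    using that mdeg_B by (intro mpoly_restrict_mult) (auto simp: monomial_algebra_def)
  show "a \<in> monomial_algebra B \<Longrightarrow> b \<in> monomial_algebra B \<Longrightarrow>
      mpoly_restrict (\<lambda>t. mdeg t = d + d) (a * b) = a * b"
    using mdeg_B by (subst *) (auto simp: monomial_algebra_def intro!: mpoly_restrict_id arg_cong2[where f = "(*)"])
qed simp

definition monomial_ideal :: "'v monomial set \<Rightarrow> 'v monomial set" where
  "monomial_ideal Z = {z + u |z u. z \<in> Z \<and> u \<in> S}"

lemma ideal_span_monomials:
  "LP.ideal_span (map (\<lambda>z. Poly_Mapping.single z 1) zs) = monomial_algebra (monomial_ideal (set zs))"
  (is "LP.ideal_span ?Z = ?I")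
proof
  show "LP.ideal_span ?Z \<subseteq> ?I"
  proof
    fix f assume "f \<in> LP.ideal_span ?Z"
    then obtain a where a: "\<forall>l. a l \<in> KS" "f = (\<Sum>l<length zs. a l * Poly_Mapping.single (zs ! l) 1)"
      by (auto simp: LP.ideal_span_def)
    have "Poly_Mapping.keys (a l * Poly_Mapping.single (zs ! l) 1) \<subseteq> monomial_ideal (set zs)"
      if "l < length zs" for l
      using a(1) that nth_mem[OF that]
      by (force simp: keys_mult_single monomial_ideal_def monomial_algebra_def add.commute)
    then show "f \<in> ?I"
      unfolding a(2) by (intro monomial_algebra_sum) (simp add: monomial_algebra_def)
  qed
  show "?I \<subseteq> LP.ideal_span ?Z"
  proof
    fix f :: "('v, 'k) mpoly" assume f: "f \<in> ?I"
    show "f \<in> LP.ideal_span ?Z"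
    proof (induction f rule: poly_mapping_induct_add)
      case zero
      show ?case
        by (auto simp: LP.ideal_span_def intro!: exI[of _ "\<lambda>_. 0"])
    next
      case (single t c)
      then obtain j u where j: "j < length zs" "u \<in> S" "t = zs ! j + u"
        using f by (fastforce simp: monomial_algebra_def monomial_ideal_def in_set_conv_nth)
      then show ?case
        using LP.ideal_span_mult_nth[of j ?Z "Poly_Mapping.single u c"]
        by (simp add: mult_single add.commute monomial_algebra_single)
    qed (rule LP.ideal_span_add)
  qed
qed

text \<open>Multiplication by a monomial shifts exponents injectively, and an ideal spanned by
  monomials is determined by their exponents. Colon ideals can thus be tested one monomial at a
  time, which leaves a condition on \<open>S\<close> alone.\<close>

theorem koszul_monomial_filtration:
  assumes F: "\<And>zs j. zs \<in> F \<Longrightarrow> j < length zs \<Longrightarrow> zs ! j \<in> B \<and>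
      (\<exists>ys\<in>F. \<forall>s\<in>S. s + zs ! j \<in> monomial_ideal (set (take j zs)) \<longleftrightarrow> s \<in> monomial_ideal (set ys))"
    and xs: "xs \<in> F" "set xs = B"
  shows "koszul R (toric_grading B)"
proof -
  let ?x = "map (\<lambda>z. Poly_Mapping.single z 1) :: 'v monomial list \<Rightarrow> ('v, 'k) mpoly list"
  have "LP.ideal_quotients (?x ` F) Z" if "Z \<in> ?x ` F" for Z
    unfolding LP.ideal_quotients_def
  proof (intro allI impI)
    fix j assume j: "j < length Z"
    from that obtain zs where zs: "zs \<in> F" "Z = ?x zs"
      by blast
    obtain ys where ys: "ys \<in> F"
      "\<forall>s\<in>S. s + zs ! j \<in> monomial_ideal (set (take j zs)) \<longleftrightarrow> s \<in> monomial_ideal (set ys)"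
      using F[OF zs(1), of j] j zs(2) by auto
    have "r * Z ! j \<in> LP.ideal_span (take j Z) \<longleftrightarrow> r \<in> LP.ideal_span (?x ys)" if "r \<in> KS" for r
    proof -
      have "r * Z ! j \<in> LP.ideal_span (take j Z) \<longleftrightarrow>
          (\<forall>s\<in>Poly_Mapping.keys r. s + zs ! j \<in> monomial_ideal (set (take j zs)))"
        using j zs(2) ideal_span_monomials[of "take j zs"]
        by (auto simp: take_map monomial_algebra_def keys_mult_single)
      also have "\<dots> \<longleftrightarrow> r \<in> LP.ideal_span (?x ys)"
        using that ys(2) unfolding ideal_span_monomials by (auto simp: monomial_algebra_def)
      finally show ?thesis .
    qed
    then show "Z ! j \<in> monomial_algebra B \<and> (\<exists>Y\<in>?x ` F. \<forall>r\<in>KS. r * Z ! j \<in> LP.ideal_span (take j Z) \<longleftrightarrow> r \<in> LP.ideal_span Y)"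
      using F[OF zs(1), of j] j zs(2) ys(1) by (auto intro: monomial_algebra_single)
  qed
  then obtain L where L: "L 0 = map (\<lambda>y i. if i = 0 then y else 0) (?x xs)"
    "\<And>i j r. j < length (L i) \<Longrightarrow> (L i ! j) r \<in> monomial_algebra B"
    "\<And>i. LP.module_span (L (Suc i)) = LP.syzygies (L i)"
    using LP.linear_resolution[of "?x ` F" "?x xs"] xs(1) by blast
  \<comment> \<open>The vectors in \<open>L i\<close> are the columns of the map from the free
    module number \<open>i + 1\<close> to number \<open>i\<close>, hence the shift by one.\<close>
  define b where "b i = (case i of 0 \<Rightarrow> 1 | Suc i \<Rightarrow> length (L i))" for i
  \<comment> \<open>Vectors are functions on all naturals. Exactness only tests the rows below
    \<open>b i\<close>; the others vanish because the columns of \<open>L (Suc k)\<close> are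
    syzygies of \<open>L k\<close>.\<close>
  have rows: "(L i ! c) r = 0" if "c < b (Suc i)" "r \<ge> b i" for i c r
  proof (cases i)
    case 0
    then show ?thesis
      using that L(1) by (simp add: b_def)
  next
    case (Suc k)
    then have "L i ! c \<in> LP.syzygies (L k)"
      using that LP.module_span_nth[of c "L i"] L(3)[of k] by (simp add: b_def)
    then show ?thesis
      using that Suc by (simp add: LP.syzygies_def LP.free_module_def b_def)
  qed
  show ?thesis
  proof (rule G.koszulI[where b = b and D = "\<lambda>i r c. (L i ! c) r"])
    show "b 0 = 1"
      by (simp add: b_def)
    show "(L i ! c) r \<in> monomial_algebra B" if "r < b i" "c < b (Suc i)" for i r c
      using that L(2) by (simp add: b_def)
    show "x \<in> K_plus \<longleftrightarrow> (\<exists>w. (\<forall>c. w c \<in> KS) \<and> x = (\<Sum>c<b 1. (L 0 ! c) 0 * w c))"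
      if "x \<in> KS" for x
    proof -
      have "s \<in> monomial_ideal B \<longleftrightarrow> s \<noteq> 0" if s: "s \<in> S" for s
      proof
        assume "s \<in> monomial_ideal B"
        then show "s \<noteq> 0"
          using d_pos mdeg_B[of 0] by (auto simp: monomial_ideal_def monomial_add_eq_0_iff)
      next
        assume "s \<noteq> 0"
        obtain W where W: "Poly_Mapping.keys W \<subseteq> B" "s = weight W"
          using s by (auto simp: S_def)
        then have "W \<noteq> 0"
          using \<open>s \<noteq> 0\<close> by auto
        then obtain m U where "m \<in> B" "Poly_Mapping.keys U \<subseteq> B" "W = Poly_Mapping.single m 1 + U"
          using W(1) by (rule word_cases)
        then show "s \<in> monomial_ideal B"
          using W(2) by (auto simp: monomial_ideal_def weight_add S_def)
      qed
      then have "x \<in> K_plus \<longleftrightarrow> x \<in> monomial_algebra (monomial_ideal B)"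
        using that by (auto simp: K_plus_def monomial_algebra_def in_keys_iff subset_iff)
      also have "\<dots> \<longleftrightarrow> x \<in> LP.ideal_span (?x xs)"
        by (simp add: ideal_span_monomials xs(2))
      finally show ?thesis
        by (simp add: LP.ideal_span_def b_def L(1) mult.commute conj_commute)
    qed
    show "(\<forall>r<b i. (\<Sum>c<b (Suc i). (L i ! c) r * v c) = 0) \<longleftrightarrow>
      (\<exists>w. (\<forall>e. w e \<in> KS) \<and> (\<forall>c<b (Suc i). v c = (\<Sum>e<b (Suc (Suc i)). (L (Suc i) ! e) c * w e)))"
      if v: "\<forall>c<b (Suc i). v c \<in> KS" for i v
    proof -
      define v' where "v' c = (if c < b (Suc i) then v c else 0)" for c
      have v': "v' \<in> LP.free_module (length (L i))"
        using v by (auto simp: v'_def LP.free_module_def b_def)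
      have "(\<forall>r<b i. (\<Sum>c<b (Suc i). (L i ! c) r * v c) = 0) \<longleftrightarrow>
          (\<forall>r. (\<Sum>c<b (Suc i). (L i ! c) r * v c) = 0)"
      proof -
        have "(\<Sum>c<b (Suc i). (L i ! c) r * v c) = 0" if "r \<ge> b i" for r
          using rows that by (intro sum.neutral) auto
        then show ?thesis
          by (meson not_le)
      qed
      also have "\<dots> \<longleftrightarrow> v' \<in> LP.syzygies (L i)"
        using v' by (simp add: LP.syzygies_def LP.lin_comb_def fun_eq_iff v'_def b_def mult.commute)
      also have "\<dots> \<longleftrightarrow> v' \<in> LP.module_span (L (Suc i))"
        by (simp add: L(3))
      also have "\<dots> \<longleftrightarrow> (\<exists>w. (\<forall>e. w e \<in> KS) \<and> (\<forall>c<b (Suc i). v c = (\<Sum>e<b (Suc (Suc i)). (L (Suc i) ! e) c * w e)))"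
      proof
        assume "v' \<in> LP.module_span (L (Suc i))"
        then obtain w where w: "w \<in> LP.free_module (length (L (Suc i)))" "v' = LP.lin_comb w (L (Suc i))"
          by (rule LP.module_spanE)
        have "v c = (\<Sum>e<b (Suc (Suc i)). (L (Suc i) ! e) c * w e)" if "c < b (Suc i)" for c
          using fun_cong[OF w(2), of c] that by (simp add: v'_def LP.lin_comb_def b_def mult.commute)
        then show "\<exists>w. (\<forall>e. w e \<in> KS) \<and> (\<forall>c<b (Suc i). v c = (\<Sum>e<b (Suc (Suc i)). (L (Suc i) ! e) c * w e))"
          using w(1) by (auto simp: LP.free_module_def)
      next
        assume "\<exists>w. (\<forall>e. w e \<in> KS) \<and> (\<forall>c<b (Suc i). v c = (\<Sum>e<b (Suc (Suc i)). (L (Suc i) ! e) c * w e))"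
        then obtain w where w: "\<forall>e. w e \<in> KS"
          "\<forall>c<b (Suc i). v c = (\<Sum>e<b (Suc (Suc i)). (L (Suc i) ! e) c * w e)"
          by blast
        have "v' c = LP.lin_comb w (L (Suc i)) c" for c
        proof (cases "c < b (Suc i)")
          case True
          then show ?thesis
            using w(2) by (simp add: v'_def LP.lin_comb_def b_def mult.commute)
        next
          case False
          then show ?thesis
            using rows[of _ "Suc i" c] by (auto simp: v'_def LP.lin_comb_def b_def intro!: sum.neutral[symmetric])
        qed
        then have "v' = LP.lin_comb w (L (Suc i))" ..
        then show "v' \<in> LP.module_span (L (Suc i))"
          using w(1) LP.module_spanI by metis
      qed
      finally show ?thesis .
    qed
  qed
qed

end

section \<open>Lattice points in a triangle\<close>

text \<open>Three integer coordinates in place of exponent vectors turn the geometry into linear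
  arithmetic.\<close>

locale plane_lattice =
  fixes \<Lambda> :: "int \<Rightarrow> int \<Rightarrow> int \<Rightarrow> bool" and d :: int
  assumes d_pos: "d > 0"
    and \<Lambda>_add: "\<Lambda> a b c \<Longrightarrow> \<Lambda> a' b' c' \<Longrightarrow> \<Lambda> (a + a') (b + b') (c + c')"
    and \<Lambda>_neg: "\<Lambda> a b c \<Longrightarrow> \<Lambda> (- a) (- b) (- c)"
    and \<Lambda>_d: "\<Lambda> d 0 0" "\<Lambda> 0 d 0" "\<Lambda> 0 0 d"
begin

lemma \<Lambda>_mult: "\<Lambda> a b c \<Longrightarrow> \<Lambda> (n * a) (n * b) (n * c)"
proof (induction n rule: int_induct[where k = 0])
  case base
  then show ?case
    using \<Lambda>_add[OF \<Lambda>_d(1) \<Lambda>_neg[OF \<Lambda>_d(1)]] by simp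
next
  case (step1 n)
  then show ?case
    using \<Lambda>_add[of "n * a" "n * b" "n * c" a b c] by (simp add: algebra_simps)
next
  case (step2 n)
  then show ?case
    using \<Lambda>_add[OF step2.IH[OF step2.prems] \<Lambda>_neg[OF step2.prems]] by (simp add: algebra_simps)
qed

text \<open>Subtracting a vertex from the edge point gives the direction \<open>(x, -x, 0)\<close>.
  Together with \<open>(d, -d, 0)\<close> and Bezout it yields the step \<open>gcd x d\<close>, a
  proper divisor of \<open>d\<close> because \<open>x < d\<close>; hence it is at most half of
  \<open>d\<close>.\<close>

lemma edge_step:
  assumes "\<Lambda> x y 0" "0 < x" "0 < y" "x + y = d"
  obtains g where "0 < g" "2 * g \<le> d" "g dvd d" "\<Lambda> g (- g) 0"
proof -
  obtain u v where uv: "u * x + v * d = gcd x d"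
    using bezout_int by blast
  have "\<Lambda> x (- x) 0" "\<Lambda> d (- d) 0"
    using \<Lambda>_add[OF assms(1) \<Lambda>_neg[OF \<Lambda>_d(2)]] \<Lambda>_add[OF \<Lambda>_d(1) \<Lambda>_neg[OF \<Lambda>_d(2)]]
    by (simp_all flip: assms(4))
  then have "\<Lambda> (u * x + v * d) (u * (- x) + v * (- d)) (u * 0 + v * 0)"
    by (intro \<Lambda>_add \<Lambda>_mult)
  moreover have "u * (- x) + v * (- d) = - gcd x d"
    using uv by simp
  ultimately have "\<Lambda> (gcd x d) (- gcd x d) 0"
    by (simp only: uv mult_zero_right add_0_right)
  moreover have "gcd x d \<le> x"
    using assms(2) by (simp add: zdvd_imp_le)
  moreover have "2 * gcd x d \<le> d"
  proof -
    obtain k where k: "d = gcd x d * k"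
      using gcd_dvd2 by (rule dvdE)
    have "gcd x d > 0"
      using assms(2) by simp
    moreover have "gcd x d * 1 < gcd x d * k"
      using \<open>gcd x d \<le> x\<close> assms(3,4) k by linarith
    ultimately have "2 \<le> k"
      by (simp only: mult_less_cancel_left) auto
    then have "gcd x d * 2 \<le> gcd x d * k"
      using \<open>gcd x d > 0\<close> by (intro mult_left_mono) auto
    then show ?thesis
      using k by (simp add: mult.commute)
  qed
  ultimately show ?thesis
    using that[of "gcd x d"] assms(2) by simp
qed

context
  fixes g :: int
  assumes g: "0 < g" "2 * g \<le> d" "g dvd d" "\<Lambda> g (- g) 0"
begin

text \<open>Translations by \<open>(g, -g, 0)\<close> and \<open>(d, 0, 0)\<close> stay in the
  lattice. Membership thus depends only on \<open>c\<close>, on \<open>b\<close> modulo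
  \<open>g\<close> and on \<open>a + b\<close> modulo \<open>d\<close>.\<close>

lemma \<Lambda>_shift:
  assumes "\<Lambda> a b c" "g dvd b' - b" "d dvd a' + b' - (a + b)"
  shows "\<Lambda> a' b' c"
proof -
  obtain k m where "b' - b = g * k" "a' + b' - (a + b) = d * m"
    using assms(2,3) by (auto elim!: dvdE)
  moreover have "\<Lambda> (a + (- k) * g + m * d) (b + (- k) * (- g) + m * 0) (c + (- k) * 0 + m * 0)"
    using assms(1) g(4) \<Lambda>_d(1) by (intro \<Lambda>_add \<Lambda>_mult)
  moreover have "a + (- k) * g + m * d = a'" "b + (- k) * (- g) + m * 0 = b'"
    using calculation(1,2) by (auto simp: algebra_simps)
  ultimately show ?thesis
    by simp
qed

text \<open>The edge \<open>c = 0\<close> is divided into segments of length \<open>g\<close>. A point of the triangle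
  is \<open>flat\<close> if it lies in the triangle spanned by one of these segments and parallels to
  the two other edges.\<close>

definition flat :: "int \<Rightarrow> int \<Rightarrow> int \<Rightarrow> bool" where
  "flat a b c \<longleftrightarrow> \<Lambda> a b c \<and> 0 \<le> a \<and> 0 \<le> b \<and> 0 \<le> c \<and> a + b + c = d \<and> b mod g + c \<le> g"

lemma flat_edge:
  assumes "g dvd m" "0 \<le> m" "m \<le> d"
  shows "flat m (d - m) 0"
proof -
  have "g dvd d - m"
    using assms g(3) by simp
  then show ?thesis
    using \<Lambda>_shift[OF \<Lambda>_d(1), of "d - m" m] assms g(1) by (auto simp: flat_def mod_eq_0_iff_dvd)
qed

text \<open>The number of the segment below the point, \<open>b div g\<close>, turns the condition
  on \<open>b mod g\<close> into two linear inequalities.\<close>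

lemma flat_bounds:
  assumes "flat a b c"
  obtains i where "i * g \<le> b" "d - (i + 1) * g \<le> a" "0 \<le> i"
proof (rule that[of "b div g"])
  have "b div g * g + b mod g = b"
    by simp
  moreover have "b mod g \<ge> 0"
    using g(1) by simp
  ultimately show "b div g * g \<le> b" "d - (b div g + 1) * g \<le> a"
    using assms unfolding flat_def distrib_right by linarith+
  show "0 \<le> b div g"
    using assms g(1) by (simp add: flat_def pos_imp_zdiv_nonneg_iff)
qed

text \<open>For points over segments \<open>i\<close> and \<open>j\<close> and
  \<open>d = g * k\<close>, the two strict inequalities force \<open>i + j = k - 1\<close>. Then
  both coordinate sums are at least \<open>d - g\<close>, and \<open>d - g\<close> is at least
  \<open>g\<close>. This is divisibility by \<open>(g, d - g, 0)\<close>.\<close>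

lemma flat_add:
  assumes "flat a b c" "flat a' b' c'" "a + a' < d" "b + b' < d"
  shows "g \<le> a + a'" "d - g \<le> b + b'"
proof -
  obtain i where i: "i * g \<le> b" "d - (i + 1) * g \<le> a" "0 \<le> i"
    using assms(1) by (rule flat_bounds)
  obtain j where j: "j * g \<le> b'" "d - (j + 1) * g \<le> a'" "0 \<le> j"
    using assms(2) by (rule flat_bounds)
  obtain k where k: "d = g * k"
    using g(3) by (rule dvdE)
  have "(k - (i + j + 2)) * g < 0"
    using i(2) j(2) assms(3) k by (simp add: algebra_simps)
  then have "k < i + j + 2"
    using g(1) by (simp add: mult_less_0_iff)
  moreover have "(i + j - k) * g < 0"
    using i(1) j(1) assms(4) k by (simp add: algebra_simps)
  then have "i + j < k"
    using g(1) by (simp add: mult_less_0_iff)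
  ultimately have ij: "i + j = k - 1"
    by simp
  have "(k - 1) * g \<le> b + b'"
    using i(1) j(1) unfolding ij[symmetric] by (simp add: algebra_simps)
  then show "d - g \<le> b + b'"
    using k by (simp add: algebra_simps)
  have "2 * d - (i + j + 2) * g \<le> a + a'"
    using i(2) j(2) by (simp add: algebra_simps)
  then have "d - g \<le> a + a'"
    using k by (simp add: ij algebra_simps)
  then show "g \<le> a + a'"
    using g(2) by simp
qed

text \<open>Over segment 0 the first coordinate is at least \<open>d - g\<close>; over every other
  segment the second one is at least \<open>g\<close>.\<close>

lemma flat_add_edge:
  assumes "flat a b c"
  shows "d \<le> a + g \<or> d \<le> b + (d - g)"
proof -
  obtain i where i: "i * g \<le> b" "d - (i + 1) * g \<le> a" "0 \<le> i"
    using assms by (rule flat_bounds)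
  show ?thesis
  proof (cases "i = 0")
    case False
    then have "1 * g \<le> i * g"
      using i(3) g(1) by (intro mult_right_mono) auto
    then show ?thesis
      using i(1) by simp
  qed (use i in auto)
qed

lemma flat_highest:
  obtains a b c where "flat a b c" "\<And>a' b' c'. flat a' b' c' \<Longrightarrow> c' \<le> c"
proof -
  let ?H = "{c. \<exists>a b. flat a b c}"
  have "?H \<subseteq> {0..g}"
    using g(1) by (auto simp: flat_def) (smt (verit) pos_mod_sign)
  then have fin: "finite ?H"
    by (rule finite_subset) simp
  have "?H \<noteq> {}"
    using flat_edge[of 0] d_pos by auto
  then obtain a b where "flat a b (Max ?H)"
    using Max_in[OF fin] by auto
  then show ?thesis
    using that[of a b "Max ?H"] Max_ge[OF fin] by blast
qed

text \<open>Adding \<open>p\<close> to the highest flat point \<open>t\<close> (modulo the lattice spanned by the vertices and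
  the edge) leaves the set of flat points, and this locates a translate of \<open>t\<close> below the
  complement of \<open>p\<close>.\<close>

lemma flat_covering:
  assumes p: "\<Lambda> p q r" "0 < p" "0 < q" "0 < r" "p + q + r = d"
  obtains a b c where "flat a b c" "a \<le> d - p" "b \<le> d - q" "c \<le> d - r"
proof -
  define \<rho> where "\<rho> = q mod g"
  have \<rho>: "0 \<le> \<rho>" "\<rho> < g" "g dvd q - \<rho>" "q - \<rho> = q div g * g"
    using g(1) by (auto simp: \<rho>_def minus_mod_eq_div_mult)
  show ?thesis
  proof (cases "\<rho> = 0 \<or> g \<le> \<rho> + r")
    case True
    \<comment> \<open>The least multiple of \<open>g\<close> that is not below \<open>q\<close>. By
      the case assumption it does not exceed \<open>q + r = d - p\<close>, so the division point
      \<open>(m, d - m, 0)\<close> already fits.\<close>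
    define m where "m = (if \<rho> = 0 then q else q - \<rho> + g)"
    have "g dvd m" "q \<le> m" "m \<le> q + r"
      using True \<rho>(1-3) p(4) by (auto simp: m_def)
    then show ?thesis
      using that[OF flat_edge[of m]] p by simp
  next
    case False
    obtain a b c where t: "flat a b c" and max: "\<And>a' b' c'. flat a' b' c' \<Longrightarrow> c' \<le> c"
      using flat_highest by metis
    define \<tau> where "\<tau> = b mod g"
    have \<tau>: "0 \<le> \<tau>" "\<tau> < g" "g dvd b - \<tau>" "\<tau> + c \<le> g"
      using g(1) t by (auto simp: \<tau>_def flat_def)
    have c: "0 \<le> c" "\<Lambda> a b c" "a + b + c = d"
      using t by (auto simp: flat_def)
    \<comment> \<open>The translates of \<open>p + t\<close> at height \<open>r + c\<close>: any
      representative of \<open>q + b\<close> modulo \<open>g\<close> may serve as second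
      coordinate.\<close>
    have sum: "\<Lambda> (d - \<beta> - (r + c)) \<beta> (r + c)" if "g dvd \<beta> - (q + b)" for \<beta>
    proof -
      have "d - \<beta> - (r + c) + \<beta> - (p + a + (q + b)) = d * - 1"
        using p(5) c(3) by simp
      then show ?thesis
        using \<Lambda>_shift[OF \<Lambda>_add[OF p(1) c(2)] that] dvd_triv_left by metis
    qed
    have not_flat: False if "flat a' b' (r + c)" for a' b'
      using max[OF that] p(4) by simp
    have dvd1: "g dvd \<rho> + \<tau> - (q + b)"
    proof -
      have "\<rho> + \<tau> - (q + b) = - ((q - \<rho>) + (b - \<tau>))"
        by simp
      then show ?thesis
        using \<rho>(3) \<tau>(3) by (metis dvd_add dvd_minus_iff)
    qed
    \<comment> \<open>If \<open>\<rho> + \<tau>\<close> exceeded \<open>g\<close>, then reducing it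
      modulo \<open>g\<close> would give a flat point, since \<open>\<rho> + r < g\<close> and
      \<open>\<tau> + c \<le> g\<close>; its height \<open>r + c\<close> is greater than the maximum
      \<open>c\<close>. The bound \<open>ge\<close> has the same reason, without reduction.\<close>
    have le: "\<rho> + \<tau> \<le> g"
    proof (rule ccontr)
      assume "\<not> \<rho> + \<tau> \<le> g"
      moreover have "g dvd \<rho> + \<tau> - g - (q + b)"
        using dvd_diff[OF dvd1 dvd_refl] by (simp add: algebra_simps)
      moreover have "(\<rho> + \<tau> - g) mod g = \<rho> + \<tau> - g"
        using calculation(1) \<rho>(2) \<tau>(2) by (intro mod_pos_pos_trivial) auto
      ultimately have "flat (d - (\<rho> + \<tau> - g) - (r + c)) (\<rho> + \<tau> - g) (r + c)"
        using sum[of "\<rho> + \<tau> - g"] \<rho>(2) \<tau>(2,4) False p(4) c(1) g(1,2) unfolding flat_def by linarith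
      then show False
        by (rule not_flat)
    qed
    have ge: "g \<le> \<rho> + \<tau> + (r + c)"
    proof (rule ccontr)
      assume "\<not> g \<le> \<rho> + \<tau> + (r + c)"
      moreover have "(\<rho> + \<tau>) mod g = \<rho> + \<tau>"
        using calculation \<rho>(1) \<tau>(1) p(4) c(1) by (intro mod_pos_pos_trivial) auto
      ultimately have "flat (d - (\<rho> + \<tau>) - (r + c)) (\<rho> + \<tau>) (r + c)"
        using sum[OF dvd1] \<rho>(1) \<tau>(1) p(4) c(1) g(1,2) unfolding flat_def by linarith
      then show False
        by (rule not_flat)
    qed
    \<comment> \<open>\<open>t\<close> is moved to the segment complementary to that of
      \<open>p\<close>, which begins at \<open>d - g - (q - \<rho>)\<close>. Now \<open>le\<close>
      bounds the second coordinate by \<open>d - q\<close> and \<open>ge\<close> the first one by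
      \<open>d - p\<close>.\<close>
    define \<beta> where "\<beta> = \<tau> + (d - g - (q - \<rho>))"
    have dvd: "g dvd d - g - (q - \<rho>)"
      using g(3) \<rho>(3) by simp
    have q: "q - \<rho> \<le> d - g"
    proof -
      obtain k where k: "d = g * k"
        using g(3) by (rule dvdE)
      have "q div g * g < k * g"
        using \<rho>(1,4) p k mult.commute[of g k] by linarith
      then have "q div g < k"
        using g(1) by (simp only: mult_less_cancel_right)
      then have "(q div g + 1) * g \<le> k * g"
        using g(1) by (intro mult_right_mono) auto
      then show ?thesis
        using \<rho>(4) k by (simp add: algebra_simps)
    qed
    have mod: "\<beta> mod g = \<tau>"
      using \<tau> dvd by (metis \<beta>_def mod_add_right_eq mod_eq_0_iff_dvd add_0_right mod_pos_pos_trivial)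
    have "\<Lambda> (d - \<beta> - c) \<beta> c"
    proof (rule \<Lambda>_shift[OF c(2)])
      have "\<beta> - b = (d - g - (q - \<rho>)) - (b - \<tau>)"
        by (simp add: \<beta>_def)
      then show "g dvd \<beta> - b"
        using dvd \<tau>(3) by (metis dvd_diff)
      show "d dvd d - \<beta> - c + \<beta> - (a + b)"
        using c(3) by (simp add: algebra_simps)
    qed
    moreover have "\<rho> \<le> q"
      using p(3) by (simp add: \<rho>_def zmod_le_nonneg_dividend)
    ultimately have "flat (d - \<beta> - c) \<beta> c"
      using mod c(1) \<tau>(1,4) q by (simp add: flat_def \<beta>_def)
    then show ?thesis
      using le ge p \<tau> \<rho> c g False by (intro that[of "d - \<beta> - c" \<beta> c]) (auto simp: \<beta>_def)
  qed
qed

end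

end

section \<open>Triangles with a lattice point on an edge\<close>

text \<open>Divisibility in the polynomial ring. That it agrees with divisibility inside
  \<open>S\<close> has to be proved, see \<open>monomial_ideal_iff\<close>.\<close>

definition mdvd :: "'v monomial \<Rightarrow> 'v monomial \<Rightarrow> bool" where
  "mdvd s t \<longleftrightarrow> (\<forall>v. Poly_Mapping.lookup s v \<le> Poly_Mapping.lookup t v)"

lemma mdvd_refl [simp]: "mdvd s s"
  by (simp add: mdvd_def)

lemma mdvd_trans: "mdvd s t \<Longrightarrow> mdvd t u \<Longrightarrow> mdvd s u"
  by (meson mdvd_def order_trans)

lemma mdvd_add_left [simp]: "mdvd s (s + t)" and mdvd_add_right [simp]: "mdvd t (s + t)"
  by (simp_all add: mdvd_def lookup_add)

lemma mdvd_add_mono: "mdvd s t \<Longrightarrow> mdvd (s + u) (t + u)"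
  by (simp add: mdvd_def lookup_add)

lemma mdvd_add_diff: "mdvd s t \<Longrightarrow> s + (t - s) = t"
  by (rule monomial_diff_add) (simp add: mdvd_def)

lemma mdvd_same_degree: "mdvd s t \<Longrightarrow> mdeg s = mdeg t \<Longrightarrow> s = t"
  using mdvd_add_diff[of s t] mdeg_add[of s "t - s"] by simp

lemma mdvd_single: "mdvd (Poly_Mapping.single v n) t \<longleftrightarrow> n \<le> Poly_Mapping.lookup t v"
  by (auto simp: mdvd_def lookup_single when_def)

lemma UNIV_3_distinct:
  assumes "i \<noteq> j" "i \<noteq> k" "j \<noteq> (k :: 3)"
  shows "UNIV = {i, j, k}"
  using assms card_subset_eq[of UNIV "{i, j, k}"] by simp

lemma mdeg_3:
  assumes "i \<noteq> j" "i \<noteq> k" "j \<noteq> (k :: 3)"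
  shows "mdeg m = Poly_Mapping.lookup m i + Poly_Mapping.lookup m j + Poly_Mapping.lookup m k"
proof -
  have "mdeg m = (\<Sum>v\<in>UNIV. Poly_Mapping.lookup m v)"
    unfolding mdeg_def by (rule sum.mono_neutral_left) (auto simp: in_keys_iff)
  then show ?thesis
    using assms by (simp add: UNIV_3_distinct[OF assms])
qed

definition exponents :: "'v monomial \<Rightarrow> 'v \<Rightarrow> int" where
  "exponents m v = int (Poly_Mapping.lookup m v)"

lemma exponents_add: "exponents (s + t) = (\<lambda>v. exponents s v + exponents t v)"
  by (auto simp: exponents_def lookup_add)

lemma exponents_single: "exponents (Poly_Mapping.single v n) = (\<lambda>u. if u = v then int n else 0)"
  by (auto simp: exponents_def lookup_single when_def)

locale triangle_family = monomial_family B d K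
  for B :: "3 monomial set" and d and K :: "'k::field itself" +
  fixes \<Lambda> :: "(3 \<Rightarrow> int) \<Rightarrow> bool"
  assumes \<Lambda>_add: "\<Lambda> a \<Longrightarrow> \<Lambda> b \<Longrightarrow> \<Lambda> (\<lambda>v. a v + b v)"
    and \<Lambda>_neg: "\<Lambda> a \<Longrightarrow> \<Lambda> (\<lambda>v. - a v)"
    and \<Lambda>_vertex: "\<Lambda> (\<lambda>v. if v = u then int d else 0)"
    and B_iff: "m \<in> B \<longleftrightarrow> mdeg m = d \<and> \<Lambda> (exponents m)"
begin

definition vertex :: "3 \<Rightarrow> 3 monomial" where
  "vertex v = Poly_Mapping.single v d"

lemma vertex_B [simp]: "vertex v \<in> B"
  by (simp add: B_iff vertex_def exponents_single \<Lambda>_vertex)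

lemma mdvd_vertex: "mdvd (vertex v) s \<longleftrightarrow> d \<le> Poly_Mapping.lookup s v"
  by (simp add: vertex_def mdvd_single)

text \<open>Described by conditions and not by generators, hence visibly closed under exact division
  (\<open>cone_diff\<close>).\<close>

definition cone :: "3 monomial set" where
  "cone = {s. \<Lambda> (exponents s) \<and> d dvd mdeg s}"

lemma cone_add: "s \<in> cone \<Longrightarrow> t \<in> cone \<Longrightarrow> s + t \<in> cone"
  by (auto simp: cone_def exponents_add mdeg_add intro: \<Lambda>_add)

lemma B_cone: "B \<subseteq> cone"
  by (auto simp: cone_def B_iff)

lemma cone_diff:
  assumes "s \<in> cone" "t \<in> cone" "mdvd s t"
  shows "t - s \<in> cone"
proof -
  have t: "s + (t - s) = t"
    using assms(3) by (rule mdvd_add_diff)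
  have "exponents (t - s) = (\<lambda>v. exponents t v + - exponents s v)"
    using exponents_add[of s "t - s"] unfolding t by auto
  moreover have "\<Lambda> (\<lambda>v. exponents t v + - exponents s v)"
    using assms by (intro \<Lambda>_add \<Lambda>_neg) (auto simp: cone_def)
  moreover have "d dvd mdeg (t - s)"
    using assms mdeg_add[of s "t - s"] unfolding t cone_def
    by (metis (no_types, lifting) dvd_add_right_iff mem_Collect_eq)
  ultimately show ?thesis
    by (simp add: cone_def)
qed

lemma S_cone: "S \<subseteq> cone"
proof
  fix s assume "s \<in> S"
  then obtain W where W: "Poly_Mapping.keys W \<subseteq> B" "s = weight W"
    by (auto simp: S_def)
  have "0 \<in> cone"
    using \<Lambda>_add[OF \<Lambda>_vertex[of 0] \<Lambda>_neg[OF \<Lambda>_vertex[of 0]]] by (simp add: cone_def exponents_def[abs_def])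
  with W(1) have "weight W \<in> cone"
    using B_cone by (induction W rule: word_induct) (auto simp: weight_add intro: cone_add)
  then show "s \<in> cone"
    by (simp add: W(2))
qed

end

lemma cases_3_distinct: "i \<noteq> j \<Longrightarrow> i \<noteq> k \<Longrightarrow> j \<noteq> k \<Longrightarrow> v = i \<or> v = j \<or> v = (k :: 3)"
  using UNIV_3_distinct[of i j k] by blast

locale triangle_with_edge = triangle_family B d K \<Lambda>
  for B d and K :: "'k::field itself" and \<Lambda> +
  fixes i j k :: 3 and m\<^sub>0 :: "3 monomial"
  assumes ijk: "i \<noteq> j" "i \<noteq> k" "j \<noteq> k"
    and m0: "m\<^sub>0 \<in> B" "Poly_Mapping.keys m\<^sub>0 = {i, j}"
begin

sublocale plane: plane_lattice "\<lambda>a b c. \<Lambda> (\<lambda>v. if v = i then a else if v = j then b else c)" "int d"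
proof
  show "int d > 0"
    using d_pos by simp
  show "\<Lambda> (\<lambda>v. if v = i then a + a' else if v = j then b + b' else c + c')"
    if "\<Lambda> (\<lambda>v. if v = i then a else if v = j then b else c)"
      "\<Lambda> (\<lambda>v. if v = i then a' else if v = j then b' else c')" for a b c a' b' c'
    using \<Lambda>_add[OF that] by (rule back_subst[of \<Lambda>]) auto
  show "\<Lambda> (\<lambda>v. if v = i then - a else if v = j then - b else - c)"
    if "\<Lambda> (\<lambda>v. if v = i then a else if v = j then b else c)" for a b c
    using \<Lambda>_neg[OF that] by (rule back_subst[of \<Lambda>]) auto
  show "\<Lambda> (\<lambda>v. if v = i then int d else if v = j then 0 else 0)"
    using \<Lambda>_vertex[of i] by (rule back_subst[of \<Lambda>]) auto
  show "\<Lambda> (\<lambda>v. if v = i then 0 else if v = j then int d else 0)"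
    using \<Lambda>_vertex[of j] by (rule back_subst[of \<Lambda>]) (use ijk in auto)
  show "\<Lambda> (\<lambda>v. if v = i then 0 else if v = j then 0 else int d)"
    using \<Lambda>_vertex[of k] by (rule back_subst[of \<Lambda>]) (use ijk cases_3_distinct[OF ijk] in \<open>auto simp: fun_eq_iff\<close>)
qed

text \<open>A step as provided by \<open>edge_step\<close>, fixed once so that the following
  definitions can refer to it.\<close>

definition g :: int where
  "g = (SOME g. 0 < g \<and> 2 * g \<le> int d \<and> g dvd int d \<and>
     \<Lambda> (\<lambda>v. if v = i then g else if v = j then - g else 0))"

lemma exponents_ijk:
  "exponents m = (\<lambda>v. if v = i then int (Poly_Mapping.lookup m i)
     else if v = j then int (Poly_Mapping.lookup m j) else int (Poly_Mapping.lookup m k))"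
  using cases_3_distinct[OF ijk] by (auto simp: fun_eq_iff exponents_def)

lemma g: "0 < g" "2 * g \<le> int d" "g dvd int d" "\<Lambda> (\<lambda>v. if v = i then g else if v = j then - g else 0)"
proof -
  have pos: "Poly_Mapping.lookup m\<^sub>0 i > 0" "Poly_Mapping.lookup m\<^sub>0 j > 0" "Poly_Mapping.lookup m\<^sub>0 k = 0"
    using m0(2) ijk not_in_keys_iff_lookup_eq_zero[of k m\<^sub>0]
      not_in_keys_iff_lookup_eq_zero[of i m\<^sub>0] not_in_keys_iff_lookup_eq_zero[of j m\<^sub>0] by auto
  have "\<Lambda> (exponents m\<^sub>0)" "int (Poly_Mapping.lookup m\<^sub>0 i) + int (Poly_Mapping.lookup m\<^sub>0 j) = int d"
    using m0(1) pos(3) by (auto simp: B_iff mdeg_3[OF ijk])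
  then have m\<^sub>0_edge: "\<Lambda> (\<lambda>v. if v = i then int (Poly_Mapping.lookup m\<^sub>0 i)
      else if v = j then int (Poly_Mapping.lookup m\<^sub>0 j) else 0)"
    "int (Poly_Mapping.lookup m\<^sub>0 i) + int (Poly_Mapping.lookup m\<^sub>0 j) = int d"
    unfolding exponents_ijk[of m\<^sub>0] pos(3) of_nat_0 by simp_all
  have "int (Poly_Mapping.lookup m\<^sub>0 i) > 0" "int (Poly_Mapping.lookup m\<^sub>0 j) > 0"
    using pos by simp_all
  then have "\<exists>g. 0 < g \<and> 2 * g \<le> int d \<and> g dvd int d \<and>
     \<Lambda> (\<lambda>v. if v = i then g else if v = j then - g else 0)"
    using m\<^sub>0_edge(2)
  proof (rule plane.edge_step[OF m\<^sub>0_edge(1)])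
    fix g assume "0 < g" "2 * g \<le> int d" "g dvd int d"
      "\<Lambda> (\<lambda>v. if v = i then g else if v = j then - g else 0)"
    then show ?thesis
      by (intro exI[of _ g] conjI)
  qed
  then have "0 < g \<and> 2 * g \<le> int d \<and> g dvd int d \<and>
     \<Lambda> (\<lambda>v. if v = i then g else if v = j then - g else 0)"
    unfolding g_def by (rule someI_ex)
  then show "0 < g" "2 * g \<le> int d" "g dvd int d" "\<Lambda> (\<lambda>v. if v = i then g else if v = j then - g else 0)"
    by auto
qed

definition flats :: "3 monomial set" where
  "flats = {m. plane.flat g (int (Poly_Mapping.lookup m i)) (int (Poly_Mapping.lookup m j))
     (int (Poly_Mapping.lookup m k))}"

lemma flats_B: "flats \<subseteq> B"
  by (auto simp: flats_def plane.flat_def[OF g] B_iff mdeg_3[OF ijk] exponents_ijk)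

definition point :: "int \<Rightarrow> int \<Rightarrow> int \<Rightarrow> 3 monomial" where
  "point a b c = Poly_Mapping.single i (nat a) + Poly_Mapping.single j (nat b) + Poly_Mapping.single k (nat c)"

lemma lookup_point [simp]:
  "Poly_Mapping.lookup (point a b c) i = nat a" "Poly_Mapping.lookup (point a b c) j = nat b"
  "Poly_Mapping.lookup (point a b c) k = nat c"
  using ijk by (auto simp: point_def lookup_add lookup_single)

lemma all_ijk: "(\<forall>v. P v) \<longleftrightarrow> P i \<and> P j \<and> P k"
proof
  assume P: "P i \<and> P j \<and> P k"
  show "\<forall>v. P v"
  proof
    show "P v" for v
      using cases_3_distinct[OF ijk, of v] P by auto
  qed
qed auto

lemma mdvd_ijk:
  "mdvd s t \<longleftrightarrow> Poly_Mapping.lookup s i \<le> Poly_Mapping.lookup t i \<and>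
     Poly_Mapping.lookup s j \<le> Poly_Mapping.lookup t j \<and> Poly_Mapping.lookup s k \<le> Poly_Mapping.lookup t k"
  unfolding mdvd_def by (rule all_ijk)

lemma point_flats: "plane.flat g a b c \<Longrightarrow> point a b c \<in> flats"
  by (simp add: flats_def plane.flat_def[OF g] cong: if_cong)

text \<open>The division point next to \<open>vertex j\<close>; the monomial \<open>e\<close> of the
  overview.\<close>

definition edge_point :: "3 monomial" where
  "edge_point = point g (int d - g) 0"

lemma edge_point_flats: "edge_point \<in> flats"
  using plane.flat_edge[OF g, of g] g by (auto simp: edge_point_def intro!: point_flats)

lemma edge_point_not_vertex: "edge_point \<noteq> vertex v"
proof
  assume "edge_point = vertex v"
  then have "Poly_Mapping.keys edge_point = {v}"
    using d_pos by (simp add: vertex_def)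
  moreover have "i \<in> Poly_Mapping.keys edge_point" "j \<in> Poly_Mapping.keys edge_point"
    using g(1,2) by (auto simp: in_keys_iff edge_point_def)
  ultimately show False
    using ijk by auto
qed

text \<open>The vertices \<open>i\<close> and \<open>j\<close> are ends of segments and thus flat
  already; only the opposite vertex has to be added.\<close>

definition core :: "3 monomial set" where
  "core = insert (vertex k) flats"

lemma vertex_core: "vertex v \<in> core"
proof -
  have "vertex i \<in> flats" "vertex j \<in> flats"
    using plane.flat_edge[OF g, of "int d"] plane.flat_edge[OF g, of 0] g ijk
    by (auto simp: flats_def vertex_def lookup_single)
  then show ?thesis
    using cases_3_distinct[OF ijk, of v] by (auto simp: core_def)
qed

lemma core_B: "core \<subseteq> B"
  using flats_B by (auto simp: core_def)

lemma core_add: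
  assumes "s \<in> core" "t \<in> core"
  shows "(\<exists>v. mdvd (vertex v) (s + t)) \<or> mdvd edge_point (s + t)"
proof (cases "s = vertex k \<or> t = vertex k")
  case False
  let ?a = "int (Poly_Mapping.lookup (s + t) i)" and ?b = "int (Poly_Mapping.lookup (s + t) j)"
  have *: "g \<le> ?a" "int d - g \<le> ?b" if "?a < int d" "?b < int d"
    using plane.flat_add[OF g, of _ _ _ "int (Poly_Mapping.lookup t i)"
        "int (Poly_Mapping.lookup t j)" "int (Poly_Mapping.lookup t k)"] that assms False
    by (auto simp: core_def flats_def lookup_add)
  then show ?thesis
  proof (cases "?a < int d \<and> ?b < int d")
    case True
    then have "mdvd edge_point (s + t)"
      using * by (simp add: mdvd_ijk edge_point_def nat_le_iff)
    then show ?thesis ..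
  next
    case False
    then have "mdvd (vertex i) (s + t) \<or> mdvd (vertex j) (s + t)"
      by (auto simp: mdvd_vertex)
    then show ?thesis
      by blast
  qed
qed (use mdvd_add_left mdvd_add_right in blast)

lemma core_add_edge_point:
  assumes "s \<in> core"
  shows "\<exists>v. mdvd (vertex v) (s + edge_point)"
proof (cases "s = vertex k")
  case False
  then have "int d \<le> int (Poly_Mapping.lookup s i) + g \<or> int d \<le> int (Poly_Mapping.lookup s j) + (int d - g)"
    using plane.flat_add_edge[OF g] assms by (auto simp: core_def flats_def)
  then have "d \<le> Poly_Mapping.lookup (s + edge_point) i \<or> d \<le> Poly_Mapping.lookup (s + edge_point) j"
    using g(1,2) by (auto simp: lookup_add edge_point_def)
  then show ?thesis
    by (auto simp: mdvd_vertex)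
qed (use mdvd_add_left in blast)

text \<open>If no vertex divides \<open>s\<close>, all exponents are below \<open>d\<close>, so the
  degree is below \<open>3 * d\<close> and \<open>n = 2\<close>. The complement of \<open>s\<close>
  in \<open>(d, d, d)\<close> is then a lattice point of degree \<open>d\<close> with positive
  coordinates, and \<open>flat_covering\<close> finds a flat point below \<open>s\<close>.\<close>

lemma core_covering:
  assumes s: "s \<in> cone" "mdeg s = n * d" "n \<ge> 2"
  shows "\<exists>z\<in>core. mdvd z s"
proof (cases "\<exists>v. d \<le> Poly_Mapping.lookup s v")
  case True
  then show ?thesis
    using vertex_core by (auto simp: mdvd_vertex[symmetric])
next
  case False
  let ?s = "\<lambda>v. int (Poly_Mapping.lookup s v)"
  have lt: "?s v < int d" for v
    using False by (simp add: not_le)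
  have "n * d < 3 * d"
    using s(2) lt[of i] lt[of j] lt[of k] unfolding mdeg_3[OF ijk] by linarith
  then have "n = 2"
    using s(3) by (simp only: mult_less_cancel2) simp
  then have sum: "?s i + ?s j + ?s k = 2 * int d"
    using s(2) by (simp add: mdeg_3[OF ijk])
  have "\<Lambda> (\<lambda>v. if v = i then int d - ?s i else if v = j then int d - ?s j else int d - ?s k)"
  proof -
    have "\<Lambda> (\<lambda>v. if v = i then - ?s i else if v = j then - ?s j else - ?s k)"
    proof (rule plane.\<Lambda>_neg)
      have "\<Lambda> (exponents s)"
        using s(1) by (simp add: cone_def)
      then show "\<Lambda> (\<lambda>v. if v = i then ?s i else if v = j then ?s j else ?s k)"
        unfolding exponents_ijk[of s] .
    qed
    from plane.\<Lambda>_add[OF this plane.\<Lambda>_add[OF plane.\<Lambda>_d(1) plane.\<Lambda>_add[OF plane.\<Lambda>_d(2,3)]]]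
    show ?thesis
      by (simp add: algebra_simps cong: if_cong)
  qed
  then obtain a b c where z: "plane.flat g a b c" "a \<le> ?s i" "b \<le> ?s j" "c \<le> ?s k"
    by (rule plane.flat_covering[OF g]) (use lt[of i] lt[of j] lt[of k] sum in auto)
  then have "mdvd (point a b c) s"
    by (simp add: mdvd_ijk nat_le_iff)
  then show ?thesis
    using point_flats[OF z(1)] by (auto simp: core_def)
qed

text \<open>Core monomials can be split off until degree \<open>d\<close> is reached, where
  membership in the cone means membership in \<open>B\<close>.\<close>

lemma cone_S: "cone = S"
proof
  have "s \<in> S" if "s \<in> cone" "mdeg s = n * d" for s n
    using that
  proof (induction n arbitrary: s)
    case 0
    then show ?case by simp
  next
    case (Suc n)
    show ?case
    proof (cases "n = 0")
      case True
      then have "s \<in> B"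
        using Suc.prems by (simp add: B_iff cone_def)
      then show ?thesis
        using B_S by blast
    next
      case False
      then obtain z where z: "z \<in> core" "mdvd z s"
        using core_covering[OF Suc.prems] by auto
      have s: "z + (s - z) = s"
        using z(2) by (rule mdvd_add_diff)
      have "z \<in> B"
        using z core_B by blast
      then have "s - z \<in> cone" "mdeg (s - z) = n * d"
        using cone_diff[OF _ Suc.prems(1) z(2)] B_cone Suc.prems(2) mdeg_add[of z "s - z"] mdeg_B
        unfolding s by auto
      then have "s - z \<in> S"
        by (rule Suc.IH)
      then have "z + (s - z) \<in> S"
        using \<open>z \<in> B\<close> B_S by (intro S_add) auto
      then show ?thesis
        by (simp add: s)
    qed
  qed
  then show "cone \<subseteq> S"
    by (auto simp: cone_def elim!: dvdE simp: mult.commute)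
qed (rule S_cone)

section \<open>Colon ideals of the triangle and their filtration\<close>

lemma monomial_ideal_iff:
  assumes "s \<in> S" "Q \<subseteq> B"
  shows "s \<in> monomial_ideal Q \<longleftrightarrow> (\<exists>q\<in>Q. mdvd q s)"
proof
  assume "\<exists>q\<in>Q. mdvd q s"
  then obtain q where q: "q \<in> Q" "mdvd q s"
    by blast
  then have "s - q \<in> S"
    using assms B_cone cone_diff unfolding cone_S by blast
  then show "s \<in> monomial_ideal Q"
    using q mdvd_add_diff[OF q(2)] unfolding monomial_ideal_def by force
qed (use mdvd_add_left in \<open>unfold monomial_ideal_def, blast\<close>)

text \<open>The short lists generate the colon ideals of the vertices, which form a regular
  sequence. In the long lists \<open>cs\<close> is the remaining core and \<open>zs\<close> the rest
  of the generators; this order makes every colon ideal from \<open>edge_point\<close> on contain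
  the core.\<close>

definition filtration :: "3 monomial list set" where
  "filtration = {take n [vertex i, vertex j, vertex k] |n. n \<le> 2} \<union>
     {[vertex i, vertex j, vertex k, edge_point] @ cs @ zs |cs zs.
        distinct ([vertex i, vertex j, vertex k, edge_point] @ cs @ zs) \<and>
        set ([vertex i, vertex j, vertex k, edge_point] @ cs @ zs) \<subseteq> B \<and> set cs \<subseteq> core \<and>
        core \<subseteq> set ([vertex i, vertex j, vertex k, edge_point] @ cs)}"

lemma filtration_exists:
  assumes "core \<subseteq> T" "T \<subseteq> B"
  obtains ys where "ys \<in> filtration" "set ys = T"
proof -
  let ?V = "{vertex i, vertex j, vertex k, edge_point}"
  have fin: "finite T"
    using assms(2) finite_B finite_subset by blast
  obtain cs where cs: "set cs = core - ?V" "distinct cs"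
    using finite_distinct_list[of "core - ?V"] fin assms(1) by (meson finite_Diff finite_subset)
  obtain zs where zs: "set zs = T - core" "distinct zs"
    using finite_distinct_list[of "T - core"] fin by auto
  have V: "?V \<subseteq> core"
    using vertex_core edge_point_flats by (auto simp: core_def)
  have dist: "vertex i \<noteq> vertex j" "vertex i \<noteq> vertex k" "vertex j \<noteq> vertex k"
    using ijk d_pos by (auto simp: vertex_def dest!: arg_cong[of _ _ Poly_Mapping.keys])
  have all: "set ([vertex i, vertex j, vertex k, edge_point] @ cs @ zs) = T"
    using V cs(1) zs(1) assms(1) by auto
  moreover have "distinct ([vertex i, vertex j, vertex k, edge_point] @ cs @ zs)"
    using V cs zs dist edge_point_not_vertex by (auto simp: eq_commute[of "vertex _" edge_point])
  moreover have "core \<subseteq> set ([vertex i, vertex j, vertex k, edge_point] @ cs)" "set cs \<subseteq> core"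
    using V cs(1) by auto
  ultimately have "[vertex i, vertex j, vertex k, edge_point] @ cs @ zs \<in> filtration"
    unfolding filtration_def using assms(2) by blast
  then show ?thesis
    using that all by blast
qed

text \<open>\<open>T\<close> is the part of degree \<open>d\<close> of the colon ideal. It generates
  everything: elements of higher degree are divisible by a core monomial, which belongs to
  \<open>T\<close>, and degree 0 is excluded since \<open>z\<close> is not in \<open>Q\<close>. Any
  set between the core and \<open>B\<close> is listed in the filtration.\<close>

lemma colon_in_filtration:
  assumes Q: "Q \<subseteq> B" "z \<in> B" "z \<notin> Q"
    and colon: "\<And>c. c \<in> core \<Longrightarrow> \<exists>q\<in>Q. mdvd q (c + z)"
  shows "\<exists>ys\<in>filtration. \<forall>s\<in>S. s + z \<in> monomial_ideal Q \<longleftrightarrow> s \<in> monomial_ideal (set ys)"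
proof -
  define T where "T = {m \<in> B. \<exists>q\<in>Q. mdvd q (m + z)}"
  have T: "core \<subseteq> T" "T \<subseteq> B"
    using core_B colon by (auto simp: T_def)
  then obtain ys where ys: "ys \<in> filtration" "set ys = T"
    by (rule filtration_exists)
  have "(\<exists>q\<in>Q. mdvd q (s + z)) \<longleftrightarrow> (\<exists>m\<in>T. mdvd m s)" if s: "s \<in> S" for s
  proof
    assume "\<exists>m\<in>T. mdvd m s"
    then show "\<exists>q\<in>Q. mdvd q (s + z)"
      using mdvd_trans mdvd_add_mono by (force simp: T_def)
  next
    assume q: "\<exists>q\<in>Q. mdvd q (s + z)"
    obtain n where n: "mdeg s = n * d"
      using s by (rule S_degree)
    consider "n = 0" | "n = 1" | "n \<ge> 2"
      by linarith
    then show "\<exists>m\<in>T. mdvd m s"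
    proof cases
      case 1
      then obtain q where "q \<in> Q" "mdvd q z"
        using q n by auto
      then have "q = z"
        using mdvd_same_degree Q mdeg_B by (metis subsetD)
      then show ?thesis
        using \<open>q \<in> Q\<close> Q(3) by simp
    next
      case 2
      then have "s \<in> T"
        using q s n S_degree_d by (auto simp: T_def)
      then show ?thesis
        using mdvd_refl by blast
    next
      case 3
      then show ?thesis
        using core_covering[OF _ n] s T(1) unfolding cone_S by blast
    qed
  qed
  moreover have "s + z \<in> S" if "s \<in> S" for s
    using that Q(2) B_S S_add by blast
  ultimately have "\<forall>s\<in>S. s + z \<in> monomial_ideal Q \<longleftrightarrow> s \<in> monomial_ideal (set ys)"
    using Q(1) T(2) ys(2) by (simp add: monomial_ideal_iff)
  then show ?thesis
    using ys(1) by blast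
qed

text \<open>Multiplication by \<open>vertex v\<close> changes the exponent of \<open>v\<close>
  alone, while divisibility by another vertex looks at a different exponent.\<close>

lemma vertex_colon:
  assumes "s \<in> S" "v \<notin> A"
  shows "s + vertex v \<in> monomial_ideal (vertex ` A) \<longleftrightarrow> s \<in> monomial_ideal (vertex ` A)"
proof -
  have "s + vertex v \<in> S"
    using assms(1) B_S by (intro S_add) auto
  moreover have "mdvd (vertex a) (s + vertex v) \<longleftrightarrow> mdvd (vertex a) s" if "a \<in> A" for a
  proof -
    have "a \<noteq> v"
      using that assms(2) by blast
    then show ?thesis
      by (simp add: mdvd_vertex lookup_add) (simp add: vertex_def lookup_single)
  qed
  ultimately show ?thesis
    using assms(1) by (subst (1 2) monomial_ideal_iff) auto
qed

lemma filtration_colon: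
  assumes zs: "zs \<in> filtration" "n < length zs"
  shows "zs ! n \<in> B \<and> (\<exists>ys\<in>filtration. \<forall>s\<in>S.
    s + zs ! n \<in> monomial_ideal (set (take n zs)) \<longleftrightarrow> s \<in> monomial_ideal (set ys))"
proof (cases "n < 3")
  case True
  let ?V = "[vertex i, vertex j, vertex k]"
  have zs_n: "zs ! n = ?V ! n" "take n zs = take n ?V"
    using zs True by (auto simp: filtration_def numeral_3_eq_3 less_Suc_eq numeral_2_eq_2 le_Suc_eq)
  have "set (take n ?V) = vertex ` set (take n [i, j, k])" "?V ! n = vertex ([i, j, k] ! n)"
    "[i, j, k] ! n \<notin> set (take n [i, j, k])"
    using True ijk by (auto simp: numeral_3_eq_3 less_Suc_eq)
  then have "\<forall>s\<in>S. s + zs ! n \<in> monomial_ideal (set (take n zs)) \<longleftrightarrow> s \<in> monomial_ideal (set (take n ?V))"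
    unfolding zs_n using vertex_colon by metis
  moreover have "take n ?V \<in> filtration"
    using True unfolding filtration_def by (intro UnI1 CollectI exI[of _ n]) simp
  moreover have "zs ! n \<in> B"
    using \<open>?V ! n = vertex ([i, j, k] ! n)\<close> zs_n by simp
  ultimately show ?thesis
    by blast
next
  case False
  let ?V = "[vertex i, vertex j, vertex k, edge_point]"
  obtain cs ws where eq: "zs = ?V @ cs @ ws" and dist: "distinct zs" and B: "set zs \<subseteq> B"
    and core: "set cs \<subseteq> core" "core \<subseteq> set (?V @ cs)"
    using zs False by (auto simp: filtration_def)
  have in_B: "zs ! n \<in> B" "set (take n zs) \<subseteq> B"
    using zs(2) B nth_mem set_take_subset by fastforce+
  have notin: "zs ! n \<notin> set (take n zs)"
    using dist zs(2) by (auto simp: in_set_conv_nth distinct_conv_nth)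
  have vertices: "vertex v \<in> set (take n zs)" for v
    using False cases_3_distinct[OF ijk, of v] by (auto simp: eq take_Cons')
  have "\<exists>q\<in>set (take n zs). mdvd q (c + zs ! n)" if c: "c \<in> core" for c
  proof -
    \<comment> \<open>Positions 0 to 2 hold the vertices, position 3 \<open>edge_point\<close>, and
      the next \<open>length cs\<close> positions the other core monomials.\<close>
    consider "n = 3" | "n \<ge> 4" "n < 4 + length cs" | "n \<ge> 4 + length cs"
      using False by linarith
    then show ?thesis
    proof cases
      case 1
      then have "zs ! n = edge_point"
        by (simp add: eq)
      then show ?thesis
        using core_add_edge_point[OF c] vertices by auto
    next
      case 2
      then have "zs ! n \<in> core"
        using core(1) by (auto simp: eq nth_append nth_Cons' intro!: subsetD[OF core(1)])
      moreover have "edge_point \<in> set (take n zs)"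
        using 2 by (simp add: eq take_Cons')
      ultimately show ?thesis
        using core_add[OF c] vertices by blast
    next
      case 3
      then have "set (?V @ cs) \<subseteq> set (take n zs)"
        by (auto simp: eq take_Cons')
      then show ?thesis
        using c core(2) mdvd_add_left by blast
    qed
  qed
  then show ?thesis
    using colon_in_filtration[OF in_B(2,1) notin] in_B(1) by blast
qed

theorem koszul_triangle: "koszul R (toric_grading B)"
proof -
  obtain xs where "xs \<in> filtration" "set xs = B"
    using filtration_exists[OF core_B] by blast
  then show ?thesis
    using filtration_colon by (intro koszul_monomial_filtration) auto
qed

end

section \<open>Quadratic generation\<close>

context monomial_family
begin

abbreviation letter :: "'v monomial \<Rightarrow> ('v, 'k) mpoly" where
  "letter m \<equiv> Poly_Mapping.single m 1"

lemma linear_form: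
  assumes "f \<in> monomial_algebra B"
  shows "f = (\<Sum>m\<in>B. Poly_Mapping.single 0 (Poly_Mapping.lookup f m) * letter m)"
proof -
  have "f = (\<Sum>m\<in>Poly_Mapping.keys f. Poly_Mapping.single m (Poly_Mapping.lookup f m))"
    by (rule poly_mapping_sum_single[symmetric])
  also have "\<dots> = (\<Sum>m\<in>B. Poly_Mapping.single m (Poly_Mapping.lookup f m))"
    using assms finite_B by (intro sum.mono_neutral_left) (auto simp: monomial_algebra_def in_keys_iff)
  finally show ?thesis
    by (simp add: mult_single)
qed

lemma single_0_sum:
  "(\<Sum>i\<in>I. Poly_Mapping.single 0 (c i)) = (Poly_Mapping.single 0 (sum c I) :: ('v, 'k) mpoly)"
  by (induction I rule: infinite_finite_induct) (auto simp: single_add)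

lemma lookup_mult_constant:
  "Poly_Mapping.lookup (f * Poly_Mapping.single 0 c :: ('v, 'k) mpoly) s = Poly_Mapping.lookup f s * c"
  by (induction f rule: poly_mapping_induct_add)
     (auto simp: mult_single lookup_single when_def lookup_add algebra_simps)

lemma K_plus_1: "1 \<notin> K_plus"
  by (simp add: K_plus_def)

lemma letter_K_plus: "m \<in> B \<Longrightarrow> letter m \<in> K_plus"
  using B_S mdeg_B[of 0] d_pos by (auto simp: K_plus_def lookup_single when_def monomial_algebra_def)

text \<open>In a linear resolution of the residue field the first map can be replaced by the row
  of all the generators \<open>m \<in> B\<close>.\<close>

lemma koszul_linear_syzygies:
  assumes "koszul R (toric_grading B)"
    and \<sigma>: "\<And>m. m \<in> B \<Longrightarrow> \<sigma> m \<in> KS" "(\<Sum>m\<in>B. \<sigma> m * letter m) = 0"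
  obtains n :: nat and r :: "nat \<Rightarrow> ('v, 'k) mpoly" and l :: "nat \<Rightarrow> 'v monomial \<Rightarrow> ('v, 'k) mpoly"
  where "\<forall>e. r e \<in> KS" "\<forall>e<n. \<forall>m\<in>B. l e m \<in> monomial_algebra B"
    "\<forall>e<n. (\<Sum>m\<in>B. l e m * letter m) = 0" "\<forall>m\<in>B. \<sigma> m = (\<Sum>e<n. r e * l e m)"
proof -
  obtain b :: "nat \<Rightarrow> nat" and D :: "nat \<Rightarrow> nat \<Rightarrow> nat \<Rightarrow> ('v, 'k) mpoly"
    where b0: "b 0 > 0"
    and D': "\<forall>i. \<forall>r<b i. \<forall>c<b (Suc i). D i r c \<in> monomial_algebra B"
    and gen: "\<forall>x\<in>K_plus \<inter> KS. \<exists>w. (\<forall>c. w c \<in> KS) \<and>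
      (\<forall>r<b 0. (if r = 0 then x else 0) = (\<Sum>c<b 1. D 0 r c * w c))"
    and exact': "\<forall>i v. (\<forall>c<b (Suc i). v c \<in> KS) \<longrightarrow>
      (\<forall>r<b i. (\<Sum>c<b (Suc i). D i r c * v c) = 0) \<longleftrightarrow>
      (\<exists>w. (\<forall>e. w e \<in> KS) \<and> (\<forall>c<b (Suc i). v c = (\<Sum>e<b (Suc (Suc i)). D (Suc i) c e * w e)))"
    by (rule G.koszulE[OF assms(1) K_plus_1])
  note D = D'[rule_format] and exact = exact'[rule_format]
  have D_KS: "D i r c \<in> KS" if "r < b i" "c < b (Suc i)" for i r c
    using D[OF that] B_S by (auto simp: monomial_algebra_def)
  \<comment> \<open>Letters and matrix entries have the same degree, so the coefficients may be
    replaced by their constant terms.\<close>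
  have "\<forall>m\<in>B. \<exists>a. \<forall>r<b 0. (if r = 0 then letter m else 0)
      = (\<Sum>c<b 1. D 0 r c * Poly_Mapping.single 0 (a c))"
  proof
    fix m assume m: "m \<in> B"
    then obtain w where w: "\<forall>c. w c \<in> KS"
      "\<forall>r<b 0. (if r = 0 then letter m else 0) = (\<Sum>c<b 1. D 0 r c * w c)"
      using bspec[OF gen, of "letter m"] letter_K_plus[OF m] by (auto simp: K_plus_def)
    have "(if r = 0 then letter m else 0)
        = (\<Sum>c<b 1. D 0 r c * Poly_Mapping.single 0 (Poly_Mapping.lookup (w c) 0))" if r: "r < b 0" for r
    proof -
      have const_part: "mpoly_restrict (\<lambda>t. mdeg t = 0) f = Poly_Mapping.single 0 (Poly_Mapping.lookup f 0)"
        for f :: "('v, 'k) mpoly"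
        by (rule poly_mapping_eqI) (auto simp: lookup_mpoly_restrict lookup_single when_def)
      have "(if r = 0 then letter m else 0) = mpoly_restrict (\<lambda>t. mdeg t = 0 + d) (if r = 0 then letter m else 0)"
        using m mdeg_B by (simp add: mpoly_restrict_single)
      also have "\<dots> = mpoly_restrict (\<lambda>t. mdeg t = 0 + d) (\<Sum>c<b 1. w c * D 0 r c)"
        using w(2) r by (simp add: mult.commute)
      also have "\<dots> = (\<Sum>c<b 1. mpoly_restrict (\<lambda>t. mdeg t = 0) (w c) * D 0 r c)"
        using D[of r 0] r mdeg_B unfolding mpoly_restrict_sum
        by (intro sum.cong refl mpoly_restrict_mult) (auto simp: monomial_algebra_def)
      finally show ?thesis
        by (simp only: const_part mult.commute[of _ "D 0 r _"])
    qed
    then show "\<exists>a. \<forall>r<b 0. (if r = 0 then letter m else 0) = (\<Sum>c<b 1. D 0 r c * Poly_Mapping.single 0 (a c))"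
      by (intro exI[of _ "\<lambda>c. Poly_Mapping.lookup (w c) 0"]) blast
  qed
  then obtain a where a: "\<And>m r. m \<in> B \<Longrightarrow> r < b 0 \<Longrightarrow> (if r = 0 then letter m else 0)
      = (\<Sum>c<b 1. D 0 r c * Poly_Mapping.single 0 (a m c))"
    by metis
  \<comment> \<open>Scalar matrices of base change between the letters and the entries of row 0 of
    \<open>D 0\<close>. The product \<open>\<alpha>\<beta>\<close> is the identity because the
    letters are linearly independent.\<close>
  define \<alpha> where "\<alpha> m c = (Poly_Mapping.single 0 (a m c) :: ('v, 'k) mpoly)" for m c
  define \<beta> where "\<beta> c m = (Poly_Mapping.single 0 (Poly_Mapping.lookup (D 0 0 c) m) :: ('v, 'k) mpoly)" for c m
  have const: "\<alpha> m c \<in> KS" "\<beta> c m \<in> KS" for m c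
    by (simp_all add: \<alpha>_def \<beta>_def monomial_algebra_single)
  have \<alpha>\<beta>: "(\<Sum>c<b 1. \<alpha> m' c * \<beta> c m) = (if m' = m then 1 else 0)" if "m' \<in> B" for m m'
  proof -
    have "(\<Sum>c<b 1. \<alpha> m' c * \<beta> c m)
        = Poly_Mapping.single 0 (\<Sum>c<b 1. Poly_Mapping.lookup (D 0 0 c) m * a m' c)"
      by (simp add: \<alpha>_def \<beta>_def mult_single single_0_sum mult.commute)
    also have "(\<Sum>c<b 1. Poly_Mapping.lookup (D 0 0 c) m * a m' c) = Poly_Mapping.lookup (letter m') m"
      using a[OF that b0] by (simp add: lookup_sum lookup_mult_constant)
    finally show ?thesis
      by (simp add: lookup_single when_def)
  qed
  \<comment> \<open>The syzygy \<open>\<sigma>\<close> expressed in the columns of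
    \<open>D 0\<close>. Rows other than 0 vanish as well, since \<open>a\<close> was chosen with
    zeros there.\<close>
  define \<sigma>' where "\<sigma>' c = (\<Sum>m\<in>B. \<sigma> m * \<alpha> m c)" for c
  have "(\<Sum>c<b 1. D 0 r c * \<sigma>' c) = 0" if "r < b 0" for r
  proof -
    have "(\<Sum>c<b 1. D 0 r c * \<sigma>' c) = (\<Sum>m\<in>B. \<sigma> m * (\<Sum>c<b 1. D 0 r c * \<alpha> m c))"
      unfolding \<sigma>'_def sum_distrib_left by (subst sum.swap) (simp add: algebra_simps)
    also have "\<dots> = (\<Sum>m\<in>B. \<sigma> m * (if r = 0 then letter m else 0))"
      using a that by (simp add: \<alpha>_def)
    finally show ?thesis
      using \<sigma>(2) by (cases "r = 0") auto
  qed
  moreover have \<sigma>'_KS: "\<sigma>' c \<in> KS" for c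
    unfolding \<sigma>'_def using \<sigma>(1) const by (intro monomial_algebra_sum KS_mult)
  ultimately obtain w where w: "\<forall>e. w e \<in> KS" "\<forall>c<b 1. \<sigma>' c = (\<Sum>e<b 2. D 1 c e * w e)"
    using exact[of 0 \<sigma>'] by (auto simp: numeral_2_eq_2)
  \<comment> \<open>The columns of \<open>D 1\<close>, which are linear syzygies of
    \<open>D 0\<close>, carried back to the letters by \<open>\<beta>\<close>.\<close>
  define l where "l e m = (\<Sum>c<b 1. D 1 c e * \<beta> c m)" for e m
  show thesis
  proof (rule that[of w "b 2" l]; intro allI impI ballI)
    show "w e \<in> KS" for e
      using w(1) by blast
    show "l e m \<in> monomial_algebra B" if "e < b 2" for e m
      unfolding l_def
    proof (rule monomial_algebra_sum)
      fix c assume "c \<in> {..<b 1}"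
      then have "D 1 c e \<in> monomial_algebra B"
        using D[of c 1 e] that by (simp add: numeral_2_eq_2)
      then show "D 1 c e * \<beta> c m \<in> monomial_algebra B"
        by (rule monomial_algebra_mult[where T = "{0}"]) (auto simp: \<beta>_def monomial_algebra_def)
    qed
    show "(\<Sum>m\<in>B. l e m * letter m) = 0" if e: "e < b 2" for e
    proof -
      have "(\<Sum>m\<in>B. l e m * letter m) = (\<Sum>c<b 1. D 1 c e * (\<Sum>m\<in>B. \<beta> c m * letter m))"
        unfolding l_def sum_distrib_left sum_distrib_right by (subst sum.swap) (simp add: algebra_simps)
      also have "\<dots> = (\<Sum>c<b 1. D 0 0 c * D 1 c e)"
        using linear_form[OF D[of 0 0]] b0 by (intro sum.cong refl) (auto simp: \<beta>_def mult.commute)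
      also have "\<dots> = 0"
      proof -
        have "\<exists>w. (\<forall>e. w e \<in> KS) \<and> (\<forall>c<b (Suc 0). D 1 c e = (\<Sum>e'<b (Suc (Suc 0)). D (Suc 0) c e' * w e'))"
          using e by (intro exI[of _ "\<lambda>e'. if e' = e then 1 else 0"])
            (auto simp: monomial_algebra_def if_distrib[where f = "\<lambda>x. _ * x"] numeral_2_eq_2 cong: if_cong)
        then show ?thesis
          using exact[of 0 "\<lambda>c. D 1 c e"] D_KS[of _ 1 e] e b0 by (auto simp: numeral_2_eq_2)
      qed
      finally show ?thesis .
    qed
    show "\<sigma> m = (\<Sum>e<b 2. w e * l e m)" if "m \<in> B" for m
    proof -
      have "(\<Sum>e<b 2. w e * l e m) = (\<Sum>c<b 1. (\<Sum>e<b 2. D 1 c e * w e) * \<beta> c m)"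
        unfolding l_def sum_distrib_left sum_distrib_right by (subst sum.swap) (simp add: algebra_simps)
      also have "\<dots> = (\<Sum>c<b 1. \<sigma>' c * \<beta> c m)"
        using w(2) by simp
      also have "\<dots> = (\<Sum>m'\<in>B. \<sigma> m' * (\<Sum>c<b 1. \<alpha> m' c * \<beta> c m))"
        unfolding \<sigma>'_def sum_distrib_left sum_distrib_right by (subst sum.swap) (simp add: algebra_simps)
      also have "\<dots> = (\<Sum>m'\<in>B. if m' = m then \<sigma> m' else 0)"
        using \<alpha>\<beta> by (intro sum.cong refl) simp
      also have "\<dots> = \<sigma> m"
        using that finite_B by simp
      finally show ?thesis ..
    qed
  qed
qed

lemma mpoly_homogeneous_alt:
  "mpoly_homogeneous B (int n) = monomial_algebra {t. Poly_Mapping.keys t \<subseteq> B \<and> mdeg t = n}"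
  by (auto simp: mpoly_homogeneous_def carrier_mpoly_ring monomial_algebra_def)

lemma mpoly_homogeneous_mult:
  "f \<in> mpoly_homogeneous B (int m) \<Longrightarrow> g \<in> mpoly_homogeneous B (int n) \<Longrightarrow> f * g \<in> mpoly_homogeneous B (int (m + n))"
  unfolding mpoly_homogeneous_alt
  by (erule (1) monomial_algebra_mult) (auto simp: mdeg_add keys_add_monomial)

lemma toric_ideal_iff: "f \<in> toric_ideal B \<longleftrightarrow> f \<in> carrier P_B \<and> monomial_map f = 0"
  by (simp only: toric_ideal_def a_kernel_def' mem_Collect_eq mpoly_ring_simps)

definition variable :: "'v monomial \<Rightarrow> ('v monomial, 'k) mpoly" where
  "variable m = Poly_Mapping.single (Poly_Mapping.single m 1) 1"

lemma monomial_map_variable: "monomial_map (variable m) = letter m"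
  by (simp add: variable_def)

lemma variable_homogeneous: "m \<in> B \<Longrightarrow> variable m \<in> mpoly_homogeneous B (int 1)"
  unfolding mpoly_homogeneous_alt variable_def by (rule monomial_algebra_single) simp

lemma homogeneous_decomposition:
  assumes "f \<in> mpoly_homogeneous B (int (Suc n))"
  shows "\<exists>F. (\<forall>m. F m \<in> mpoly_homogeneous B (int n)) \<and> f = (\<Sum>m\<in>B. F m * variable m)"
proof (induction f rule: poly_mapping_induct_add)
  case zero
  show ?case
    by (intro exI[of _ "\<lambda>_. 0"]) (simp add: mpoly_homogeneous_alt)
next
  case (single t c)
  then have t: "Poly_Mapping.keys t \<subseteq> B" "mdeg t = Suc n"
    using assms unfolding mpoly_homogeneous_alt by (auto simp: monomial_algebra_def)
  then have "t \<noteq> 0"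
    by auto
  then obtain m U where m: "m \<in> B" "Poly_Mapping.keys U \<subseteq> B" "t = Poly_Mapping.single m 1 + U"
    using t(1) by (rule word_cases)
  have "(\<Sum>m'\<in>B. (if m' = m then Poly_Mapping.single U c else 0) * variable m') = Poly_Mapping.single U c * variable m"
    using m(1) finite_B by (simp add: if_distrib[where f = "\<lambda>x. x * _"] cong: if_cong)
  also have "\<dots> = Poly_Mapping.single t c"
    by (simp add: variable_def m(3) mult_single add.commute)
  finally have "Poly_Mapping.single t c = (\<Sum>m'\<in>B. (if m' = m then Poly_Mapping.single U c else 0) * variable m')" ..
  moreover have "Poly_Mapping.single U c \<in> mpoly_homogeneous B (int n)"
    unfolding mpoly_homogeneous_alt using m t by (intro monomial_algebra_single) (simp add: mdeg_add)
  moreover have "0 \<in> mpoly_homogeneous B (int n)"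
    by (simp add: mpoly_homogeneous_alt)
  ultimately show ?case
    by (intro exI[of _ "\<lambda>m'. if m' = m then Poly_Mapping.single U c else 0"]) auto
next
  case (add f g)
  then obtain F F' where "\<forall>m. F m \<in> mpoly_homogeneous B (int n)" "f = (\<Sum>m\<in>B. F m * variable m)"
    "\<forall>m. F' m \<in> mpoly_homogeneous B (int n)" "g = (\<Sum>m\<in>B. F' m * variable m)"
    by blast
  then show ?case
    by (intro exI[of _ "\<lambda>m. F m + F' m"])
       (auto simp: algebra_simps sum.distrib mpoly_homogeneous_alt intro: monomial_algebra_add)
qed

lemma monomial_map_inj_on:
  assumes "inj_on weight (Poly_Mapping.keys f)" "monomial_map f = 0"
  shows "f = 0"
proof (rule poly_mapping_eqI)
  fix t
  show "Poly_Mapping.lookup f t = Poly_Mapping.lookup 0 t"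
  proof (cases "t \<in> Poly_Mapping.keys f")
    case True
    then have "{u \<in> Poly_Mapping.keys f. weight u = weight t} = {t}"
      using assms(1) by (auto simp: inj_on_def)
    then show ?thesis
      using lookup_monomial_map[of f "weight t"] assms(2) by simp
  qed (simp add: in_keys_iff)
qed

text \<open>Words of length at most 1 are determined by their weights.\<close>

lemma toric_ideal_low_degree:
  assumes "f \<in> mpoly_homogeneous B (int n)" "n \<le> 1" "monomial_map f = 0"
  shows "f = 0"
proof (rule monomial_map_inj_on[OF _ assms(3)])
  have keys: "Poly_Mapping.keys t \<subseteq> B \<and> mdeg t = n" if "t \<in> Poly_Mapping.keys f" for t
    using assms(1) that unfolding mpoly_homogeneous_alt by (auto simp: monomial_algebra_def)
  show "inj_on weight (Poly_Mapping.keys f)"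
  proof (cases "n = 0")
    case True
    then show ?thesis
      using keys by (auto simp: inj_on_def)
  next
    case False
    then have "\<exists>m. t = Poly_Mapping.single m 1" if "t \<in> Poly_Mapping.keys f" for t
      using keys[OF that] assms(2) word_degree_1[of t B] by (metis le_neq_implies_less less_one)
    then show ?thesis
      by (metis One_nat_def inj_onI weight_single)
  qed
qed

text \<open>For degree at least 3 write \<open>f\<close> as the sum of
  \<open>F m * variable m\<close>. The images of the \<open>F m\<close> are a syzygy of the letters,
  hence a combination of linear syzygies \<open>l e\<close> with coefficients \<open>r e\<close>.
  With lifts \<open>L\<close> and \<open>\<rho>\<close>, \<open>f\<close> is the sum of the
  \<open>(F m - (\<Sum>e<N. \<rho> e * L e m)) * variable m\<close>, where induction covers the
  bracket, and of multiples by \<open>\<rho> e\<close> of the toric quadrics formed from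
  \<open>L e\<close>.\<close>

theorem koszul_quadratic:
  assumes koszul: "koszul R (toric_grading B)"
  shows "generated_by_quadrics B (toric_ideal B :: ('v monomial, 'k) mpoly set)"
proof -
  define Q where "Q = (toric_ideal B :: ('v monomial, 'k) mpoly set) \<inter> mpoly_homogeneous B (int 2)"
  have I: "ideal (toric_ideal B) P_B"
    unfolding toric_ideal_def by (rule P.kernel_is_ideal)
  have Q: "Q \<subseteq> carrier P_B"
    by (auto simp: Q_def toric_ideal_iff)
  define J where "J = Idl\<^bsub>P_B\<^esub> Q"
  interpret J: ideal J P_B
    unfolding J_def using Q by (rule P.R.genideal_ideal)
  have J_0: "0 \<in> J"
    using J.zero_closed by simp
  have J_add: "f + g \<in> J" if "f \<in> J" "g \<in> J" for f g
    using J.a_closed[OF that] by simp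
  have J_mult: "f * g \<in> J" if "f \<in> J" "g \<in> carrier P_B" for f g
    using J.I_r_closed[OF that] by simp
  have J_sum: "sum F A \<in> J" if "\<And>x. x \<in> A \<Longrightarrow> F x \<in> J"
    for F :: "'c \<Rightarrow> ('v monomial, 'k) mpoly" and A
    using that by (induction A rule: infinite_finite_induct) (auto intro: J_0 J_add)
  have Q_J: "Q \<subseteq> J"
    unfolding J_def using Q by (rule P.R.genideal_self)
  have H_carrier: "f \<in> carrier P_B" if "f \<in> mpoly_homogeneous B n" for f :: "('v monomial, 'k) mpoly" and n
    using that by (simp add: mpoly_homogeneous_def)
  have homogeneous: "f \<in> J" if "f \<in> mpoly_homogeneous B (int n)" "monomial_map f = 0" for f n
    using that
  proof (induction n arbitrary: f)
    case 0
    then show ?case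
      using toric_ideal_low_degree[of f 0] J_0 by simp
  next
    case (Suc n)
    consider "n = 0" | "n = 1" | "n \<ge> 2"
      by linarith
    then show ?case
    proof cases
      case 1
      then show ?thesis
        using toric_ideal_low_degree[of f 1] J_0 Suc.prems by simp
    next
      case 2
      then have "f \<in> Q"
        using Suc.prems H_carrier by (auto simp: Q_def toric_ideal_iff)
      then show ?thesis
        using Q_J by blast
    next
      case 3
      define n' where "n' = n - 1"
      have n': "n = n' + 1"
        using 3 by (simp add: n'_def)
      obtain F where F: "\<And>m. F m \<in> mpoly_homogeneous B (int n)" "f = (\<Sum>m\<in>B. F m * variable m)"
        using homogeneous_decomposition[OF Suc.prems(1)] by blast
      have \<sigma>: "monomial_map (F m) \<in> KS" for m
        using F(1) H_carrier by (intro monomial_map_in) blast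
      have \<sigma>_0: "(\<Sum>m\<in>B. monomial_map (F m) * letter m) = 0"
        using Suc.prems(2) unfolding F(2)
        by (simp only: monomial_map_sum monomial_map_mult monomial_map_variable)
      obtain N :: nat and r :: "nat \<Rightarrow> ('v, 'k) mpoly" and l :: "nat \<Rightarrow> 'v monomial \<Rightarrow> ('v, 'k) mpoly"
        where r: "\<forall>e. r e \<in> KS"
        and l: "\<forall>e<N. \<forall>m\<in>B. l e m \<in> monomial_algebra B"
        "\<forall>e<N. (\<Sum>m\<in>B. l e m * letter m) = 0"
        and eq: "\<forall>m\<in>B. monomial_map (F m) = (\<Sum>e<N. r e * l e m)"
        by (rule koszul_linear_syzygies[where \<sigma> = "\<lambda>m. monomial_map (F m)", OF koszul \<sigma> \<sigma>_0])
      note r = r[rule_format] and l = l[rule_format] and eq = eq[rule_format]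
      \<comment> \<open>\<open>F m\<close> has degree \<open>n = n' + 1\<close> and
        \<open>l e m\<close> is linear, so only the component of degree \<open>n'\<close> of
        \<open>r e\<close> contributes.\<close>
      define r' where "r' e = mpoly_restrict (\<lambda>t. mdeg t = n' * d) (r e)" for e
      have eq': "monomial_map (F m) = (\<Sum>e<N. r' e * l e m)" if m: "m \<in> B" for m
      proof -
        have "monomial_map (F m) = mpoly_restrict (\<lambda>t. mdeg t = n' * d + d) (monomial_map (F m))"
          using monomial_map_homogeneous[OF F(1)[of m]]
          by (intro mpoly_restrict_id[symmetric]) (auto simp: K_piece_def n' algebra_simps simp flip: of_nat_mult of_nat_add)
        also have "\<dots> = (\<Sum>e<N. mpoly_restrict (\<lambda>t. mdeg t = n' * d + d) (r e * l e m))"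
          by (simp only: eq[OF m] mpoly_restrict_sum)
        also have "\<dots> = (\<Sum>e<N. r' e * l e m)"
          unfolding r'_def using l(1)[OF _ m] mdeg_B
          by (intro sum.cong refl mpoly_restrict_mult) (auto simp: monomial_algebra_def)
        finally show ?thesis .
      qed
      have "\<exists>p. p \<in> mpoly_homogeneous B (int n') \<and> monomial_map p = r' e" for e
      proof (rule homogeneous_lift[of "r' e" n'])
        show "r' e \<in> K_piece (int n')"
          using r[of e] by (auto simp: K_piece_def r'_def keys_mpoly_restrict monomial_algebra_def)
      qed blast
      then obtain \<rho> where \<rho>: "\<And>e. \<rho> e \<in> mpoly_homogeneous B (int n')" "\<And>e. monomial_map (\<rho> e) = r' e"
        by metis
      have "\<exists>p. p \<in> mpoly_homogeneous B (int 1) \<and> monomial_map p = l e m" if "e < N" "m \<in> B" for e m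
        using homogeneous_lift[of "l e m" 1] l(1)[OF that] K_piece_1 by auto
      then obtain L where L: "\<And>e m. e < N \<Longrightarrow> m \<in> B \<Longrightarrow> L e m \<in> mpoly_homogeneous B (int 1)"
        "\<And>e m. e < N \<Longrightarrow> m \<in> B \<Longrightarrow> monomial_map (L e m) = l e m"
        by metis
      have "F m - (\<Sum>e<N. \<rho> e * L e m) \<in> J" if m: "m \<in> B" for m
      proof (rule Suc.IH)
        have "(\<Sum>e<N. \<rho> e * L e m) \<in> mpoly_homogeneous B (int n)"
          unfolding mpoly_homogeneous_alt
          by (rule monomial_algebra_sum, unfold mpoly_homogeneous_alt[symmetric] n', rule mpoly_homogeneous_mult)
             (use \<rho>(1) L(1) m in auto)
        then show "F m - (\<Sum>e<N. \<rho> e * L e m) \<in> mpoly_homogeneous B (int n)"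
          using F(1) unfolding mpoly_homogeneous_alt by (intro monomial_algebra_diff)
        show "monomial_map (F m - (\<Sum>e<N. \<rho> e * L e m)) = 0"
          using eq'[OF m] \<rho>(2) L(2) m by (simp add: monomial_map_diff monomial_map_sum monomial_map_mult)
      qed
      then have "(\<Sum>m\<in>B. (F m - (\<Sum>e<N. \<rho> e * L e m)) * variable m) \<in> J"
        using H_carrier[OF variable_homogeneous] by (intro J_sum J_mult) auto
      moreover have "(\<Sum>m\<in>B. L e m * variable m) \<in> J" if e: "e < N" for e
      proof -
        have "(\<Sum>m\<in>B. L e m * variable m) \<in> mpoly_homogeneous B (int (1 + 1))"
          unfolding mpoly_homogeneous_alt
          by (rule monomial_algebra_sum, unfold mpoly_homogeneous_alt[symmetric], rule mpoly_homogeneous_mult)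
             (use L(1) e variable_homogeneous in auto)
        moreover have "monomial_map (\<Sum>m\<in>B. L e m * variable m) = 0"
          using l(2)[OF e] L(2)[OF e] by (simp add: monomial_map_sum monomial_map_mult monomial_map_variable)
        ultimately have "(\<Sum>m\<in>B. L e m * variable m) \<in> Q"
          using H_carrier by (auto simp: Q_def toric_ideal_iff numeral_2_eq_2)
        then show ?thesis
          using Q_J by blast
      qed
      then have "(\<Sum>e<N. (\<Sum>m\<in>B. L e m * variable m) * \<rho> e) \<in> J"
        using H_carrier[OF \<rho>(1)] by (intro J_sum[of "{..<N}"] J_mult) auto
      ultimately have "(\<Sum>m\<in>B. (F m - (\<Sum>e<N. \<rho> e * L e m)) * variable m)
          + (\<Sum>e<N. (\<Sum>m\<in>B. L e m * variable m) * \<rho> e) \<in> J"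
        by (rule J_add)
      also have "(\<Sum>m\<in>B. (F m - (\<Sum>e<N. \<rho> e * L e m)) * variable m)
          + (\<Sum>e<N. (\<Sum>m\<in>B. L e m * variable m) * \<rho> e) = f"
      proof -
        have "(\<Sum>e<N. (\<Sum>m\<in>B. L e m * variable m) * \<rho> e) = (\<Sum>m\<in>B. (\<Sum>e<N. \<rho> e * L e m) * variable m)"
          unfolding sum_distrib_left sum_distrib_right by (subst sum.swap) (simp add: algebra_simps)
        then show ?thesis
          by (simp add: F(2) left_diff_distrib sum_subtractf)
      qed
      finally show ?thesis .
    qed
  qed
  have "toric_ideal B \<subseteq> J"
  proof
    fix f :: "('v monomial, 'k) mpoly" assume "f \<in> toric_ideal B"
    then have f: "f \<in> carrier P_B" "monomial_map f = 0"
      by (auto simp: toric_ideal_iff)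
    have "mpoly_restrict (\<lambda>t. mdeg t = n) f \<in> J" for n
    proof (rule homogeneous)
      show "mpoly_restrict (\<lambda>t. mdeg t = n) f \<in> mpoly_homogeneous B (int n)"
        using restrict_in_P_B[OF f(1)] by (auto simp: mpoly_homogeneous_def keys_mpoly_restrict)
      show "monomial_map (mpoly_restrict (\<lambda>t. mdeg t = n) f) = 0"
        using monomial_map_restrict_degree[OF f(1)] f(2) by simp
    qed
    then have "(\<Sum>n\<in>mdeg ` Poly_Mapping.keys f. mpoly_restrict (\<lambda>t. mdeg t = n) f) \<in> J"
      by (rule J_sum)
    also have "(\<Sum>n\<in>mdeg ` Poly_Mapping.keys f. mpoly_restrict (\<lambda>t. mdeg t = n) f) = f"
      by (rule poly_mapping_eqI) (auto simp: lookup_sum lookup_mpoly_restrict in_keys_iff)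
    finally show "f \<in> J" .
  qed
  moreover have "J \<subseteq> toric_ideal B"
    unfolding J_def by (rule P.R.genideal_minimal[OF I]) (auto simp: Q_def)
  ultimately have "toric_ideal B = Idl\<^bsub>P_B\<^esub> Q"
    by (simp add: J_def)
  then show ?thesis
    unfolding generated_by_quadrics_def by (intro exI[of _ Q]) (auto simp: Q_def)
qed

end

section \<open>Triangles without lattice points on the edges\<close>

lemma card_keys_3:
  fixes m :: "3 monomial"
  assumes "card (Poly_Mapping.keys m) \<noteq> 2" "u \<noteq> v" "u \<in> Poly_Mapping.keys m" "v \<in> Poly_Mapping.keys m"
  shows "w \<in> Poly_Mapping.keys m"
proof -
  have "card {u, v} \<le> card (Poly_Mapping.keys m)"
    using assms by (intro card_mono) auto
  moreover have "card (Poly_Mapping.keys m) \<le> card (UNIV :: 3 set)"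
    by (intro card_mono) auto
  ultimately have "card (Poly_Mapping.keys m) = card (UNIV :: 3 set)"
    using assms(1,2) by simp
  then have "Poly_Mapping.keys m = UNIV"
    by (intro card_subset_eq) auto
  then show ?thesis
    by simp
qed

lemma third_index: "\<exists>w :: 3. w \<noteq> u \<and> w \<noteq> v"
proof (rule ccontr)
  assume "\<not> (\<exists>w :: 3. w \<noteq> u \<and> w \<noteq> v)"
  then have "UNIV = {u, v}"
    by blast
  then have "card (UNIV :: 3 set) = card {u, v}"
    by simp
  moreover have "card {u, v} \<le> 2"
    by (simp add: card_insert_if)
  ultimately show False
    by simp
qed

lemma weight_sum: "weight (sum f I) = (\<Sum>i\<in>I. weight (f i))"
  by (induction I rule: infinite_finite_induct) (auto simp: weight_add)

context triangle_family
begin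

definition total :: "3 monomial" where
  "total = (\<Sum>v\<in>UNIV. vertex v)"

lemma lookup_total [simp]: "Poly_Mapping.lookup total v = d"
  by (simp add: total_def lookup_sum vertex_def lookup_single when_def)

lemma lookup_vertex: "Poly_Mapping.lookup (vertex u) v = (if u = v then d else 0)"
  by (simp add: vertex_def lookup_single when_def)

lemma vertex_inject [simp]: "vertex u = vertex v \<longleftrightarrow> u = v"
proof
  assume "vertex u = vertex v"
  then have "Poly_Mapping.lookup (vertex u) u = Poly_Mapping.lookup (vertex v) u"
    by simp
  then show "u = v"
    using d_pos by (simp add: lookup_vertex split: if_splits)
qed simp

lemma mdeg_UNIV: "mdeg (m :: 3 monomial) = (\<Sum>v\<in>UNIV. Poly_Mapping.lookup m v)"
  unfolding mdeg_def by (rule sum.mono_neutral_left) (auto simp: in_keys_iff)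

lemma mdeg_total: "mdeg total = 3 * d"
  by (simp add: mdeg_UNIV)

lemma total_cone: "total \<in> cone"
proof -
  have "vertex v \<in> cone" for v
    using B_cone by auto
  then show ?thesis
    unfolding total_def sum_3 by (intro cone_add)
qed

lemma cone_B: "m \<in> cone \<Longrightarrow> mdeg m = d \<Longrightarrow> m \<in> B"
  by (simp add: B_iff cone_def)

text \<open>The degree is \<open>d\<close> or \<open>2 * d\<close>. In the second case all exponents
  of \<open>m\<close> are positive, so its complement in \<open>total\<close> has degree
  \<open>d\<close> and no exponent equal to \<open>d\<close>.\<close>

lemma box_element:
  assumes "m \<in> cone" "m \<noteq> 0" "\<And>v. Poly_Mapping.lookup m v < d"
  shows "\<exists>p\<in>B. \<forall>v. p \<noteq> vertex v"
proof -
  obtain n where n: "mdeg m = d * n"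
    using assms(1) by (auto simp: cone_def)
  have sum: "mdeg m = Poly_Mapping.lookup m 1 + Poly_Mapping.lookup m 2 + Poly_Mapping.lookup m 3"
    by (rule mdeg_3) auto
  have "d * n < d * 3"
    using n assms(3)[of 1] assms(3)[of 2] assms(3)[of 3] sum by linarith
  then have "n < 3"
    by (simp only: mult_less_cancel1)
  moreover have "n \<noteq> 0"
    using n assms(2) by (metis mdeg_eq_0_iff mult_0_right)
  ultimately consider "n = 1" | "n = 2"
    by linarith
  then show ?thesis
  proof cases
    case 1
    have "m \<noteq> vertex v" for v
      using assms(3)[of v] by (auto simp: lookup_vertex)
    then show ?thesis
      using cone_B[OF assms(1)] n 1 by auto
  next
    case 2
    have pos: "Poly_Mapping.lookup m v > 0" for v
    proof -
      have "v \<in> {1, 2, 3}"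
        using UNIV_3 by blast
      then show ?thesis
        using n 2 sum assms(3)[of 1] assms(3)[of 2] assms(3)[of 3] by auto
    qed
    have le: "mdvd m total"
      using assms(3) by (simp add: mdvd_def less_imp_le)
    have eq: "m + (total - m) = total"
      by (rule mdvd_add_diff[OF le])
    have "total - m \<in> B"
      using cone_diff[OF assms(1) total_cone le] mdeg_add[of m "total - m"] n 2
      unfolding eq mdeg_total by (intro cone_B) auto
    moreover have "total - m \<noteq> vertex v" for v
    proof
      assume "total - m = vertex v"
      then have "Poly_Mapping.lookup (total - m) v = d"
        by (simp add: lookup_vertex)
      then show False
        using pos[of v] d_pos by (simp add: lookup_minus)
    qed
    ultimately show ?thesis
      by blast
  qed
qed

definition inner :: "3 monomial set" where
  "inner = {m \<in> B. \<forall>v. 0 < Poly_Mapping.lookup m v}"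

context
  assumes no_edge: "\<forall>m\<in>B. card (Poly_Mapping.keys m) \<noteq> 2"
begin

lemma inner_or_vertex:
  assumes "m \<in> B" "m \<notin> inner"
  obtains v where "m = vertex v"
proof -
  have "m \<noteq> 0"
    using mdeg_B[OF assms(1)] d_pos by auto
  then obtain v where v: "v \<in> Poly_Mapping.keys m"
    using keys_eq_empty by blast
  have "Poly_Mapping.lookup m u = 0" if "u \<noteq> v" for u
  proof (rule ccontr)
    assume "Poly_Mapping.lookup m u \<noteq> 0"
    then have "u \<in> Poly_Mapping.keys m"
      by (simp add: in_keys_iff)
    then have "w \<in> Poly_Mapping.keys m" for w
      using card_keys_3[OF _ that _ v] no_edge assms(1) by blast
    then show False
      using assms by (auto simp: inner_def in_keys_iff)
  qed
  note zero = this
  have "mdeg m = Poly_Mapping.lookup m v"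
    using sum.mono_neutral_right[of UNIV "{v}" "Poly_Mapping.lookup m"] zero by (simp add: mdeg_UNIV)
  then have "m = vertex v"
    using zero mdeg_B[OF assms(1)] lookup_vertex[of v] by (intro poly_mapping_eqI) simp
  then show ?thesis
    by (rule that)
qed

lemma inner_lt: "m \<in> inner \<Longrightarrow> Poly_Mapping.lookup m v < d"
proof (rule ccontr)
  assume m: "m \<in> inner" and "\<not> Poly_Mapping.lookup m v < d"
  then have "mdvd (vertex v) m"
    by (simp add: mdvd_vertex)
  then have "vertex v = m"
    using m by (intro mdvd_same_degree) (auto simp: inner_def mdeg_B)
  moreover obtain u where "u \<noteq> v"
    using third_index[of v v] by blast
  ultimately show False
    using m by (auto simp: inner_def lookup_vertex dest: spec[of _ u])
qed

text \<open>Otherwise \<open>t \<mapsto> t + p\<close> modulo the vertices would be an injection from the inner points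
  to themselves that misses \<open>p\<close>.\<close>

lemma inner_triple:
  assumes p: "p \<in> inner"
  obtains t q where "t \<in> B" "q \<in> B" "p + t + q = total"
proof -
  have "\<exists>t\<in>inner. \<forall>v. Poly_Mapping.lookup (p + t) v < d"
  proof (rule ccontr)
    assume "\<not> (\<exists>t\<in>inner. \<forall>v. Poly_Mapping.lookup (p + t) v < d)"
    then have "\<forall>t\<in>inner. \<exists>v. mdvd (vertex v) (p + t)"
      by (auto simp: mdvd_vertex not_less)
    then obtain c where c: "\<And>t. t \<in> inner \<Longrightarrow> mdvd (vertex (c t)) (p + t)"
      by metis
    define f where "f t = p + t - vertex (c t)" for t
    have f: "vertex (c t) + f t = p + t" if "t \<in> inner" for t
      unfolding f_def by (rule mdvd_add_diff[OF c[OF that]])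
    have f_inner: "f t \<in> inner" if t: "t \<in> inner" for t
    proof -
      have pt: "p \<in> B" "t \<in> B" "p \<in> cone" "t \<in> cone"
        using p t B_cone by (auto simp: inner_def)
      have "f t \<in> B"
      proof (rule cone_B)
        show "f t \<in> cone"
          unfolding f_def using c[OF t] pt B_cone by (intro cone_diff cone_add) auto
        show "mdeg (f t) = d"
          using arg_cong[OF f[OF t], of mdeg] pt by (simp add: mdeg_add mdeg_B)
      qed
      \<comment> \<open>A product of two vertices omits a variable, whereas \<open>p\<close>
        involves all three.\<close>
      moreover have "f t \<noteq> vertex u" for u
      proof
        assume "f t = vertex u"
        then have eq: "vertex (c t) + vertex u = p + t"
          using f[OF t] by simp
        obtain w where "w \<noteq> c t" "w \<noteq> u"
          using third_index by blast
        then have "Poly_Mapping.lookup (p + t) w = 0"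
          unfolding eq[symmetric] by (simp add: lookup_add lookup_vertex)
        moreover have "0 < Poly_Mapping.lookup p w"
          using p by (simp add: inner_def)
        ultimately show False
          by (simp add: lookup_add)
      qed
      ultimately show ?thesis
        using inner_or_vertex by blast
    qed
    have "inj_on f inner"
    proof (rule inj_onI)
      fix t t' assume t: "t \<in> inner" "t' \<in> inner" "f t = f t'"
      have "p + (t + vertex (c t')) = p + (t' + vertex (c t))"
      proof -
        have "p + (t + vertex (c t')) = vertex (c t) + f t + vertex (c t')"
          by (simp only: f[OF t(1)] add.assoc)
        also have "\<dots> = vertex (c t') + f t' + vertex (c t)"
          by (simp only: t(3) ac_simps)
        also have "\<dots> = p + (t' + vertex (c t))"
          by (simp only: f[OF t(2)] add.assoc)
        finally show ?thesis .
      qed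
      then have eq: "t + vertex (c t') = t' + vertex (c t)"
        by simp
      show "t = t'"
      proof (cases "c t = c t'")
        \<comment> \<open>Otherwise comparing the exponents of \<open>c t\<close> shows that
          \<open>t\<close> has an exponent of at least \<open>d\<close> there.\<close>
        case False
        then show ?thesis
          using arg_cong[OF eq, of "\<lambda>m. Poly_Mapping.lookup m (c t)"] inner_lt[OF t(1), of "c t"]
          by (simp add: lookup_add lookup_vertex)
      qed (use eq in simp)
    qed
    moreover have "finite inner"
      using finite_B by (simp add: inner_def)
    moreover have "f ` inner \<subseteq> inner"
      using f_inner by (rule image_subsetI)
    ultimately have "f ` inner = inner"
      by (simp add: endo_inj_surj)
    then have "p \<in> f ` inner"
      using p by simp
    then obtain t where t: "p = f t" "t \<in> inner"
      by (rule imageE)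
    \<comment> \<open>If \<open>p\<close> were a value of \<open>f\<close>, then \<open>t\<close>
      would be a vertex, which is not inner.\<close>
    have "p + vertex (c t) = p + t"
      using f[OF t(2)] by (simp only: t(1)[symmetric] add.commute[of "vertex (c t)" p])
    then have "t = vertex (c t)"
      by simp
    then have "Poly_Mapping.lookup t (c t) = Poly_Mapping.lookup (vertex (c t)) (c t)"
      by (rule arg_cong)
    then show False
      using inner_lt[OF t(2), of "c t"] by (simp add: lookup_vertex)
  qed
  then obtain t where t: "t \<in> inner" "\<And>v. Poly_Mapping.lookup (p + t) v < d"
    by blast
  have pt: "p \<in> B" "t \<in> B" "p \<in> cone" "t \<in> cone"
    using p t B_cone by (auto simp: inner_def)
  have le: "mdvd (p + t) total"
    using t(2) by (simp add: mdvd_def less_imp_le)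
  have eq: "p + t + (total - (p + t)) = total"
    by (rule mdvd_add_diff[OF le])
  have "total - (p + t) \<in> B"
    using cone_diff[OF cone_add[OF pt(3,4)] total_cone le] arg_cong[OF eq, of mdeg] pt
    by (intro cone_B) (auto simp: mdeg_add mdeg_B mdeg_total)
  then show ?thesis
    using that pt eq by blast
qed

text \<open>The word with the three vertices as letters, to be distinguished from its weight
  \<open>total\<close>.\<close>

definition corners :: "3 monomial monomial" where
  "corners = (\<Sum>v\<in>UNIV. Poly_Mapping.single (vertex v) 1)"

lemma lookup_corners: "Poly_Mapping.lookup corners m = (if \<exists>v. m = vertex v then 1 else 0)"
proof (cases "\<exists>v. m = vertex v")
  case True
  then obtain v where "m = vertex v"
    by blast
  then show ?thesis
    by (auto simp: corners_def lookup_sum lookup_single when_def)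
qed (auto simp: corners_def lookup_sum lookup_single when_def intro!: sum.neutral)

lemma weight_corners: "weight corners = total"
  by (simp add: corners_def total_def weight_sum)

text \<open>The weight of \<open>T\<close> is a product of two vertices and omits the third
  variable. The letters of \<open>U\<close> therefore cannot be inner, so they are vertices, and the
  exponents tell which ones.\<close>

lemma corners_pair_unique:
  assumes T: "mdvd T corners" "mdeg T = 2"
    and U: "Poly_Mapping.keys U \<subseteq> B" "mdeg U = 2" "weight U = weight T"
  shows "U = T"
proof -
  have "Poly_Mapping.keys T \<subseteq> range vertex"
  proof
    fix m assume "m \<in> Poly_Mapping.keys T"
    then have "0 < Poly_Mapping.lookup corners m"
      using T(1) unfolding mdvd_def in_keys_iff by (metis gr0I le_zero_eq)
    then show "m \<in> range vertex"
      by (auto simp: lookup_corners split: if_splits)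
  qed
  with T(2) obtain m n where "m \<in> range vertex" "n \<in> range vertex"
    "T = Poly_Mapping.single m 1 + Poly_Mapping.single n 1"
    by (rule word_degree_2)
  then obtain a b where ab: "T = Poly_Mapping.single (vertex a) 1 + Poly_Mapping.single (vertex b) 1"
    by blast
  have "a \<noteq> b"
  proof
    assume "a = b"
    then have "Poly_Mapping.lookup T (vertex a) = 2"
      by (simp add: ab lookup_add)
    then show False
      using T(1) by (auto simp: mdvd_def lookup_corners dest: spec[of _ "vertex a"])
  qed
  obtain m n where mn: "m \<in> B" "n \<in> B" "U = Poly_Mapping.single m 1 + Poly_Mapping.single n 1"
    using word_degree_2[OF U(2,1)] by metis
  have eq: "m + n = vertex a + vertex b"
    using U(3) by (simp add: ab mn(3) weight_add)
  obtain w where "w \<noteq> a" "w \<noteq> b"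
    using third_index by blast
  then have "Poly_Mapping.lookup (m + n) w = 0"
    by (simp add: eq lookup_add lookup_vertex)
  then have "m \<notin> inner" "n \<notin> inner"
    by (auto simp: inner_def lookup_add dest: spec[of _ w])
  then obtain a' b' where a'b': "m = vertex a'" "n = vertex b'"
    using mn inner_or_vertex by metis
  have lookups: "(if a' = v then d else 0) + (if b' = v then d else 0)
      = (if a = v then d else 0) + (if b = v then d else 0)" for v
    using arg_cong[OF eq, of "\<lambda>m. Poly_Mapping.lookup m v"] by (simp add: a'b' lookup_add lookup_vertex)
  have "(a' = a \<and> b' = b) \<or> (a' = b \<and> b' = a)"
    using lookups[of a] lookups[of b] \<open>a \<noteq> b\<close> d_pos by (auto split: if_splits)
  then show ?thesis
    by (auto simp: ab mn(3) a'b' add.commute)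
qed

text \<open>Polynomials without terms at divisors of \<open>corners\<close> form an ideal
  \<open>N\<close>, because a factor of a divisor is a divisor. Toric quadrics lie in
  \<open>N\<close>, as a pair of distinct vertices is alone in its fibre; the relation between
  \<open>corners\<close> and an inner triple does not.\<close>

theorem not_quadratic:
  assumes "p \<in> B" "\<forall>v. p \<noteq> vertex v"
  shows "\<not> generated_by_quadrics B (toric_ideal B :: (3 monomial, 'k) mpoly set)"
proof
  assume "generated_by_quadrics B (toric_ideal B :: (3 monomial, 'k) mpoly set)"
  then obtain Q where Q: "Q \<subseteq> mpoly_homogeneous B 2" "toric_ideal B = Idl\<^bsub>P_B\<^esub> Q"
    unfolding generated_by_quadrics_def by blast
  have "p \<in> inner"
    using assms inner_or_vertex by blast
  then obtain t q where tq: "t \<in> B" "q \<in> B" "p + t + q = total"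
    by (rule inner_triple)
  define N where "N = {f \<in> carrier P_B. \<forall>T. mdvd T corners \<longrightarrow> Poly_Mapping.lookup f T = 0}"
  have "ideal N P_B"
  proof (rule cring_idealI[OF mpoly_ring_cring])
    show "N \<subseteq> carrier P_B" "\<zero>\<^bsub>P_B\<^esub> \<in> N"
      by (auto simp: N_def carrier_mpoly_ring)
    show "f \<oplus>\<^bsub>P_B\<^esub> g \<in> N" if "f \<in> N" "g \<in> N" for f g
      using that by (auto simp: N_def lookup_add carrier_mpoly_ring intro: monomial_algebra_add)
    show "g \<otimes>\<^bsub>P_B\<^esub> f \<in> N" if "f \<in> N" "g \<in> carrier P_B" for f g
    proof -
      have "Poly_Mapping.lookup (g * f) T = 0" if "mdvd T corners" for T
      proof (rule lookup_mult_singleton)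
        fix a b assume "a + b = T" "b \<in> Poly_Mapping.keys f"
        then show False
          using \<open>f \<in> N\<close> that mdvd_trans[OF mdvd_add_right[of b a]] by (auto simp: N_def in_keys_iff)
      qed
      moreover have "g \<otimes>\<^bsub>P_B\<^esub> f \<in> carrier P_B"
        using that by (intro P.R.m_closed) (auto simp: N_def)
      ultimately show ?thesis
        by (simp add: N_def)
    qed
  qed
  moreover have "Q \<subseteq> N"
  proof
    fix f assume f: "f \<in> Q"
    have homog: "f \<in> carrier P_B" "\<And>T. T \<in> Poly_Mapping.keys f \<Longrightarrow> mdeg T = 2 \<and> Poly_Mapping.keys T \<subseteq> B"
      using f Q(1) P_B_keys[of f] by (auto simp: mpoly_homogeneous_def)
    have "Q \<subseteq> toric_ideal B"
      unfolding Q(2) using Q(1) by (intro P.R.genideal_self) (auto simp: mpoly_homogeneous_def)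
    then have zero: "monomial_map f = 0"
      using f by (auto simp: toric_ideal_iff)
    have "Poly_Mapping.lookup f T = 0" if "mdvd T corners" for T
    proof (rule ccontr)
      assume "Poly_Mapping.lookup f T \<noteq> 0"
      then have T: "T \<in> Poly_Mapping.keys f"
        by (simp add: in_keys_iff)
      then have "{U \<in> Poly_Mapping.keys f. weight U = weight T} = {T}"
        using corners_pair_unique[OF that] homog(2) by auto
      then show False
        using lookup_monomial_map[of f "weight T"] zero T by (simp add: in_keys_iff)
    qed
    then show "f \<in> N"
      using homog(1) by (simp add: N_def)
  qed
  ultimately have "toric_ideal B \<subseteq> N"
    unfolding Q(2) by (rule P.R.genideal_minimal)
  define W where "W = Poly_Mapping.single p 1 + Poly_Mapping.single t 1 + (Poly_Mapping.single q 1 :: 3 monomial monomial)"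
  define f where "f = Poly_Mapping.single corners 1 - (Poly_Mapping.single W 1 :: (3 monomial, 'k) mpoly)"
  have "Poly_Mapping.keys corners \<subseteq> B"
    by (auto simp: in_keys_iff lookup_corners split: if_splits)
  moreover have "Poly_Mapping.keys W \<subseteq> B"
    using assms(1) tq by (simp add: W_def keys_add_monomial)
  moreover have "weight W = weight corners"
    using tq(3) by (simp add: W_def weight_add weight_corners)
  ultimately have "f \<in> toric_ideal B"
    by (auto simp: toric_ideal_iff f_def carrier_mpoly_ring monomial_map_diff
        intro!: monomial_algebra_diff monomial_algebra_single)
  moreover have "Poly_Mapping.lookup W p \<noteq> Poly_Mapping.lookup corners p"
    using assms(2) by (simp add: W_def lookup_add lookup_corners)
  then have "Poly_Mapping.lookup f corners = 1"
    by (auto simp: f_def lookup_minus lookup_single when_def)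
  ultimately show False
    using \<open>toric_ideal B \<subseteq> N\<close> by (auto simp: N_def)
qed

end

end

section \<open>Diagonal groups\<close>

text \<open>Translation by \<open>y\<close> permutes the group and multiplies the sum by
  \<open>\<phi> y\<close>.\<close>

lemma (in group) sum_character:
  fixes \<phi> :: "'a \<Rightarrow> 'k::field"
  assumes "finite (carrier G)"
    and mult: "\<And>x y. x \<in> carrier G \<Longrightarrow> y \<in> carrier G \<Longrightarrow> \<phi> (x \<otimes> y) = \<phi> x * \<phi> y"
    and y: "y \<in> carrier G" "\<phi> y \<noteq> 1"
  shows "(\<Sum>x\<in>carrier G. \<phi> x) = 0"
proof -
  have "\<phi> y * (\<Sum>x\<in>carrier G. \<phi> x) = (\<Sum>x\<in>carrier G. \<phi> (y \<otimes> x))"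
    using mult y by (simp add: sum_distrib_left)
  also have "\<dots> = (\<Sum>x\<in>(\<lambda>x. y \<otimes> x) ` carrier G. \<phi> x)"
    using inj_on_multc y by (simp add: sum.reindex inj_on_def)
  also have "(\<lambda>x. y \<otimes> x) ` carrier G = carrier G"
    using surj_const_mult[OF y(1)] .
  finally show ?thesis
    using y(2) by (metis mult_cancel_right1 mult.commute)
qed

lemma sum_powers_root_of_unity:
  fixes x :: "'k::field"
  assumes "x ^ d = 1"
  shows "(\<Sum>a<d. x ^ a) = (if x = 1 then of_nat d else 0)"
proof (cases "x = 1")
  case False
  have "(x - 1) * (\<Sum>a<d. x ^ a) = 0"
    using power_diff_1_eq[of x d] assms by simp
  then show ?thesis
    using False by simp
qed simp

text \<open>The number of pairs \<open>(a, b)\<close> modulo the order of the group for which \<open>\<phi>\<^sup>a \<psi>\<^sup>b\<close> is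
  trivial is, by orthogonality, a positive multiple of the order.\<close>

lemma (in group) character_relation:
  fixes \<phi> \<psi> :: "'a \<Rightarrow> 'k::field_char_0"
  assumes fin: "finite (carrier G)" and d: "order G = d" "d \<ge> 2"
    and \<phi>: "\<And>x y. x \<in> carrier G \<Longrightarrow> y \<in> carrier G \<Longrightarrow> \<phi> (x \<otimes> y) = \<phi> x * \<phi> y"
      "\<And>x. x \<in> carrier G \<Longrightarrow> \<phi> x ^ d = 1"
    and \<psi>: "\<And>x y. x \<in> carrier G \<Longrightarrow> y \<in> carrier G \<Longrightarrow> \<psi> (x \<otimes> y) = \<psi> x * \<psi> y"
      "\<And>x. x \<in> carrier G \<Longrightarrow> \<psi> x ^ d = 1"
  obtains a b where "a < d" "b < d" "(a, b) \<noteq> (0, 0)" "\<And>x. x \<in> carrier G \<Longrightarrow> \<phi> x ^ a * \<psi> x ^ b = 1"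
proof -
  \<comment> \<open>For a fixed pair the sum over the group is \<open>d\<close> or 0, for a fixed
    group element the sum over the pairs is \<open>d * d\<close> or 0. Double counting gives
    \<open>card P * d = card M * (d * d)\<close> in the field, hence in the naturals.\<close>
  define P where "P = {p \<in> {..<d} \<times> {..<d}. \<forall>x\<in>carrier G. \<phi> x ^ fst p * \<psi> x ^ snd p = 1}"
  define M where "M = {x \<in> carrier G. \<phi> x = 1 \<and> \<psi> x = 1}"
  have "(\<Sum>x\<in>carrier G. \<phi> x ^ a * \<psi> x ^ b) = (if \<forall>x\<in>carrier G. \<phi> x ^ a * \<psi> x ^ b = 1 then of_nat d else 0)" for a b
  proof (cases "\<forall>x\<in>carrier G. \<phi> x ^ a * \<psi> x ^ b = 1")
    case True
    then show ?thesis
      using d(1) by (simp add: order_def)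
  next
    case False
    then obtain y where "y \<in> carrier G" "\<phi> y ^ a * \<psi> y ^ b \<noteq> 1"
      by blast
    then have "(\<Sum>x\<in>carrier G. \<phi> x ^ a * \<psi> x ^ b) = 0"
      using \<phi>(1) \<psi>(1) by (intro sum_character[OF fin]) (auto simp: power_mult_distrib)
    then show ?thesis
      unfolding if_not_P[OF False] .
  qed
  then have "(\<Sum>p\<in>{..<d} \<times> {..<d}. \<Sum>x\<in>carrier G. \<phi> x ^ fst p * \<psi> x ^ snd p)
      = (\<Sum>p\<in>{..<d} \<times> {..<d}. if \<forall>x\<in>carrier G. \<phi> x ^ fst p * \<psi> x ^ snd p = 1 then of_nat d else 0)"
    by simp
  also have "\<dots> = of_nat (card P * d)"
    by (simp add: P_def sum.If_cases Int_def)
  finally have 1: "(\<Sum>p\<in>{..<d} \<times> {..<d}. \<Sum>x\<in>carrier G. \<phi> x ^ fst p * \<psi> x ^ snd p) = of_nat (card P * d)" .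
  have "(\<Sum>p\<in>{..<d} \<times> {..<d}. \<Sum>x\<in>carrier G. \<phi> x ^ fst p * \<psi> x ^ snd p)
      = (\<Sum>x\<in>carrier G. (\<Sum>a<d. \<phi> x ^ a) * (\<Sum>b<d. \<psi> x ^ b))"
    by (subst sum.swap) (simp add: sum_product sum.cartesian_product case_prod_beta)
  also have "\<dots> = (\<Sum>x\<in>carrier G. if \<phi> x = 1 \<and> \<psi> x = 1 then of_nat (d * d) else 0)"
    using \<phi>(2) \<psi>(2) by (intro sum.cong refl) (simp add: sum_powers_root_of_unity)
  also have "\<dots> = of_nat (card M * (d * d))"
    using fin by (simp add: M_def sum.If_cases Int_def)
  finally have "card P * d = card M * (d * d)"
    using 1 by (metis of_nat_eq_iff)
  then have "card P = card M * d"
    using d(2) by simp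
  moreover have "\<phi> \<one> = 1" "\<psi> \<one> = 1"
    using \<phi>(1)[of \<one> \<one>] \<phi>(2)[of \<one>] \<psi>(1)[of \<one> \<one>] \<psi>(2)[of \<one>] d(2) by (auto simp: power_0_left)
  then have "card M > 0"
    using fin by (auto simp: M_def card_gt_0_iff)
  ultimately have "card P \<ge> 2"
    using d(2) mult_le_mono[of 1 "card M" 2 d] by simp
  then have "\<not> P \<subseteq> {(0, 0)}"
    using card_mono[of "{(0, 0)}" P] by auto
  then obtain p where "p \<in> P" "p \<noteq> (0, 0)"
    by blast
  then show ?thesis
    using that[of "fst p" "snd p"] by (auto simp: P_def)
qed

section \<open>From diagonal matrices to conditions on exponents\<close>

lemma finite_monomials_of_degree: "finite {m :: ('v::finite) monomial. mdeg m = d}"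
proof (rule finite_imageD)
  have "Poly_Mapping.lookup m v \<le> mdeg m" for m :: "'v monomial" and v
    using member_le_sum[of v "Poly_Mapping.keys m" "Poly_Mapping.lookup m"]
    by (cases "v \<in> Poly_Mapping.keys m") (auto simp: mdeg_def in_keys_iff)
  then have "Poly_Mapping.lookup ` {m :: 'v monomial. mdeg m = d} \<subseteq> (UNIV \<rightarrow>\<^sub>E {..d})"
    by (auto simp: PiE_iff)
  then show "finite (Poly_Mapping.lookup ` {m :: 'v monomial. mdeg m = d})"
    by (rule finite_subset) (simp add: finite_PiE)
  show "inj_on Poly_Mapping.lookup {m :: 'v monomial. mdeg m = d}"
    by (rule inj_onI) (simp only: lookup_inject)
qed

lemma diag_act_monomial:
  fixes g :: "'k::field ^ 'n ^ 'n"
  shows "diag_act g (Poly_Mapping.single m 1) = Poly_Mapping.single m (\<Prod>v\<in>UNIV. (g $ v $ v) ^ Poly_Mapping.lookup m v)"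
proof -
  have power: "Poly_Mapping.single (Poly_Mapping.single v 1) c ^ n = Poly_Mapping.single (Poly_Mapping.single v n) (c ^ n)"
    for v :: 'n and c :: 'k and n
    by (induction n) (auto simp: mult_single single_add[symmetric])
  have "diag_act g (Poly_Mapping.single m 1) =
      (\<Prod>v\<in>Poly_Mapping.keys m. Poly_Mapping.single (Poly_Mapping.single v (Poly_Mapping.lookup m v)) ((g $ v $ v) ^ Poly_Mapping.lookup m v))"
    using power by (simp add: diag_act_def mpoly_subst_def mult_single)
  also have "\<dots> = Poly_Mapping.single m (\<Prod>v\<in>Poly_Mapping.keys m. (g $ v $ v) ^ Poly_Mapping.lookup m v)"
    unfolding prod_single poly_mapping_sum_single ..
  also have "(\<Prod>v\<in>Poly_Mapping.keys m. (g $ v $ v) ^ Poly_Mapping.lookup m v)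
      = (\<Prod>v\<in>UNIV. (g $ v $ v) ^ Poly_Mapping.lookup m v)"
    by (rule prod.mono_neutral_left) (auto simp: in_keys_iff)
  finally show ?thesis .
qed

lemma prod_UNIV_3: "prod f (UNIV :: 3 set) = f 1 * f 2 * f 3"
  unfolding UNIV_3 by (simp add: ac_simps)

lemma diagonal_mult:
  assumes "diagonal_matrix g"
  shows "(g ** h) $ v $ v = g $ v $ v * h $ v $ v"
proof -
  have "(g ** h) $ v $ v = (\<Sum>w\<in>UNIV. if w = v then g $ v $ v * h $ v $ v else 0)"
    using assms by (simp only: matrix_matrix_mult_def vec_lambda_beta)
      (rule sum.cong, auto simp: diagonal_matrix_def)
  then show ?thesis
    by simp
qed

theorem theorem4p6:
  fixes G :: "('k::{alg_closed_field, field_char_0} ^ 3 ^ 3) set" and d :: nat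
  assumes "subgroup G GL"
    and "comm_group (GL\<lparr>carrier := G\<rparr>)"
    and "finite G"
    and "card G = d"
    and "\<forall>g\<in>G. diagonal_matrix g"
    and "d \<ge> 2"
  shows
    "(koszul
        (toric_coordinate_ring (invariant_monomials G d)
          :: (3 monomial, 'k) mpoly set ring)
        (toric_grading (invariant_monomials G d))
      \<longleftrightarrow> (\<exists>m \<in> invariant_monomials G d. card (Poly_Mapping.keys m) = 2)) \<and>
     ((\<exists>m \<in> invariant_monomials G d. card (Poly_Mapping.keys m) = 2)
      \<longleftrightarrow> generated_by_quadrics (invariant_monomials G d)
            (toric_ideal (invariant_monomials G d) :: (3 monomial, 'k) mpoly set))"
proof -
  let ?B = "invariant_monomials G d"
  interpret H: comm_group "GL\<lparr>carrier := G\<rparr>"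
    by fact
  have mult: "(x \<otimes>\<^bsub>GL\<lparr>carrier := G\<rparr>\<^esub> y) $ v $ v = x $ v $ v * y $ v $ v" if "x \<in> G" for x y v
    using that assms(5) by (simp add: GL_def diagonal_mult)
  have one: "\<one>\<^bsub>GL\<^esub> $ v $ v = (1 :: 'k)" for v :: 3
    by (simp add: GL_def mat_def)
  have pow: "(x [^]\<^bsub>GL\<lparr>carrier := G\<rparr>\<^esub> n) $ v $ v = (x $ v $ v) ^ n" if "x \<in> G" for x v and n :: nat
    using that mult[OF H.nat_pow_closed[of x, simplified]] by (induction n) (simp_all add: one mult.commute)
  have order: "order (GL\<lparr>carrier := G\<rparr>) = d"
    using assms(4) by (simp add: order_def)
  have root: "(x $ v $ v) ^ d = 1" if "x \<in> G" for x v
    using H.pow_order_eq_1[of x] that pow[OF that, where n = d] by (simp add: order one)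
  have nz: "x $ v $ v \<noteq> 0" if "x \<in> G" for x v
    using root[OF that, of v] assms(6) by (auto simp: power_0_left)
  \<comment> \<open>Integer powers extend invariance to vectors with negative entries, as needed for
    a lattice.\<close>
  define \<Lambda> where "\<Lambda> a \<longleftrightarrow> (\<forall>x\<in>G. (\<Prod>v\<in>UNIV. (x $ v $ v) powi (a v)) = 1)" for a :: "3 \<Rightarrow> int"
  have \<Lambda>_iff: "\<Lambda> (exponents m) \<longleftrightarrow> (\<forall>x\<in>G. (\<Prod>v\<in>UNIV. (x $ v $ v) ^ Poly_Mapping.lookup m v) = 1)" for m
    by (simp add: \<Lambda>_def exponents_def)
  interpret T: triangle_family ?B d "TYPE('k)" \<Lambda>
  proof
    show "finite ?B"
      by (rule finite_subset[OF _ finite_monomials_of_degree[of d]]) (auto simp: invariant_monomials_def)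
    show "d > 0"
      using assms(6) by simp
    show "mdeg m = d" if "m \<in> ?B" for m
      using that by (simp add: invariant_monomials_def)
    show "\<Lambda> (\<lambda>v. a v + b v)" if "\<Lambda> a" "\<Lambda> b" for a b
      using that nz by (simp add: \<Lambda>_def power_int_add prod.distrib)
    show "\<Lambda> (\<lambda>v. - a v)" if "\<Lambda> a" for a
      using that by (simp add: \<Lambda>_def power_int_minus prod_inversef[unfolded o_def])
    show "\<Lambda> (\<lambda>v. if v = u then int d else 0)" for u
      using root by (simp add: \<Lambda>_def if_distrib[where f = "\<lambda>n. _ powi n"] cong: if_cong)
    show "m \<in> ?B \<longleftrightarrow> mdeg m = d \<and> \<Lambda> (exponents m)" for m
      unfolding invariant_monomials_def \<Lambda>_iff diag_act_monomial
      by (simp add: inj_eq[OF inj_single])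
  qed
  have koszul: "koszul (toric_coordinate_ring ?B :: (3 monomial, 'k) mpoly set ring) (toric_grading ?B)"
    if m: "m \<in> ?B" "card (Poly_Mapping.keys m) = 2" for m
  proof -
    obtain i j where ij: "Poly_Mapping.keys m = {i, j}" "i \<noteq> j"
      using m(2) by (auto simp: card_2_iff)
    obtain k where "k \<noteq> i" "k \<noteq> j"
      using third_index by blast
    then interpret E: triangle_with_edge ?B d "TYPE('k)" \<Lambda> i j k m
      using ij m(1) by unfold_locales auto
    show ?thesis
      by (rule E.koszul_triangle)
  qed
  have edge: "\<exists>m\<in>?B. card (Poly_Mapping.keys m) = 2"
    if quadrics: "generated_by_quadrics ?B (toric_ideal ?B :: (3 monomial, 'k) mpoly set)"
  proof (rule ccontr)
    assume "\<not> (\<exists>m\<in>?B. card (Poly_Mapping.keys m) = 2)"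
    then have no_edge: "\<forall>m\<in>?B. card (Poly_Mapping.keys m) \<noteq> 2"
      by blast
    \<comment> \<open>Dividing by the third entry leaves the third exponent free, so that it can be
      chosen to make the degree a multiple of \<open>d\<close>.\<close>
    obtain a b where ab: "a < d" "b < d" "(a, b) \<noteq> (0, 0)"
      and trivial: "\<And>x. x \<in> G \<Longrightarrow> (x $ 1 $ 1 / x $ 3 $ 3) ^ a * (x $ 2 $ 2 / x $ 3 $ 3) ^ b = 1"
      by (rule H.character_relation[where d = d and \<phi> = "\<lambda>x. x $ 1 $ 1 / x $ 3 $ 3" and \<psi> = "\<lambda>x. x $ 2 $ 2 / x $ 3 $ 3"])
         (use assms(3,6) order mult root in \<open>auto simp: power_divide\<close>)
    \<comment> \<open>The representative of \<open>- (a + b)\<close> modulo \<open>d\<close> in the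
      range below \<open>d\<close>; the outer \<open>mod\<close> sends the value \<open>d\<close> to
      0.\<close>
    define c where "c = (d - (a + b) mod d) mod d"
    have "(a + b + c) mod d = ((a + b) mod d + (d - (a + b) mod d)) mod d"
      by (simp only: c_def mod_add_left_eq mod_add_right_eq)
    also have "(a + b) mod d + (d - (a + b) mod d) = d"
      using assms(6) by (intro le_add_diff_inverse less_imp_le mod_less_divisor) simp
    finally have dvd: "d dvd a + b + c"
      by (simp only: mod_self dvd_eq_mod_eq_0)
    have c: "c < d"
      unfolding c_def using assms(6) by (intro mod_less_divisor) simp
    define m :: "3 monomial" where
      "m = Poly_Mapping.single 1 a + Poly_Mapping.single 2 b + Poly_Mapping.single 3 c"
    have m: "Poly_Mapping.lookup m 1 = a" "Poly_Mapping.lookup m 2 = b" "Poly_Mapping.lookup m 3 = c"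
      by (simp_all add: m_def lookup_add lookup_single)
    have "(\<Prod>v\<in>UNIV. (x $ v $ v) ^ Poly_Mapping.lookup m v) = 1" if x: "x \<in> G" for x
    proof -
      obtain k where k: "a + b + c = d * k"
        using dvd by (rule dvdE)
      have "(x $ 1 $ 1) ^ a * (x $ 2 $ 2) ^ b = (x $ 3 $ 3) ^ (a + b)"
        using trivial[OF x] nz[OF x] by (simp add: power_divide power_add field_simps)
      then have "(\<Prod>v\<in>UNIV. (x $ v $ v) ^ Poly_Mapping.lookup m v) = (x $ 3 $ 3) ^ (a + b + c)"
        by (simp only: prod_UNIV_3 m power_add)
      then show ?thesis
        using root[OF x] by (simp add: k power_mult)
    qed
    then have "m \<in> T.cone"
      using dvd by (simp add: T.cone_def \<Lambda>_iff mdeg_3[of 1 2 3] m)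
    moreover have "m \<noteq> 0"
      using ab(3) m by auto
    moreover have "Poly_Mapping.lookup m v < d" for v
      using exhaust_3[of v] ab c m by auto
    ultimately obtain p where "p \<in> ?B" "\<forall>v. p \<noteq> T.vertex v"
      using T.box_element by blast
    then show False
      using T.not_quadratic[OF no_edge] quadrics by blast
  qed
  show ?thesis
    using koszul edge T.koszul_quadratic by blast
qed

end
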